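(* Let $\mathcal{H}$ be a finite central irreducible real hyperplane arrangement in $\mathbb{R}^n$ with base region $B$. Let $C'\lessdot C$ and $D'\lessdot D$ be cover relations in the poset of regions $\mathrm{Weak}(\mathcal{H},B)$, with corresponding edges $C'\xrightarrow{e}C$ and $D'\xrightarrow{f}D$ of the Salvetti complex. Then $\ell_e=\ell_f$ in $\pi_1(\mathrm{Sal}(\mathcal{H}),B)$ if and only if $\Sigma(e)=\Sigma(f)$.
   Context: Regions of $\mathcal{H}$ are the connected components of $\mathbb{R}^n\setminus\bigcup\mathcal{H}$; $\mathcal{R}$ is the set of regions. For regions $C,C'$, $\mathrm{inv}(C,C')$ is the set of hyperplanes separating them; fix a base region $B$ and put $\mathrm{inv}(C)=\mathrm{inv}(B,C)$; $-C$ is the region with $\mathrm{inv}(C,-C)=\mathcal{H}$. The poset of regions $\mathrm{Weak}(\mathcal{H},B)$ orders $\mathcal{R}$ by $C\le C'$ iff $\mathrm{inv}(C)\subseteq\mathrm{inv}(C')$. Irreducible means: there is no linear automorphism $\theta$ of $\mathbb{R}^n$ and partition $\mathcal{H}=\mathcal{H}_1\sqcup\mathcal{H}_2$ into nonempty parts such that every normal vector of a hyperplane of $\theta(\mathcal{H}_1)$ is orthogonal to every normal vector of a hyperplane of $\theta(\mathcal{H}_2)$. Salvetti complex (2-skeleton, which determines $\pi_1$): vertices are the regions; for each ordered pair $(D,D')$ of regions separated by exactly one hyperplane there is one directed edge $D\to D'$. For a cover $C'\lessdot C$ we write $e$ for the edge $C'\to C$ and $e^*$ for the edge $C\to C'$.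 A positive gallery is a directed edge path; it is minimal if its length from $D$ to $D'$ equals $|\mathrm{inv}(D,D')|$. For every codimension-2 face $F$ of the arrangement and every region $C$ with $F\subseteq\overline{C}$, let $C^F$ be the region whose closure contains $F$ and which is separated from $C$ exactly by the hyperplanes containing $F$; there are exactly two positive minimal galleries from $C$ to $C^F$ through regions whose closures contain $F$, and a 2-cell is glued along them. $\pi_1(\mathrm{Sal}(\mathcal{H}),B)$ is the fundamental group with base vertex $B$ (it is isomorphic to $\pi_1$ of the complement of the complexified arrangement). Any two positive minimal galleries between the same regions are homotopic; $\mathrm{gal}(D,D')$ denotes any one. For a cover $C'\lessdot C$ with edge $e$, $\ell_e:=\mathrm{gal}(B,C')\cdot e\, e^*\cdot\mathrm{gal}(B,C')^{-1}$. Shards: a full rank-2 subarrangement is the set $\mathcal{A}$ of all hyperplanes of $\mathcal{H}$ containing a given codimension-2 subspace, when this set has at least two elements; $B_\mathcal{A}$ is the region of $\mathcal{A}$ containing $B$; $H\in\mathcal{A}$ is basic if $H\cap\partial B_\mathcal{A}$ has dimension $n-1$. $H$ cuts $H'$ if both lie in a common full rank-2 subarrangement in which $H$ is basic and $H'$ is not. The shards of $H\in\mathcal{H}$ are the closures of the connected components of $H$ minus the union of the hyperplanes cutting $H$. For a cover $C'\lessdot C$ (edge $e$), $\Sigma(e)=\Sigma(C'\lessdot C)$ is the unique shard containing the $(n-1)$-dimensional set $\overline{C'}\cap\overline{C}$. *)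

theory Defs
  imports "HOL-Analysis.Analysis" "HOL-Algebra.Group"
begin

section \<open>Arrangements, regions and the poset of regions\<close>

definition normal_of :: "'a::euclidean_space set \<Rightarrow> 'a \<Rightarrow> bool" where
  "normal_of H u \<longleftrightarrow> u \<noteq> 0 \<and> H = {x. u \<bullet> x = 0}"

text \<open>Central means that all hyperplanes are linear, i.e. pass through the origin.\<close>

definition central_arrangement :: "'a::euclidean_space set set \<Rightarrow> bool" where
  "central_arrangement \<H> \<longleftrightarrow> finite \<H> \<and> (\<forall>H\<in>\<H>. \<exists>u. normal_of H u)"

definition irreducible_arrangement :: "'a::euclidean_space set set \<Rightarrow> bool" where
  "irreducible_arrangement \<H> \<longleftrightarrow>
     \<not> (\<exists>(\<theta> :: 'a \<Rightarrow> 'a) \<H>1 \<H>2. linear \<theta> \<and> bij \<theta> \<and>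
          \<H>1 \<union> \<H>2 = \<H> \<and> \<H>1 \<inter> \<H>2 = {} \<and> \<H>1 \<noteq> {} \<and> \<H>2 \<noteq> {} \<and>
          (\<forall>H1\<in>\<H>1. \<forall>H2\<in>\<H>2. \<forall>u v.
             normal_of (\<theta> ` H1) u \<longrightarrow> normal_of (\<theta> ` H2) v \<longrightarrow> u \<bullet> v = 0))"

definition regions :: "'a::euclidean_space set set \<Rightarrow> 'a set set" where
  "regions \<H> = components (UNIV - \<Union>\<H>)"

definition separates :: "'a::euclidean_space set \<Rightarrow> 'a set \<Rightarrow> 'a set \<Rightarrow> bool" where
  "separates H C C' \<longleftrightarrow>
     (\<exists>u. normal_of H u \<and> (\<forall>x\<in>C. u \<bullet> x < 0) \<and> (\<forall>x\<in>C'. u \<bullet> x > 0))"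

definition sep_set :: "'a::euclidean_space set set \<Rightarrow> 'a set \<Rightarrow> 'a set \<Rightarrow> 'a set set" where
  "sep_set \<H> C C' = {H \<in> \<H>. separates H C C'}"

definition weak_le :: "'a::euclidean_space set set \<Rightarrow> 'a set \<Rightarrow> 'a set \<Rightarrow> 'a set \<Rightarrow> bool" where
  "weak_le \<H> B C C' \<longleftrightarrow>
     C \<in> regions \<H> \<and> C' \<in> regions \<H> \<and> sep_set \<H> B C \<subseteq> sep_set \<H> B C'"

definition weak_less :: "'a::euclidean_space set set \<Rightarrow> 'a set \<Rightarrow> 'a set \<Rightarrow> 'a set \<Rightarrow> bool" where
  "weak_less \<H> B C C' \<longleftrightarrow> weak_le \<H> B C C' \<and> C \<noteq> C'"

text \<open>\<open>weak_cover \<H> B C' C\<close>: in the poset of regions based at \<open>B\<close>, \<open>C\<close> covers \<open>C'\<close>.\<close>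

definition weak_cover :: "'a::euclidean_space set set \<Rightarrow> 'a set \<Rightarrow> 'a set \<Rightarrow> 'a set \<Rightarrow> bool" where
  "weak_cover \<H> B C' C \<longleftrightarrow>
     weak_less \<H> B C' C \<and> \<not> (\<exists>E. weak_less \<H> B C' E \<and> weak_less \<H> B E C)"


section \<open>The Salvetti complex and its fundamental group\<close>

definition sal_edges :: "'a::euclidean_space set set \<Rightarrow> ('a set \<times> 'a set) set" where
  "sal_edges \<H> =
     {(D, D'). D \<in> regions \<H> \<and> D' \<in> regions \<H> \<and> card (sep_set \<H> D D') = 1}"

text \<open>
  An edge may be traversed along or against its direction. Traversing \<open>(D, D')\<close> against
  its direction and traversing the edge \<open>(D', D)\<close> along its direction are different steps.
\<close>

datatype 'a step = Along "'a set \<times> 'a set" | Against "'a set \<times> 'a set"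

fun step_edge :: "'a step \<Rightarrow> 'a set \<times> 'a set" where
  "step_edge (Along e) = e"
| "step_edge (Against e) = e"

fun step_source :: "'a step \<Rightarrow> 'a set" where
  "step_source (Along e) = fst e"
| "step_source (Against e) = snd e"

fun step_target :: "'a step \<Rightarrow> 'a set" where
  "step_target (Along e) = snd e"
| "step_target (Against e) = fst e"

fun step_rev :: "'a step \<Rightarrow> 'a step" where
  "step_rev (Along e) = Against e"
| "step_rev (Against e) = Along e"

definition path_rev :: "'a step list \<Rightarrow> 'a step list" where
  "path_rev p = rev (map step_rev p)"

fun sal_path :: "'a::euclidean_space set set \<Rightarrow> 'a set \<Rightarrow> 'a step list \<Rightarrow> 'a set \<Rightarrow> bool" where
  "sal_path \<H> D [] E \<longleftrightarrow> D \<in> regions \<H> \<and> D = E"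
| "sal_path \<H> D (s # p) E \<longleftrightarrow>
     step_edge s \<in> sal_edges \<H> \<and> step_source s = D \<and> sal_path \<H> (step_target s) p E"

definition positive_gallery ::
    "'a::euclidean_space set set \<Rightarrow> 'a set \<Rightarrow> 'a step list \<Rightarrow> 'a set \<Rightarrow> bool" where
  "positive_gallery \<H> D g E \<longleftrightarrow> sal_path \<H> D g E \<and> set g \<subseteq> range Along"

definition minimal_gallery ::
    "'a::euclidean_space set set \<Rightarrow> 'a set \<Rightarrow> 'a step list \<Rightarrow> 'a set \<Rightarrow> bool" where
  "minimal_gallery \<H> D g E \<longleftrightarrow>
     positive_gallery \<H> D g E \<and> length g = card (sep_set \<H> D E)"

text \<open>
  Faces of the arrangement are the (closed) nonempty faces of the closures of its regions.
  Nonemptiness matters: in dimension one, the empty set has affine dimension \<open>1 - 2\<close>.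
\<close>

definition codim2_face :: "'a::euclidean_space set set \<Rightarrow> 'a set \<Rightarrow> bool" where
  "codim2_face \<H> F \<longleftrightarrow>
     F \<noteq> {} \<and> aff_dim F = int DIM('a) - 2 \<and> (\<exists>C\<in>regions \<H>. F face_of closure C)"

definition opposite_at ::
    "'a::euclidean_space set set \<Rightarrow> 'a set \<Rightarrow> 'a set \<Rightarrow> 'a set \<Rightarrow> bool" where
  "opposite_at \<H> F C C\<^sub>F \<longleftrightarrow>
     C\<^sub>F \<in> regions \<H> \<and> F \<subseteq> closure C\<^sub>F \<and> sep_set \<H> C C\<^sub>F = {H \<in> \<H>. F \<subseteq> H}"

definition gallery_around :: "'a::euclidean_space set \<Rightarrow> 'a step list \<Rightarrow> bool" where
  "gallery_around F g \<longleftrightarrow>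
     (\<forall>s\<in>set g. F \<subseteq> closure (step_source s) \<and> F \<subseteq> closure (step_target s))"

text \<open>
  A 2-cell, given by the pair of galleries along which it is glued. The degenerate case
  \<open>g = g'\<close> is not excluded; it only contributes trivial homotopies.
\<close>

definition sal_cell ::
    "'a::euclidean_space set set \<Rightarrow> 'a step list \<Rightarrow> 'a step list \<Rightarrow> bool" where
  "sal_cell \<H> g g' \<longleftrightarrow>
     (\<exists>F C C\<^sub>F. codim2_face \<H> F \<and> C \<in> regions \<H> \<and> F \<subseteq> closure C \<and> opposite_at \<H> F C C\<^sub>F \<and>
        minimal_gallery \<H> C g C\<^sub>F \<and> gallery_around F g \<and>
        minimal_gallery \<H> C g' C\<^sub>F \<and> gallery_around F g')"

text \<open>
  Homotopy relative to endpoints of edge paths in the 2-complex: the equivalence relation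
  generated by deleting backtracks and pushing a path across a 2-cell.
\<close>

inductive sal_homotopic ::
    "'a::euclidean_space set set \<Rightarrow> 'a set \<Rightarrow> 'a set \<Rightarrow> 'a step list \<Rightarrow> 'a step list \<Rightarrow> bool"
  for \<H> D E where
  refl: "sal_path \<H> D p E \<Longrightarrow> sal_homotopic \<H> D E p p"
| sym: "sal_homotopic \<H> D E p q \<Longrightarrow> sal_homotopic \<H> D E q p"
| trans: "sal_homotopic \<H> D E p q \<Longrightarrow> sal_homotopic \<H> D E q r \<Longrightarrow> sal_homotopic \<H> D E p r"
| backtrack: "sal_path \<H> D (p @ [s, step_rev s] @ q) E \<Longrightarrow>
    sal_homotopic \<H> D E (p @ [s, step_rev s] @ q) (p @ q)"
| cell: "sal_path \<H> D (p @ g @ q) E \<Longrightarrow> sal_cell \<H> g g' \<Longrightarrow>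
    sal_homotopic \<H> D E (p @ g @ q) (p @ g' @ q)"

definition loop_class ::
    "'a::euclidean_space set set \<Rightarrow> 'a set \<Rightarrow> 'a step list \<Rightarrow> 'a step list set" where
  "loop_class \<H> B p = {q. sal_homotopic \<H> B B p q}"

text \<open>The edge-path group, i.e. the fundamental group of the 2-complex based at the vertex \<open>B\<close>.\<close>

definition sal_pi1 :: "'a::euclidean_space set set \<Rightarrow> 'a set \<Rightarrow> 'a step list set monoid" where
  "sal_pi1 \<H> B =
     \<lparr>carrier = {loop_class \<H> B p | p. sal_path \<H> B p B},
      mult = (\<lambda>X Y. \<Union>p\<in>X. \<Union>q\<in>Y. loop_class \<H> B (p @ q)),
      one = loop_class \<H> B []\<rparr>"

definition gal :: "'a::euclidean_space set set \<Rightarrow> 'a set \<Rightarrow> 'a set \<Rightarrow> 'a step list" where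
  "gal \<H> D D' = (SOME g. minimal_gallery \<H> D g D')"

definition ell ::
    "'a::euclidean_space set set \<Rightarrow> 'a set \<Rightarrow> 'a set \<times> 'a set \<Rightarrow> 'a step list set" where
  "ell \<H> B = (\<lambda>(C', C). loop_class \<H> B
     (gal \<H> B C' @ [Along (C', C), Along (C, C')] @ path_rev (gal \<H> B C')))"

lemma sal_edges_regions: "e \<in> sal_edges \<H> \<Longrightarrow> fst e \<in> regions \<H> \<and> snd e \<in> regions \<H>"
  by (auto simp: sal_edges_def)

lemma sal_path_ends: "sal_path \<H> D p E \<Longrightarrow> D \<in> regions \<H> \<and> E \<in> regions \<H>"
proof (induction p arbitrary: D)
  case (Cons s p)
  then show ?case by (cases s) (auto dest: sal_edges_regions)
qed auto

lemma sal_path_append: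
  "sal_path \<H> D (p @ q) E \<longleftrightarrow> (\<exists>M. sal_path \<H> D p M \<and> sal_path \<H> M q E)"
proof (induction p arbitrary: D)
  case Nil
  then show ?case using sal_path_ends by auto
qed auto

lemma sal_path_single [simp]:
  "sal_path \<H> D [s] E \<longleftrightarrow> step_edge s \<in> sal_edges \<H> \<and> step_source s = D \<and> step_target s = E"
  by (cases s) (auto dest: sal_edges_regions)

lemma sal_path_end_unique: "sal_path \<H> D p E \<Longrightarrow> sal_path \<H> D p E' \<Longrightarrow> E = E'"
  by (induction p arbitrary: D) auto

lemma step_rev_simps [simp]:
  "step_rev (step_rev s) = s" "step_edge (step_rev s) = step_edge s"
  "step_source (step_rev s) = step_target s" "step_target (step_rev s) = step_source s"
  by (cases s; simp)+

lemma sal_path_rev: "sal_path \<H> D p E \<Longrightarrow> sal_path \<H> E (path_rev p) D"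
proof (induction p arbitrary: D)
  case Nil
  then show ?case by (auto simp: path_rev_def)
next
  case (Cons s p)
  then have "sal_path \<H> E (path_rev p) (step_target s)" by auto
  moreover have "sal_path \<H> (step_target s) [step_rev s] D"
    using Cons.prems by (cases s) (auto dest: sal_edges_regions)
  ultimately show ?case by (auto simp: path_rev_def sal_path_append)
qed

lemma sal_homotopic_path:
  "sal_homotopic \<H> D E p q \<Longrightarrow> sal_path \<H> D p E \<and> sal_path \<H> D q E"
proof (induction rule: sal_homotopic.induct)
  case (backtrack p s q)
  then obtain M N where "sal_path \<H> D p M" "sal_path \<H> M [s, step_rev s] N" "sal_path \<H> N q E"
    by (auto simp only: sal_path_append)
  moreover from this(2) have "M = N" by auto
  ultimately show ?case using backtrack by (auto simp only: sal_path_append)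
next
  case (cell p g q g')
  then obtain M N where *: "sal_path \<H> D p M" "sal_path \<H> M g N" "sal_path \<H> N q E"
    by (auto simp only: sal_path_append)
  from cell obtain C K where g: "sal_path \<H> C g K" "sal_path \<H> C g' K" "length g = length g'"
    unfolding sal_cell_def minimal_gallery_def positive_gallery_def by metis
  have "sal_path \<H> M g' N"
  proof (cases g)
    case Nil
    then show ?thesis using g * by auto
  next
    case (Cons s g0)
    then have "M = C" using g * by auto
    then show ?thesis using g * sal_path_end_unique by metis
  qed
  then show ?case using cell * by (auto simp only: sal_path_append)
qed auto

lemma sal_homotopic_extend:
  assumes "sal_homotopic \<H> D E p q" "sal_path \<H> D' a D" "sal_path \<H> E b E'"
  shows "sal_homotopic \<H> D' E' (a @ p @ b) (a @ q @ b)"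
  using assms(1)
proof (induction rule: sal_homotopic.induct)
  case (refl p)
  then have "sal_path \<H> D' (a @ p @ b) E'"
    using assms(2,3) unfolding sal_path_append by blast
  then show ?case by (rule sal_homotopic.refl)
next
  case (backtrack p s q)
  then have "sal_path \<H> D' ((a @ p) @ [s, step_rev s] @ (q @ b)) E'"
    using assms by (simp only: sal_path_append append_assoc) blast
  from sal_homotopic.backtrack[OF this] show ?case by simp
next
  case (cell p g q g')
  then have "sal_path \<H> D' ((a @ p) @ g @ (q @ b)) E'"
    using assms by (simp only: sal_path_append append_assoc) blast
  from sal_homotopic.cell[OF this cell(2)] show ?case by simp
next
  case (sym p q)
  show ?case by (rule sal_homotopic.sym) (rule sym.IH)
next
  case (trans p q r)
  show ?case by (rule sal_homotopic.trans) (rule trans.IH)+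
qed

lemma sal_homotopic_append:
  assumes "sal_homotopic \<H> D E p p'" "sal_homotopic \<H> E K q q'"
  shows "sal_homotopic \<H> D K (p @ q) (p' @ q')"
proof -
  have P: "sal_path \<H> D p E" "sal_path \<H> D p' E" "sal_path \<H> E q K"
    using assms sal_homotopic_path by blast+
  have "sal_homotopic \<H> D K (p @ q) (p' @ q)"
    using sal_homotopic_extend[OF assms(1), of D "[]" q K] P sal_path_ends by force
  moreover have "sal_homotopic \<H> D K (p' @ q) (p' @ q')"
    using sal_homotopic_extend[OF assms(2) P(2), of "[]" K] P sal_path_ends by force
  ultimately show ?thesis by (rule sal_homotopic.trans)
qed

lemma sal_homotopic_path_rev_left:
  "sal_path \<H> D p E \<Longrightarrow> sal_homotopic \<H> E E (path_rev p @ p) []"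
proof (induction p arbitrary: D)
  case Nil
  then show ?case by (auto simp: path_rev_def intro: sal_homotopic.refl)
next
  case (Cons s p)
  define T where "T = step_target s"
  have p: "sal_path \<H> T p E" "sal_path \<H> E (path_rev p) T" and s: "sal_path \<H> D [s] T"
    using Cons.prems sal_path_rev[of \<H> T p E]
    by (cases s; auto simp: T_def dest: sal_edges_regions)+
  have "sal_path \<H> T [step_rev s, s] T"
    using s sal_path_ends[OF s] by (auto simp: T_def)
  then have "sal_path \<H> E (path_rev p @ [step_rev s, step_rev (step_rev s)] @ p) E"
    using p by (simp only: sal_path_append step_rev_simps) blast
  from sal_homotopic.backtrack[OF this]
  have "sal_homotopic \<H> E E (path_rev (s # p) @ (s # p)) (path_rev p @ p)"
    by (simp add: path_rev_def)
  then show ?case using Cons.IH[OF p(1)] by (rule sal_homotopic.trans)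
qed

lemma loop_class_eq_iff:
  assumes "sal_path \<H> B p B"
  shows "loop_class \<H> B p = loop_class \<H> B q \<longleftrightarrow> sal_homotopic \<H> B B p q"
proof
  assume "loop_class \<H> B p = loop_class \<H> B q"
  moreover have "p \<in> loop_class \<H> B p"
    using assms by (simp add: loop_class_def sal_homotopic.refl)
  ultimately show "sal_homotopic \<H> B B p q"
    by (simp add: loop_class_def sal_homotopic.sym)
next
  assume *: "sal_homotopic \<H> B B p q"
  show "loop_class \<H> B p = loop_class \<H> B q"
    unfolding loop_class_def
    using sal_homotopic.trans[OF *] sal_homotopic.trans[OF sal_homotopic.sym[OF *]] by blast
qed

lemma loop_class_mult:
  assumes "sal_path \<H> B p B" "sal_path \<H> B q B"
  shows "loop_class \<H> B p \<otimes>\<^bsub>sal_pi1 \<H> B\<^esub> loop_class \<H> B q = loop_class \<H> B (p @ q)"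
proof -
  have "loop_class \<H> B (p' @ q') = loop_class \<H> B (p @ q)"
    if "p' \<in> loop_class \<H> B p" "q' \<in> loop_class \<H> B q" for p' q'
  proof -
    have "sal_homotopic \<H> B B (p @ q) (p' @ q')"
      using that by (auto simp: loop_class_def intro: sal_homotopic_append)
    moreover have "sal_path \<H> B (p @ q) B"
      using assms by (auto simp: sal_path_append)
    ultimately show ?thesis using loop_class_eq_iff by blast
  qed
  moreover have "p \<in> loop_class \<H> B p" "q \<in> loop_class \<H> B q"
    using assms by (auto simp: loop_class_def intro: sal_homotopic.refl)
  ultimately have "(\<Union>p'\<in>loop_class \<H> B p. \<Union>q'\<in>loop_class \<H> B q. loop_class \<H> B (p' @ q'))
      = loop_class \<H> B (p @ q)"
    by blast
  then show ?thesis by (simp add: sal_pi1_def)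
qed

lemma group_sal_pi1:
  assumes "B \<in> regions \<H>"
  shows "group (sal_pi1 \<H> B)"
proof -
  let ?G = "sal_pi1 \<H> B"
  have carI: "loop_class \<H> B p \<in> carrier ?G" if "sal_path \<H> B p B" for p
    using that by (auto simp: sal_pi1_def)
  have carE: "\<exists>p. sal_path \<H> B p B \<and> x = loop_class \<H> B p" if "x \<in> carrier ?G" for x
    using that by (auto simp: sal_pi1_def)
  have one: "\<one>\<^bsub>?G\<^esub> = loop_class \<H> B []" by (simp add: sal_pi1_def)
  have nil: "sal_path \<H> B [] B" using assms by simp
  have app: "sal_path \<H> B (p @ q) B" if "sal_path \<H> B p B" "sal_path \<H> B q B" for p q
    using that by (auto simp: sal_path_append)
  show ?thesis
  proof (rule groupI)
    fix x y
    assume "x \<in> carrier ?G" "y \<in> carrier ?G"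
    then obtain p q where "sal_path \<H> B p B" "x = loop_class \<H> B p"
        "sal_path \<H> B q B" "y = loop_class \<H> B q"
      using carE by metis
    then show "x \<otimes>\<^bsub>?G\<^esub> y \<in> carrier ?G"
      by (simp add: loop_class_mult app carI)
  next
    show "\<one>\<^bsub>?G\<^esub> \<in> carrier ?G"
      unfolding one by (rule carI[OF nil])
  next
    fix x y z
    assume "x \<in> carrier ?G" "y \<in> carrier ?G" "z \<in> carrier ?G"
    then obtain p q r where "sal_path \<H> B p B" "x = loop_class \<H> B p"
        "sal_path \<H> B q B" "y = loop_class \<H> B q" "sal_path \<H> B r B" "z = loop_class \<H> B r"
      using carE by metis
    then show "x \<otimes>\<^bsub>?G\<^esub> y \<otimes>\<^bsub>?G\<^esub> z = x \<otimes>\<^bsub>?G\<^esub> (y \<otimes>\<^bsub>?G\<^esub> z)"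
      by (simp add: loop_class_mult app)
  next
    fix x
    assume "x \<in> carrier ?G"
    then obtain p where p: "sal_path \<H> B p B" "x = loop_class \<H> B p"
      using carE by metis
    show "\<one>\<^bsub>?G\<^esub> \<otimes>\<^bsub>?G\<^esub> x = x"
      unfolding one p(2) loop_class_mult[OF nil p(1)] by simp
    note r = sal_path_rev[OF p(1)]
    have "loop_class \<H> B (path_rev p) \<otimes>\<^bsub>?G\<^esub> x = loop_class \<H> B (path_rev p @ p)"
      unfolding p(2) by (rule loop_class_mult[OF r p(1)])
    also have "\<dots> = \<one>\<^bsub>?G\<^esub>"
      unfolding one loop_class_eq_iff[OF app[OF r p(1)]]
      by (rule sal_homotopic_path_rev_left[OF p(1)])
    finally show "\<exists>y\<in>carrier ?G. y \<otimes>\<^bsub>?G\<^esub> x = \<one>\<^bsub>?G\<^esub>"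
      using carI[OF r] by blast
  qed
qed


section \<open>Shards\<close>

definition full_rank2 :: "'a::euclidean_space set set \<Rightarrow> 'a set set \<Rightarrow> bool" where
  "full_rank2 \<H> \<A> \<longleftrightarrow>
     (\<exists>U. subspace U \<and> dim U + 2 = DIM('a) \<and> \<A> = {H \<in> \<H>. U \<subseteq> H}) \<and> card \<A> \<ge> 2"

definition base_region :: "'a::euclidean_space set set \<Rightarrow> 'a set \<Rightarrow> 'a set" where
  "base_region \<A> B = (THE R. R \<in> regions \<A> \<and> B \<subseteq> R)"

definition basic :: "'a::euclidean_space set set \<Rightarrow> 'a set \<Rightarrow> 'a set \<Rightarrow> bool" where
  "basic \<A> B H \<longleftrightarrow> H \<in> \<A> \<and> aff_dim (H \<inter> frontier (base_region \<A> B)) = int DIM('a) - 1"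

definition cuts :: "'a::euclidean_space set set \<Rightarrow> 'a set \<Rightarrow> 'a set \<Rightarrow> 'a set \<Rightarrow> bool" where
  "cuts \<H> B H H' \<longleftrightarrow>
     (\<exists>\<A>. full_rank2 \<H> \<A> \<and> H \<in> \<A> \<and> H' \<in> \<A> \<and> basic \<A> B H \<and> \<not> basic \<A> B H')"

definition shards_of :: "'a::euclidean_space set set \<Rightarrow> 'a set \<Rightarrow> 'a set \<Rightarrow> 'a set set" where
  "shards_of \<H> B H = closure ` components (H - \<Union>{H' \<in> \<H>. cuts \<H> B H' H})"

definition edge_shard ::
    "'a::euclidean_space set set \<Rightarrow> 'a set \<Rightarrow> 'a set \<times> 'a set \<Rightarrow> 'a set" where
  "edge_shard \<H> B = (\<lambda>(C', C).
     THE S. S \<in> (\<Union>H\<in>\<H>. shards_of \<H> B H) \<and> closure C' \<inter> closure C \<subseteq> S)"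

end

theory Submission
  imports Defs
begin

text \<open>
  Regions are sign vectors, and any two minimal galleries with the same ends are homotopic: push
  the ray from a point \<open>x\<close> of the first region towards the last one while \<open>x\<close> moves along a generic
  segment, so that the first wall it hits changes only at faces of codimension two.

  If \<open>\<Sigma>(e) = \<Sigma>(f)\<close>, join the two facets by a generic segment inside the shard. At each face of
  codimension two that it meets, the hyperplane \<open>H\<close> is basic, so the two edges lie over opposite
  sides of the same wall of the local base region, and two square relations identify the loops.

  Conversely, the loop determines \<open>H\<close> by counting crossings. If some \<open>K\<close> cutting \<open>H\<close> separates the
  two facets, then \<open>H\<close> lies strictly between \<open>K\<close> and a third hyperplane \<open>L\<close> of a rank two
  subarrangement. Forgetting all other hyperplanes maps the group to the pure braid group on three
  strands, where the two loops are conjugate but distinguished by a map to permutations of three points.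
\<close>

section \<open>Sign vectors of regions\<close>

text \<open>Faces of codimension above two carry no 2-cells, which is why both deformation arguments
  need generic segments. Each takes the form of a relation between parameters in [0,1] that holds
  locally and is then propagated by connectedness. For transitivity to have content, every
  intermediate parameter must supply a gallery (or an edge) of its own. Galleries are compared by
  induction on the number of separating hyperplanes, so that only their first walls matter.

  For the converse, conjugate loops agree in every abelian quotient; the permutations of three
  points form the smallest nonabelian target. No homomorphism of braid groups is constructed:
  directed edges are labelled by bijections, and an edge crossing none of \<open>K\<close>,
  \<open>H\<close>, \<open>L\<close> gets the identity. It suffices that transport along minimal
  galleries depends only on their ends. Labels are trivial away from \<open>B\<close>, hence the
  gallery in \<open>ell\<close> drops out and the loop acts by the label of its returning edge
  alone.\<close>

lemma connected_component_nonzero: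
  fixes n :: "'i \<Rightarrow> 'a::euclidean_space"
  assumes "convex T" "x \<in> T" "\<forall>i\<in>I. n i \<bullet> x \<noteq> 0"
  shows "connected_component_set {y\<in>T. \<forall>i\<in>I. n i \<bullet> y \<noteq> 0} x = {y\<in>T. \<forall>i\<in>I. 0 < (n i \<bullet> x) * (n i \<bullet> y)}"
    (is "connected_component_set ?S x = ?C")
proof
  show "?C \<subseteq> connected_component_set ?S x"
  proof (rule connected_component_maximal)
    show "x \<in> ?C" using assms by (auto simp: zero_less_mult_iff)
    have "convex ?C"
    proof (rule convexI)
      fix y z and u v :: real
      assume *: "y \<in> ?C" "z \<in> ?C" "0 \<le> u" "0 \<le> v" "u + v = 1"
      then have "u *\<^sub>R y + v *\<^sub>R z \<in> T" using assms(1) by (auto simp: convex_def)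
      moreover have "0 < (n i \<bullet> x) * (n i \<bullet> (u *\<^sub>R y + v *\<^sub>R z))" if "i \<in> I" for i
      proof -
        have "0 < (n i \<bullet> x) * (n i \<bullet> y)" "0 < (n i \<bullet> x) * (n i \<bullet> z)" using * that by auto
        moreover have "u > 0 \<or> v > 0" using * by linarith
        ultimately have "0 < u * ((n i \<bullet> x) * (n i \<bullet> y)) \<or> 0 < v * ((n i \<bullet> x) * (n i \<bullet> z))"
          "0 \<le> u * ((n i \<bullet> x) * (n i \<bullet> y))" "0 \<le> v * ((n i \<bullet> x) * (n i \<bullet> z))"
          using *(3,4) by (auto simp del: zero_less_mult_iff intro: mult_pos_pos mult_nonneg_nonneg less_imp_le)
        then have "0 < u * ((n i \<bullet> x) * (n i \<bullet> y)) + v * ((n i \<bullet> x) * (n i \<bullet> z))"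
          by linarith
        then show ?thesis by (simp add: inner_add_right algebra_simps)
      qed
      ultimately show "u *\<^sub>R y + v *\<^sub>R z \<in> ?C" by blast
    qed
    then show "connected ?C" by (rule convex_connected)
    show "?C \<subseteq> ?S" by auto
  qed
  show "connected_component_set ?S x \<subseteq> ?C"
  proof
    fix y assume "y \<in> connected_component_set ?S x"
    then obtain W where W: "connected W" "W \<subseteq> ?S" "x \<in> W" "y \<in> W"
      by (auto simp: connected_component_def)
    have "0 < (n i \<bullet> x) * (n i \<bullet> y)" if i: "i \<in> I" for i
    proof (rule ccontr)
      assume "\<not> 0 < (n i \<bullet> x) * (n i \<bullet> y)"
      moreover have "n i \<bullet> x \<noteq> 0" "n i \<bullet> y \<noteq> 0" using W i by auto
      ultimately have "n i \<bullet> x \<le> 0 \<and> 0 \<le> n i \<bullet> y \<or> n i \<bullet> y \<le> 0 \<and> 0 \<le> n i \<bullet> x"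
        unfolding zero_less_mult_iff by linarith
      then obtain z where "z \<in> W" "n i \<bullet> z = 0"
        using connected_ivt_hyperplane[OF W(1)] W(3,4) by metis
      then show False using W(2) i by auto
    qed
    then show "y \<in> ?C" using W by auto
  qed
qed

text \<open>Finitely many hyperplanes form a null set, and no nonempty open set fits into
  one.\<close>

lemma generic_point:
  fixes S :: "'a::euclidean_space set"
  assumes "open S" "S \<noteq> {}" "finite V" "0 \<notin> V"
  obtains x where "x \<in> S" "\<forall>v\<in>V. v \<bullet> x \<noteq> 0"
proof -
  have "negligible (\<Union>((\<lambda>v. {x. v \<bullet> x = 0}) ` V))"
    using assms by (intro negligible_Union) (auto intro: negligible_hyperplane)
  then have "\<not> S \<subseteq> (\<Union>v\<in>V. {x. v \<bullet> x = 0})"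
    using open_not_negligible[OF assms(1,2)] negligible_subset by blast
  then show ?thesis using that by auto
qed

text \<open>Perturbation principle: for small \<open>e > 0\<close> the sign of
  \<open>a + e * b\<close> is that of \<open>a\<close>, with ties broken by \<open>b\<close>. It
  serves whenever a boundary point is pushed slightly in a chosen direction.\<close>

lemma eventually_lex_positive:
  assumes "finite I" "\<forall>i\<in>I. 0 < a i \<or> a i = 0 \<and> 0 < (b i :: real)"
  shows "\<forall>\<^sub>F e in at_right 0. 0 < e \<and> (\<forall>i\<in>I. 0 < a i + e * b i)"
proof -
  have "\<forall>\<^sub>F e in at_right 0. 0 < a i + e * b i" if "i \<in> I" for i
  proof (cases "0 < a i")
    case True
    have "((\<lambda>e. a i + e * b i) \<longlongrightarrow> a i + 0 * b i) (at_right 0)"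
      by (intro tendsto_intros)
    then show ?thesis using True by (auto dest: order_tendstoD)
  next
    case False
    then show ?thesis using assms(2) that
      by (auto intro!: eventually_mono[OF eventually_at_right_less[of 0]])
  qed
  then show ?thesis using assms(1)
    by (auto simp: eventually_conj_iff eventually_at_right_less intro!: eventually_ball_finite)
qed

lemma lex_positive:
  assumes "finite I" "\<forall>i\<in>I. 0 < a i \<or> a i = 0 \<and> 0 < (b i :: real)"
  obtains e where "0 < e" "\<forall>i\<in>I. 0 < a i + e * b i"
  using eventually_happens[OF eventually_lex_positive[OF assms]] that
  by (auto simp: trivial_limit_at_right_real)

section \<open>Chosen normals and sign vectors\<close>

definition nrm :: "'a::euclidean_space set \<Rightarrow> 'a" where
  "nrm H = (SOME u. normal_of H u)"

text \<open>One point suffices because all points of a region agree, see \<open>pos_iff\<close>. The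
  sign refers to the fixed normal \<open>nrm H\<close>, so that signs of different regions can be
  compared.\<close>

definition pos :: "'a::euclidean_space set \<Rightarrow> 'a set \<Rightarrow> bool" where
  "pos R H \<longleftrightarrow> (\<exists>x\<in>R. 0 < nrm H \<bullet> x)"

definition orient :: "'a::euclidean_space set \<Rightarrow> 'a set \<Rightarrow> 'a" where
  "orient R H = (if pos R H then nrm H else - nrm H)"

definition through :: "'a::euclidean_space set set \<Rightarrow> 'a \<Rightarrow> 'a set set" where
  "through \<H> p = {H\<in>\<H>. p \<in> H}"

lemma through_subset: "through \<H> p \<subseteq> \<H>"
  by (auto simp: through_def)

lemma sep_set_subset: "sep_set \<H> R S \<subseteq> \<H>"
  by (auto simp: sep_set_def)

lemma normal_of_parallel:
  assumes "normal_of H u" "normal_of H v"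
  obtains c where "c \<noteq> 0" "v = c *\<^sub>R u"
proof -
  have z: "u \<noteq> 0" "v \<noteq> 0" and eq: "\<And>x. u \<bullet> x = 0 \<longleftrightarrow> v \<bullet> x = 0" using assms by (auto simp: normal_of_def)
  define c where "c = (u \<bullet> v) / (u \<bullet> u)"
  have "u \<bullet> (v - c *\<^sub>R u) = 0" using z by (simp add: c_def inner_diff_right)
  then have "v \<bullet> (v - c *\<^sub>R u) = 0" using eq by blast
  then have "(v - c *\<^sub>R u) \<bullet> (v - c *\<^sub>R u) = 0"
    using \<open>u \<bullet> (v - c *\<^sub>R u) = 0\<close> by (simp add: inner_diff_left)
  then have "v = c *\<^sub>R u" by simp
  moreover have "c \<noteq> 0" using z \<open>v = _\<close> by auto
  ultimately show ?thesis using that by blast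
qed

lemma normal_of_mem: "normal_of H u \<Longrightarrow> x \<in> H \<longleftrightarrow> u \<bullet> x = 0"
  by (auto simp: normal_of_def)

lemma normal_of_minus: "normal_of H (- u) \<longleftrightarrow> normal_of H u"
  by (auto simp: normal_of_def)

text \<open>The pair \<open>(1 - t, t)\<close> is never zero, so a two by two matrix that kills it
  is singular. The identity in the proof uses that the two entries sum to one.\<close>

lemma determinant_zero:
  fixes a b a' b' t :: real
  assumes "(1 - t) * a + t * a' = 0" "(1 - t) * b + t * b' = 0"
  shows "a * b' - b * a' = 0"
proof -
  have "a * b' - b * a' = b' * ((1 - t) * a + t * a') - a' * ((1 - t) * b + t * b')
      + a * ((1 - t) * b + t * b') - b * ((1 - t) * a + t * a')"
    by (simp add: algebra_simps)
  then show ?thesis using assms by simp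
qed

lemma scaleR_eq_divide:
  fixes v w :: "'a::real_vector"
  assumes "a *\<^sub>R v = b *\<^sub>R w" "a \<noteq> 0"
  shows "v = (b / a) *\<^sub>R w"
proof -
  have "v = (1 / a) *\<^sub>R (a *\<^sub>R v)" using assms(2) by simp
  then show ?thesis unfolding assms(1) by simp
qed

lemma dim_common_zeros:
  fixes S :: "'a::euclidean_space set"
  shows "dim {x. \<forall>u\<in>S. u \<bullet> x = 0} + dim S = DIM('a)"
proof -
  have "{x. \<forall>u\<in>S. u \<bullet> x = 0} = {y \<in> UNIV. \<forall>x\<in>span S. orthogonal x y}"
  proof (intro equalityI subsetI)
    fix y assume "y \<in> {x. \<forall>u\<in>S. u \<bullet> x = 0}"
    then have "orthogonal y x" if "x \<in> S" for x using that by (simp add: orthogonal_def inner_commute)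
    then have "orthogonal y x" if "x \<in> span S" for x using that by (rule orthogonal_to_span[rotated])
    then show "y \<in> {y \<in> UNIV. \<forall>x\<in>span S. orthogonal x y}" by (simp add: orthogonal_commute)
  next
    fix y assume "y \<in> {y \<in> UNIV. \<forall>x\<in>span S. orthogonal x y}"
    then show "y \<in> {x. \<forall>u\<in>S. u \<bullet> x = 0}" using span_base by (auto simp: orthogonal_def)
  qed
  then show ?thesis
    using dim_subspace_orthogonal_to_vectors[of "span S" UNIV] by simp
qed

lemma subspace_common_zeros: "subspace {x. \<forall>u\<in>S. u \<bullet> x = 0}"
  by (auto simp: subspace_def inner_add_right)

lemma path_rev_append: "path_rev (p @ q) = path_rev q @ path_rev p"
  by (simp add: path_rev_def)

lemma path_rev_rev: "path_rev (path_rev p) = p"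
  by (simp add: path_rev_def rev_map comp_def)

lemma homotopic_rev_right: "sal_path \<H> D p E \<Longrightarrow> sal_homotopic \<H> D D (p @ path_rev p) []"
  using sal_homotopic_path_rev_left[OF sal_path_rev] by (simp add: path_rev_rev)

lemma homotopic_rev:
  assumes "sal_homotopic \<H> D E p q"
  shows "sal_homotopic \<H> E D (path_rev p) (path_rev q)"
proof -
  have pq: "sal_path \<H> D p E" "sal_path \<H> D q E" using sal_homotopic_path[OF assms] by blast+
  have r: "sal_homotopic \<H> E D (path_rev p) (path_rev p)" "sal_homotopic \<H> E D (path_rev q) (path_rev q)"
    using pq sal_path_rev sal_homotopic.refl by blast+
  have "sal_homotopic \<H> E D (path_rev p @ (q @ path_rev q)) (path_rev p @ [])"
    by (rule sal_homotopic_append[OF r(1) homotopic_rev_right[OF pq(2)]])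
  moreover have "sal_homotopic \<H> E D ((path_rev p @ q) @ path_rev q) ((path_rev p @ p) @ path_rev q)"
    by (rule sal_homotopic_append[OF sal_homotopic_append[OF r(1) sal_homotopic.sym[OF assms]] r(2)])
  moreover have "sal_homotopic \<H> E D ((path_rev p @ p) @ path_rev q) ([] @ path_rev q)"
    by (rule sal_homotopic_append[OF sal_homotopic_path_rev_left[OF pq(1)] r(2)])
  ultimately show ?thesis
    by (metis append.assoc append_Nil append_Nil2 sal_homotopic.sym sal_homotopic.trans)
qed

lemma cuts_neq: "cuts \<H> B K H \<Longrightarrow> K \<noteq> H"
  by (auto simp: cuts_def)

locale central =
  fixes \<H> :: "'a::euclidean_space set set"
  assumes central: "central_arrangement \<H>"
begin

lemma fin: "finite \<H>" using central by (simp add: central_arrangement_def)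

lemma finite_sep: "finite (sep_set \<H> R S)"
  using finite_subset[OF sep_set_subset fin] .

lemma finite_through: "finite (through \<H> p)"
  using finite_subset[OF through_subset fin] .

lemma sub: "\<A> \<subseteq> \<H> \<Longrightarrow> central \<A>"
  using central finite_subset by (auto simp: central_def central_arrangement_def)

lemma nrm: "H \<in> \<H> \<Longrightarrow> normal_of H (nrm H)"
  unfolding nrm_def using central by (auto simp: central_arrangement_def intro: someI_ex)

lemma nrm_nz: "H \<in> \<H> \<Longrightarrow> nrm H \<noteq> 0"
  using nrm unfolding normal_of_def by blast

lemma mem_iff: "H \<in> \<H> \<Longrightarrow> x \<in> H \<longleftrightarrow> nrm H \<bullet> x = 0"
  by (rule normal_of_mem[OF nrm])

lemma through_iff: "H \<in> through \<H> p \<longleftrightarrow> H \<in> \<H> \<and> nrm H \<bullet> p = 0"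
  using mem_iff by (auto simp: through_def)

lemma nrm_parallel: "\<lbrakk>H \<in> \<H>; K \<in> \<H>; a *\<^sub>R nrm H = b *\<^sub>R nrm K; a \<noteq> 0 \<or> b \<noteq> 0\<rbrakk> \<Longrightarrow> H = K"
proof -
  assume *: "H \<in> \<H>" "K \<in> \<H>" "a *\<^sub>R nrm H = b *\<^sub>R nrm K" "a \<noteq> 0 \<or> b \<noteq> 0"
  then have ab: "a \<noteq> 0" "b \<noteq> 0" using nrm_nz by fastforce+
  have "a * (nrm H \<bullet> x) = b * (nrm K \<bullet> x)" for x
    using arg_cong[OF *(3), of "\<lambda>v. v \<bullet> x"] by simp
  then have "nrm H \<bullet> x = 0 \<longleftrightarrow> nrm K \<bullet> x = 0" for x
    by (metis ab mult_eq_0_iff)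
  then show "H = K" using mem_iff *(1,2) by blast
qed

lemma complement_eq: "T - \<Union>\<A> = {y\<in>T. \<forall>H\<in>\<A>. nrm H \<bullet> y \<noteq> 0}" if "\<A> \<subseteq> \<H>"
  using that mem_iff by blast

text \<open>Sign classes in a convex set are convex, and a connected set cannot change a sign
  without meeting a zero. The ambient \<open>T\<close> is kept general: the whole space yields
  regions, a hyperplane together with its cutters yields shards.\<close>

lemma components_cells:
  assumes "convex T" "\<A> \<subseteq> \<H>"
  shows "components (T - \<Union>\<A>) =
    (\<lambda>x. {y\<in>T. \<forall>H\<in>\<A>. 0 < (nrm H \<bullet> x) * (nrm H \<bullet> y)}) ` {y\<in>T. \<forall>H\<in>\<A>. nrm H \<bullet> y \<noteq> 0}"
  unfolding complement_eq[OF assms(2)] components_def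
  by (rule image_cong[OF HOL.refl], rule connected_component_nonzero) (use assms in auto)

lemma regionsE:
  assumes "R \<in> regions \<H>"
  obtains x where "x \<in> R" "R = {y. \<forall>H\<in>\<H>. 0 < (nrm H \<bullet> x) * (nrm H \<bullet> y)}"
proof -
  obtain x where x: "\<forall>H\<in>\<H>. nrm H \<bullet> x \<noteq> 0" "R = {y\<in>UNIV. \<forall>H\<in>\<H>. 0 < (nrm H \<bullet> x) * (nrm H \<bullet> y)}"
    using assms unfolding regions_def components_cells[OF convex_UNIV order.refl] by blast
  then have "x \<in> R" by (auto simp: mult_less_0_iff zero_less_mult_iff less_le)
  then show ?thesis using that x(2) by simp
qed

lemma region_of_point:
  assumes "\<forall>H\<in>\<H>. nrm H \<bullet> x \<noteq> 0"
  obtains R where "R \<in> regions \<H>" "x \<in> R"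
proof
  let ?R = "{y. \<forall>H\<in>\<H>. 0 < (nrm H \<bullet> x) * (nrm H \<bullet> y)}"
  show "?R \<in> regions \<H>"
    using assms components_cells[OF convex_UNIV order.refl] unfolding regions_def by auto
  show "x \<in> ?R" using assms by (auto simp: zero_less_mult_iff)
qed

lemma pos_iff: "\<lbrakk>R \<in> regions \<H>; H \<in> \<H>; x \<in> R\<rbrakk> \<Longrightarrow> pos R H \<longleftrightarrow> 0 < nrm H \<bullet> x"
proof -
  assume *: "R \<in> regions \<H>" "H \<in> \<H>" "x \<in> R"
  have "(0 < nrm H \<bullet> y) = (0 < nrm H \<bullet> x)" if "y \<in> R" for y
  proof -
    obtain z where "R = {y. \<forall>H\<in>\<H>. 0 < (nrm H \<bullet> z) * (nrm H \<bullet> y)}" using * by (elim regionsE)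
    then have "0 < (nrm H \<bullet> z) * (nrm H \<bullet> y)" "0 < (nrm H \<bullet> z) * (nrm H \<bullet> x)" using * that by auto
    then show ?thesis unfolding zero_less_mult_iff by linarith
  qed
  then show "pos R H \<longleftrightarrow> 0 < nrm H \<bullet> x" using * unfolding pos_def by blast
qed

lemma region_eq:
  assumes "R \<in> regions \<H>"
  shows "R = {x. \<forall>H\<in>\<H>. 0 < orient R H \<bullet> x}"
proof -
  obtain x where x: "x \<in> R" "R = {y. \<forall>H\<in>\<H>. 0 < (nrm H \<bullet> x) * (nrm H \<bullet> y)}"
    using assms by (rule regionsE)
  have "(0 < (nrm H \<bullet> x) * (nrm H \<bullet> y)) = (0 < orient R H \<bullet> y)" if "H \<in> \<H>" for H y
  proof -
    have "0 < (nrm H \<bullet> x) * (nrm H \<bullet> x)" using x that by blast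
    then show ?thesis using pos_iff[OF assms that x(1)]
      by (cases "pos R H") (auto simp: orient_def zero_less_mult_iff)
  qed
  then have "{y. \<forall>H\<in>\<H>. 0 < (nrm H \<bullet> x) * (nrm H \<bullet> y)} = {x. \<forall>H\<in>\<H>. 0 < orient R H \<bullet> x}"
    by blast
  then show ?thesis using x(2) by argo
qed

lemma orient_pos: "\<lbrakk>R \<in> regions \<H>; H \<in> \<H>; x \<in> R\<rbrakk> \<Longrightarrow> 0 < orient R H \<bullet> x"
  using region_eq by blast

lemma orient_zero: "orient R H \<bullet> x = 0 \<longleftrightarrow> nrm H \<bullet> x = 0"
  by (auto simp: orient_def)

lemma nrm_region: "\<lbrakk>R \<in> regions \<H>; H \<in> \<H>; x \<in> R\<rbrakk> \<Longrightarrow> nrm H \<bullet> x \<noteq> 0"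
  using orient_pos orient_zero by (metis less_irrefl)

lemma orient_nz: "H \<in> \<H> \<Longrightarrow> orient R H \<noteq> 0"
  using nrm_nz by (auto simp: orient_def)

lemma orient_parallel:
  assumes "H \<in> \<H>" "K \<in> \<H>" "a *\<^sub>R orient R H = b *\<^sub>R orient S K" "a \<noteq> 0 \<or> b \<noteq> 0"
  shows "H = K"
proof (rule nrm_parallel[OF assms(1,2)])
  show "(if pos R H then a else - a) *\<^sub>R nrm H = (if pos S K then b else - b) *\<^sub>R nrm K"
    using assms(3) by (auto simp: orient_def)
qed (use assms in auto)

lemma region_nonempty: "R \<in> regions \<H> \<Longrightarrow> R \<noteq> {}"
  using regionsE by blast

lemma region_open: "R \<in> regions \<H> \<Longrightarrow> open R"
proof -
  assume R: "R \<in> regions \<H>"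
  have "R = (\<Inter>H\<in>\<H>. {x. orient R H \<bullet> x > 0})" by (subst region_eq[OF R]) blast
  moreover have "open (\<Inter>H\<in>\<H>. {x. orient R H \<bullet> x > 0})"
    using fin by (intro open_INT) (auto simp: open_halfspace_gt)
  ultimately show ?thesis by metis
qed

lemma region_convex: "R \<in> regions \<H> \<Longrightarrow> convex R"
proof -
  assume R: "R \<in> regions \<H>"
  have "R = (\<Inter>H\<in>\<H>. {x. orient R H \<bullet> x > 0})" by (subst region_eq[OF R]) blast
  moreover have "convex (\<Inter>H\<in>\<H>. {x. orient R H \<bullet> x > 0})"
    by (intro convex_INT) (auto simp: convex_halfspace_gt)
  ultimately show ?thesis by metis
qed

lemma region_cong:
  assumes "R \<in> regions \<H>" "S \<in> regions \<H>" "\<forall>H\<in>\<H>. pos R H = pos S H"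
  shows "R = S"
proof -
  have "{x. \<forall>H\<in>\<H>. 0 < orient R H \<bullet> x} = {x. \<forall>H\<in>\<H>. 0 < orient S H \<bullet> x}"
    using assms(3) by (simp add: orient_def)
  then show ?thesis using region_eq[OF assms(1)] region_eq[OF assms(2)] by argo
qed

lemma sep_set_eq:
  assumes "R \<in> regions \<H>" "S \<in> regions \<H>"
  shows "sep_set \<H> R S = {H\<in>\<H>. pos R H \<noteq> pos S H}"
proof -
  obtain x y where xy: "x \<in> R" "y \<in> S" using assms region_nonempty by blast
  have "separates H R S \<longleftrightarrow> pos R H \<noteq> pos S H" if H: "H \<in> \<H>" for H
  proof
    assume "separates H R S"
    then obtain u where u: "normal_of H u" "u \<bullet> x < 0" "u \<bullet> y > 0" using xy by (auto simp: separates_def)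
    then obtain c where "c \<noteq> 0" "nrm H = c *\<^sub>R u" using normal_of_parallel nrm[OF H] by metis
    then show "pos R H \<noteq> pos S H"
      using u pos_iff[OF assms(1) H xy(1)] pos_iff[OF assms(2) H xy(2)]
      by (auto simp: zero_less_mult_iff)
  next
    assume ne: "pos R H \<noteq> pos S H"
    have "normal_of H (orient S H)" using nrm[OF H] by (simp add: orient_def normal_of_minus)
    moreover have "orient R H = - orient S H" using ne by (auto simp: orient_def)
    ultimately show "separates H R S"
      unfolding separates_def using orient_pos[OF assms(1) H, unfolded \<open>orient R H = _\<close>] orient_pos[OF assms(2) H]
      by (intro exI[of _ "orient S H"]) auto
  qed
  then show ?thesis by (auto simp: sep_set_def)
qed

lemma sep_set_commute: "R \<in> regions \<H> \<Longrightarrow> S \<in> regions \<H> \<Longrightarrow> sep_set \<H> R S = sep_set \<H> S R"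
  unfolding sep_set_eq by blast

lemma sep_empty: "R \<in> regions \<H> \<Longrightarrow> S \<in> regions \<H> \<Longrightarrow> sep_set \<H> R S = {} \<longleftrightarrow> R = S"
  unfolding sep_set_eq using region_cong by blast

lemma closure_region:
  assumes "R \<in> regions \<H>"
  shows "closure R = {x. \<forall>H\<in>\<H>. 0 \<le> orient R H \<bullet> x}" (is "_ = ?C")
proof
  have "?C = (\<Inter>H\<in>\<H>. {x. orient R H \<bullet> x \<ge> 0})" by auto
  moreover have "closed (\<Inter>H\<in>\<H>. {x. orient R H \<bullet> x \<ge> 0})"
    by (intro closed_INT) (auto simp: closed_halfspace_ge)
  ultimately have "closed ?C" by metis
  then show "closure R \<subseteq> ?C"
    by (intro closure_minimal) (use orient_pos[OF assms] in \<open>auto intro: less_imp_le\<close>)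
  show "?C \<subseteq> closure R"
  proof
    fix x assume x: "x \<in> ?C"
    obtain y where y: "y \<in> R" using region_nonempty[OF assms] by auto
    have "\<forall>\<^sub>F e in at_right 0. 0 < e \<and> (\<forall>H\<in>\<H>. 0 < orient R H \<bullet> x + e * (orient R H \<bullet> y))"
      using x orient_pos[OF assms _ y] by (intro eventually_lex_positive fin) (auto simp: less_le)
    then have "\<forall>\<^sub>F e in at_right (0::real). x + e *\<^sub>R y \<in> closure R"
      by eventually_elim
        (subst region_eq[OF assms], rule subsetD[OF closure_subset], simp add: inner_add_right)
    moreover have "((\<lambda>e. x + e *\<^sub>R y) \<longlongrightarrow> x + 0 *\<^sub>R y) (at_right (0::real))"
      by (intro tendsto_intros)
    ultimately show "x \<in> closure R"
      using Lim_in_closed_set[OF closed_closure _ trivial_limit_at_right_real] by fastforce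
  qed
qed

text \<open>The region is the one entered on leaving \<open>p\<close> in direction \<open>v\<close>:
  signs decided at \<open>p\<close> persist, and \<open>v\<close> decides the rest.\<close>

lemma germ:
  assumes "\<forall>H\<in>\<H>. nrm H \<bullet> p = 0 \<longrightarrow> nrm H \<bullet> v \<noteq> 0"
  obtains R where "R \<in> regions \<H>" "p \<in> closure R"
    "\<And>H. H \<in> \<H> \<Longrightarrow> pos R H \<longleftrightarrow> 0 < nrm H \<bullet> p \<or> nrm H \<bullet> p = 0 \<and> 0 < nrm H \<bullet> v"
proof -
  define s where "s H = (if 0 < nrm H \<bullet> p \<or> nrm H \<bullet> p = 0 \<and> 0 < nrm H \<bullet> v then nrm H else - nrm H)" for H
  obtain e where e: "0 < e" "\<forall>H\<in>\<H>. 0 < s H \<bullet> p + e * (s H \<bullet> v)"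
    by (rule lex_positive[OF fin, of "\<lambda>H. s H \<bullet> p" "\<lambda>H. s H \<bullet> v"])
      (use assms in \<open>auto simp: s_def less_le\<close>)
  define x where "x = p + e *\<^sub>R v"
  have x: "0 < s H \<bullet> x" if "H \<in> \<H>" for H using e that by (auto simp: x_def inner_add_right)
  have "\<forall>H\<in>\<H>. nrm H \<bullet> x \<noteq> 0" using x by (force simp: s_def split: if_splits)
  then obtain R where R: "R \<in> regions \<H>" "x \<in> R" using region_of_point by blast
  have ps: "pos R H \<longleftrightarrow> 0 < nrm H \<bullet> p \<or> nrm H \<bullet> p = 0 \<and> 0 < nrm H \<bullet> v" if "H \<in> \<H>" for H
    using pos_iff[OF R(1) that R(2)] x[OF that] by (auto simp: s_def split: if_splits)
  then have "p \<in> closure R" unfolding closure_region[OF R(1)] by (auto simp: orient_def)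
  then show ?thesis using that R ps by blast
qed

lemma closure_pos:
  assumes "R \<in> regions \<H>" "p \<in> closure R" "H \<in> \<H>" "nrm H \<bullet> p \<noteq> 0"
  shows "pos R H \<longleftrightarrow> 0 < nrm H \<bullet> p"
  using assms unfolding closure_region[OF assms(1)] by (force simp: orient_def split: if_splits)

lemma closure_iff_pos:
  assumes "R \<in> regions \<H>"
  shows "p \<in> closure R \<longleftrightarrow> (\<forall>H\<in>\<H>. nrm H \<bullet> p \<noteq> 0 \<longrightarrow> (pos R H \<longleftrightarrow> 0 < nrm H \<bullet> p))"
  unfolding closure_region[OF assms] by (force simp: orient_def)

text \<open>Leaving \<open>p\<close> in direction \<open>- x\<close>, with \<open>x\<close> in
  \<open>C\<close>, reverses every sign that \<open>p\<close> leaves undecided and keeps the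
  others.\<close>

lemma opposite:
  assumes "C \<in> regions \<H>" "p \<in> closure C"
  obtains C' where "C' \<in> regions \<H>" "p \<in> closure C'" "sep_set \<H> C C' = through \<H> p"
proof -
  obtain x where x: "x \<in> C" using region_nonempty assms by blast
  have "\<forall>H\<in>\<H>. nrm H \<bullet> p = 0 \<longrightarrow> nrm H \<bullet> (- x) \<noteq> 0"
    using nrm_region[OF assms(1) _ x] by simp
  then obtain C' where C': "C' \<in> regions \<H>" "p \<in> closure C'"
    and *: "\<And>H. H \<in> \<H> \<Longrightarrow> pos C' H \<longleftrightarrow> 0 < nrm H \<bullet> p \<or> nrm H \<bullet> p = 0 \<and> 0 < nrm H \<bullet> (- x)"
    using germ[of p "- x"] by metis
  have "pos C H \<noteq> pos C' H \<longleftrightarrow> nrm H \<bullet> p = 0" if H: "H \<in> \<H>" for H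
  proof (cases "nrm H \<bullet> p = 0")
    case True
    have "nrm H \<bullet> x \<noteq> 0" using nrm_region[OF assms(1) H x] .
    then show ?thesis using True *[OF H] pos_iff[OF assms(1) H x] by auto
  next
    case False
    then show ?thesis using closure_pos assms C' H by metis
  qed
  then have "sep_set \<H> C C' = through \<H> p"
    unfolding sep_set_eq[OF assms(1) C'(1)] set_eq_iff through_iff by blast
  then show ?thesis using that C' by blast
qed

lemma facet_point:
  assumes R: "R \<in> regions \<H>" and S: "S \<in> regions \<H>" and sep: "sep_set \<H> R S = {H}"
  obtains p where "through \<H> p = {H}" "p \<in> closure R" "p \<in> closure S"
proof -
  obtain x y where xy: "x \<in> R" "y \<in> S" using R S region_nonempty by blast
  have H: "H \<in> \<H>" "pos R H \<noteq> pos S H" using sep sep_set_eq[OF R S] by auto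
  have o: "0 < orient R H \<bullet> x" using orient_pos[OF R H(1) xy(1)] .
  have o': "orient R H \<bullet> y < 0" using orient_pos[OF S H(1) xy(2)] H(2) by (auto simp: orient_def)
  define a where "a = orient R H \<bullet> x"
  define b where "b = - (orient R H \<bullet> y)"
  \<comment> \<open>A positive multiple of the point where the segment from \<open>x\<close> to
    \<open>y\<close> crosses \<open>H\<close>; regions are cones, so the weights need not be
    normalized.\<close>
  define p where "p = b *\<^sub>R x + a *\<^sub>R y"
  have ab: "a > 0" "b > 0" using o o' by (auto simp: a_def b_def)
  have "orient R H \<bullet> p = 0" by (simp add: p_def inner_add_right inner_diff_right a_def b_def)
  then have z: "nrm H \<bullet> p = 0" using orient_zero by blast
  have other: "0 < orient R K \<bullet> p" "orient S K = orient R K" if "K \<in> \<H>" "K \<noteq> H" for K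
  proof -
    have "pos R K = pos S K" using sep sep_set_eq[OF R S] that by auto
    then show "orient S K = orient R K" by (simp add: orient_def)
    then show "0 < orient R K \<bullet> p"
      using orient_pos[OF R that(1) xy(1)] orient_pos[OF S that(1) xy(2)] ab
      by (simp add: p_def inner_add_right add_pos_pos)
  qed
  have "nrm K \<bullet> p \<noteq> 0" if "K \<in> \<H>" "K \<noteq> H" for K
    using other(1)[OF that] orient_zero[of R K p] by simp
  then have "through \<H> p = {H}" using z H unfolding set_eq_iff through_iff by blast
  moreover have "p \<in> closure R" unfolding closure_region[OF R]
    using other z by (force simp: orient_zero less_imp_le order.order_iff_strict)
  moreover have "p \<in> closure S" unfolding closure_region[OF S]
    using other z by (force simp: orient_zero order.order_iff_strict)
  ultimately show ?thesis using that by blast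
qed

text \<open>On the ray from \<open>x \<in> D\<close> in direction \<open>y \<in> E\<close>, the hyperplane \<open>H\<close> separating \<open>D\<close>
  from \<open>E\<close> is crossed at time \<open>weight D y H \<bullet> x\<close>, which is linear in \<open>x\<close>.\<close>

definition weight :: "'a set \<Rightarrow> 'a \<Rightarrow> 'a set \<Rightarrow> 'a" where
  "weight D y H = (1 / - (orient D H \<bullet> y)) *\<^sub>R orient D H"

definition hits :: "'a set \<Rightarrow> 'a set \<Rightarrow> 'a \<Rightarrow> 'a \<Rightarrow> 'a set set" where
  "hits D E y x = {H \<in> sep_set \<H> D E. \<forall>K \<in> sep_set \<H> D E. weight D y H \<bullet> x \<le> weight D y K \<bullet> x}"

lemma orient_neg:
  assumes "D \<in> regions \<H>" "E \<in> regions \<H>" "y \<in> E" "H \<in> sep_set \<H> D E"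
  shows "orient D H \<bullet> y < 0"
proof -
  have "H \<in> \<H>" "pos D H \<noteq> pos E H" using assms(4) by (simp_all add: sep_set_eq[OF assms(1,2)])
  then show ?thesis using orient_pos[OF assms(2) \<open>H \<in> \<H>\<close> assms(3)] by (auto simp: orient_def)
qed

lemma weight_inner_self:
  assumes "D \<in> regions \<H>" "E \<in> regions \<H>" "y \<in> E" "H \<in> sep_set \<H> D E"
  shows "weight D y H \<bullet> y = - 1"
  using orient_neg[OF assms] by (simp add: weight_def)

lemma weight_inj:
  assumes DE: "D \<in> regions \<H>" "E \<in> regions \<H>" "y \<in> E"
    and HK: "H \<in> sep_set \<H> D E" "K \<in> sep_set \<H> D E" "weight D y H = weight D y K"
  shows "H = K"
proof (rule orient_parallel)
  show "(1 / - (orient D H \<bullet> y)) *\<^sub>R orient D H = (1 / - (orient D K \<bullet> y)) *\<^sub>R orient D K"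
    using HK(3) by (simp add: weight_def)
  show "1 / - (orient D H \<bullet> y) \<noteq> 0 \<or> 1 / - (orient D K \<bullet> y) \<noteq> 0"
    using orient_neg[OF DE HK(1)] by simp
qed (use HK sep_set_subset in blast)+

lemma hits_nonempty:
  assumes "D \<in> regions \<H>" "E \<in> regions \<H>" "D \<noteq> E"
  obtains H where "H \<in> hits D E y x"
proof -
  let ?S = "sep_set \<H> D E"
  have "?S \<noteq> {}" using sep_empty[OF assms(1,2)] assms(3) by simp
  then have "Min ((\<lambda>H. weight D y H \<bullet> x) ` ?S) \<in> (\<lambda>H. weight D y H \<bullet> x) ` ?S"
    using finite_sep by (intro Min_in) auto
  then obtain H where "H \<in> ?S" "weight D y H \<bullet> x = Min ((\<lambda>H. weight D y H \<bullet> x) ` ?S)" by force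
  then have "H \<in> hits D E y x" using finite_sep by (simp add: hits_def)
  then show ?thesis using that by blast
qed

text \<open>A hyperplane that does not separate \<open>D\<close> from \<open>E\<close> has
  \<open>x\<close> and \<open>y\<close> strictly on the same side, so the ray from \<open>x\<close>
  in direction \<open>y\<close> never meets it; only the separating ones compete for the first
  hit.\<close>

lemma first_hit:
  assumes D: "D \<in> regions \<H>" and E: "E \<in> regions \<H>" and "D \<noteq> E" and x: "x \<in> D" and y: "y \<in> E"
  obtains p where "p \<in> closure D" "through \<H> p = hits D E y x"
proof -
  obtain H where H: "H \<in> hits D E y x" using hits_nonempty assms(1-3) by blast
  define s where "s = weight D y H \<bullet> x"
  have HS: "H \<in> sep_set \<H> D E" and le: "\<And>K. K \<in> sep_set \<H> D E \<Longrightarrow> s \<le> weight D y K \<bullet> x"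
    using H by (auto simp: hits_def s_def)
  note neg = orient_neg[OF D E y]
  have "H \<in> \<H>" using HS sep_set_subset by blast
  then have s: "s > 0" using neg[OF HS] orient_pos[OF D _ x]
    by (simp add: s_def weight_def divide_less_0_iff)
  define p where "p = x + s *\<^sub>R y"
  have ww: "orient D K \<bullet> p = - (orient D K \<bullet> y) * (weight D y K \<bullet> x - s)" if "K \<in> sep_set \<H> D E" for K
    using neg[OF that] by (simp add: p_def weight_def inner_add_right field_simps)
  have ge: "0 \<le> orient D K \<bullet> p \<and> (orient D K \<bullet> p = 0 \<longleftrightarrow> K \<in> hits D E y x)" if "K \<in> \<H>" for K
  proof (cases "K \<in> sep_set \<H> D E")
    case True
    have "K \<in> hits D E y x \<longleftrightarrow> weight D y K \<bullet> x = s"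
      using H HS True by (auto simp: hits_def s_def intro: antisym)
    then show ?thesis using ww[OF True] le[OF True] neg[OF True] by (auto simp: mult_nonpos_nonneg)
  next
    case False
    then have "orient D K = orient E K" using that by (simp add: sep_set_eq[OF D E] orient_def)
    then have "0 < orient D K \<bullet> p" using orient_pos[OF D that x] orient_pos[OF E that y] s
      by (simp add: p_def inner_add_right add_pos_pos)
    then show ?thesis using False by (simp add: hits_def)
  qed
  have "p \<in> closure D" unfolding closure_region[OF D] using ge by blast
  moreover have "through \<H> p = hits D E y x"
  proof (intro equalityI subsetI)
    fix K assume "K \<in> through \<H> p"
    then show "K \<in> hits D E y x" using ge[of K] by (simp add: through_iff orient_zero)
  next
    fix K assume K: "K \<in> hits D E y x"
    then have "K \<in> \<H>" using sep_set_subset by (auto simp: hits_def)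
    then show "K \<in> through \<H> p" using ge[of K] K by (simp add: through_iff orient_zero)
  qed
  ultimately show ?thesis using that by blast
qed

text \<open>A starting point orthogonal to none of these vectors meets the separating hyperplanes at
  pairwise different times.\<close>

definition weight_diffs :: "'a set \<Rightarrow> 'a set \<Rightarrow> 'a \<Rightarrow> 'a set" where
  "weight_diffs D E y = {weight D y H - weight D y K | H K.
     H \<in> sep_set \<H> D E \<and> K \<in> sep_set \<H> D E \<and> H \<noteq> K}"

lemma weight_diffs:
  assumes "D \<in> regions \<H>" "E \<in> regions \<H>" "y \<in> E"
  shows "finite (weight_diffs D E y)" "0 \<notin> weight_diffs D E y"
proof -
  have "weight_diffs D E y \<subseteq> (\<lambda>(H, K). weight D y H - weight D y K) ` (sep_set \<H> D E \<times> sep_set \<H> D E)"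
    by (auto simp: weight_diffs_def)
  then show "finite (weight_diffs D E y)" using finite_sep finite_subset by blast
  show "0 \<notin> weight_diffs D E y"
    using weight_inj[OF assms] by (auto simp: weight_diffs_def)
qed

text \<open>From a generic start in \<open>D\<close> the ray meets the separating hyperplanes at
  different times, so its first hit lies on one wall only, and the opposite region at that point is
  adjacent to \<open>D\<close>.\<close>

lemma wall:
  assumes D: "D \<in> regions \<H>" and E: "E \<in> regions \<H>" and "D \<noteq> E"
  obtains D' H where "D' \<in> regions \<H>" "sep_set \<H> D D' = {H}" "H \<in> sep_set \<H> D E"
proof -
  obtain y where y: "y \<in> E" using region_nonempty E by blast
  obtain x where x: "x \<in> D" "\<forall>v\<in>weight_diffs D E y. v \<bullet> x \<noteq> 0"
    using generic_point[OF region_open[OF D] region_nonempty[OF D] weight_diffs[OF D E y]] by metis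
  obtain H where H: "H \<in> hits D E y x" using hits_nonempty assms by blast
  have "K = H" if K: "K \<in> hits D E y x" for K
  proof (rule ccontr)
    assume "K \<noteq> H"
    then have "weight D y K - weight D y H \<in> weight_diffs D E y"
      using H K unfolding weight_diffs_def hits_def by blast
    moreover have "(weight D y K - weight D y H) \<bullet> x = 0"
      using H K unfolding hits_def inner_diff_left by (metis (no_types, lifting) antisym eq_iff_diff_eq_0 mem_Collect_eq)
    ultimately show False using x(2) by blast
  qed
  then have "hits D E y x = {H}" using H by blast
  moreover obtain p where "p \<in> closure D" "through \<H> p = hits D E y x"
    using first_hit[OF D E \<open>D \<noteq> E\<close> x(1) y] by blast
  ultimately show ?thesis using opposite[OF D] that H unfolding hits_def by (metis (no_types, lifting) mem_Collect_eq)
qed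

end

section \<open>Galleries and two-cells\<close>

context central begin

lemma sal_edge_iff:
  "(D, D') \<in> sal_edges \<H> \<longleftrightarrow> D \<in> regions \<H> \<and> D' \<in> regions \<H> \<and> (\<exists>H. sep_set \<H> D D' = {H})"
  by (simp add: sal_edges_def card_1_singleton_iff)

lemma sep_set_via:
  assumes "D \<in> regions \<H>" "M \<in> regions \<H>" "E \<in> regions \<H>"
  shows "sep_set \<H> D E = (sep_set \<H> D M - sep_set \<H> M E) \<union> (sep_set \<H> M E - sep_set \<H> D M)"
  unfolding sep_set_eq[OF assms(1,2)] sep_set_eq[OF assms(2,3)] sep_set_eq[OF assms(1,3)] by blast

lemma sep_refl: "D \<in> regions \<H> \<Longrightarrow> sep_set \<H> D D = {}"
  using sep_empty by blast

lemma positive_gallery_Cons: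
  "positive_gallery \<H> D (s # g) E \<longleftrightarrow>
    (\<exists>D'. s = Along (D, D') \<and> (D, D') \<in> sal_edges \<H> \<and> positive_gallery \<H> D' g E)"
  by (cases s) (auto simp: positive_gallery_def)

lemma positive_gallery_regions:
  "positive_gallery \<H> D g E \<Longrightarrow> D \<in> regions \<H> \<and> E \<in> regions \<H>"
  using sal_path_ends by (auto simp: positive_gallery_def)

lemma sep_step:
  assumes "D \<in> regions \<H>" "D' \<in> regions \<H>" "E \<in> regions \<H>" "sep_set \<H> D D' = {H}"
  shows "H \<in> sep_set \<H> D E \<Longrightarrow> sep_set \<H> D' E = sep_set \<H> D E - {H}"
    and "H \<notin> sep_set \<H> D E \<Longrightarrow> sep_set \<H> D' E = insert H (sep_set \<H> D E)"
proof -
  have "sep_set \<H> D' E = ({H} - sep_set \<H> D E) \<union> (sep_set \<H> D E - {H})"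
    using sep_set_via[OF assms(2,1,3)] sep_set_commute[OF assms(1,2)] assms(4) by simp
  then show "H \<in> sep_set \<H> D E \<Longrightarrow> sep_set \<H> D' E = sep_set \<H> D E - {H}"
    and "H \<notin> sep_set \<H> D E \<Longrightarrow> sep_set \<H> D' E = insert H (sep_set \<H> D E)" by (simp_all add: insert_Diff_if)
qed

lemma positive_gallery_length:
  "positive_gallery \<H> D g E \<Longrightarrow> card (sep_set \<H> D E) \<le> length g"
proof (induction g arbitrary: D)
  case Nil
  then show ?case using sep_refl by (auto simp: positive_gallery_def)
next
  case (Cons s g)
  then obtain D' H where *: "D \<in> regions \<H>" "D' \<in> regions \<H>" "E \<in> regions \<H>" "sep_set \<H> D D' = {H}"
    and g: "positive_gallery \<H> D' g E"
    using positive_gallery_regions by (auto simp: positive_gallery_Cons sal_edge_iff)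
  have "sep_set \<H> D E \<subseteq> insert H (sep_set \<H> D' E)" using sep_step[OF *] by blast
  then have "card (sep_set \<H> D E) \<le> card (insert H (sep_set \<H> D' E))"
    by (intro card_mono) (simp_all add: finite_sep)
  also have "\<dots> \<le> Suc (card (sep_set \<H> D' E))" by (simp add: card_insert_if finite_sep)
  finally show ?case using Cons.IH[OF g] by simp
qed

lemma minimal_gallery_Nil: "minimal_gallery \<H> D [] E \<longleftrightarrow> D \<in> regions \<H> \<and> D = E"
  using sep_refl by (auto simp: minimal_gallery_def positive_gallery_def)

lemma minimal_gallery_regions:
  "minimal_gallery \<H> D g E \<Longrightarrow> D \<in> regions \<H> \<and> E \<in> regions \<H>"
  using positive_gallery_regions by (auto simp: minimal_gallery_def)

text \<open>Each step changes the distance to \<open>E\<close> by exactly one. An increase could not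
  be made up, because a positive gallery is at least as long as the distance; hence tails of minimal
  galleries are minimal, which permits induction along them.\<close>

lemma minimal_gallery_Cons:
  "minimal_gallery \<H> D (s # g) E \<longleftrightarrow>
    (\<exists>D' H. s = Along (D, D') \<and> D \<in> regions \<H> \<and> D' \<in> regions \<H> \<and> sep_set \<H> D D' = {H} \<and>
      H \<in> sep_set \<H> D E \<and> minimal_gallery \<H> D' g E)" (is "?L \<longleftrightarrow> ?R")
proof
  assume ?L
  then obtain D' H where *: "D \<in> regions \<H>" "D' \<in> regions \<H>" "E \<in> regions \<H>" "sep_set \<H> D D' = {H}"
    and g: "s = Along (D, D')" "positive_gallery \<H> D' g E" and len: "Suc (length g) = card (sep_set \<H> D E)"
    using positive_gallery_regions
    by (auto simp: minimal_gallery_def positive_gallery_Cons sal_edge_iff)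
  have "H \<in> sep_set \<H> D E"
  proof (rule ccontr)
    assume "H \<notin> sep_set \<H> D E"
    then have "card (sep_set \<H> D' E) = Suc (card (sep_set \<H> D E))"
      using sep_step(2)[OF *] finite_sep by simp
    then show False using positive_gallery_length[OF g(2)] len by simp
  qed
  moreover from this have "card (sep_set \<H> D E) = Suc (card (sep_set \<H> D' E))"
    using sep_step(1)[OF *] finite_sep by (metis card.remove)
  ultimately show ?R using * g len by (auto simp: minimal_gallery_def)
next
  assume ?R
  then obtain D' H where D: "D \<in> regions \<H>" "D' \<in> regions \<H>" and DH: "sep_set \<H> D D' = {H}"
    and g: "s = Along (D, D')" "minimal_gallery \<H> D' g E" and H: "H \<in> sep_set \<H> D E"
    by blast
  note * = D conjunct2[OF minimal_gallery_regions[OF g(2)]] DH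
  have "card (sep_set \<H> D E) = Suc (card (sep_set \<H> D' E))"
    using sep_step(1)[OF * H] H finite_sep by (metis card.remove)
  then show ?L using * g by (auto simp: minimal_gallery_def positive_gallery_Cons sal_edge_iff)
qed

lemma minimal_gallery_append:
  assumes "minimal_gallery \<H> D g M" "minimal_gallery \<H> M h E" "sep_set \<H> D M \<inter> sep_set \<H> M E = {}"
  shows "minimal_gallery \<H> D (g @ h) E"
proof -
  have "sep_set \<H> D E = sep_set \<H> D M \<union> sep_set \<H> M E"
    using sep_set_via[of D M E] assms minimal_gallery_regions by blast
  then have "card (sep_set \<H> D E) = length g + length h"
    using assms finite_sep by (simp add: card_Un_disjoint minimal_gallery_def)
  then show ?thesis using assms by (auto simp: minimal_gallery_def positive_gallery_def sal_path_append)
qed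

lemma minimal_gallery_exists:
  assumes "D \<in> regions \<H>" "E \<in> regions \<H>"
  obtains g where "minimal_gallery \<H> D g E"
proof -
  have "\<exists>g. minimal_gallery \<H> D g E" using assms(1)
  proof (induction "card (sep_set \<H> D E)" arbitrary: D)
    case 0
    then show ?case using sep_empty[OF 0(2) assms(2)] finite_sep minimal_gallery_Nil by (metis card_0_eq)
  next
    case (Suc n)
    have "D \<noteq> E" using Suc.hyps(2) sep_refl[OF Suc.prems] by auto
    then obtain D' H where D': "D' \<in> regions \<H>" "sep_set \<H> D D' = {H}" "H \<in> sep_set \<H> D E"
      using wall Suc.prems assms(2) by metis
    have "sep_set \<H> D' E = sep_set \<H> D E - {H}" using sep_step(1)[OF Suc.prems D'(1) assms(2) D'(2,3)] .
    then have "n = card (sep_set \<H> D' E)" using D'(3) Suc.hyps(2) by simp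
    then obtain g where "minimal_gallery \<H> D' g E" using Suc.hyps(1) D' by blast
    then show ?case using D' Suc.prems minimal_gallery_Cons by metis
  qed
  then show ?thesis using that by blast
qed

lemma gal: "D \<in> regions \<H> \<Longrightarrow> E \<in> regions \<H> \<Longrightarrow> minimal_gallery \<H> D (gal \<H> D E) E"
  unfolding gal_def using minimal_gallery_exists someI_ex by metis

lemma minimal_gallery_path: "minimal_gallery \<H> D g E \<Longrightarrow> sal_path \<H> D g E"
  by (simp add: minimal_gallery_def positive_gallery_def)

lemma minimal_gallery_step:
  assumes "minimal_gallery \<H> D g E" "s \<in> set g" "M = step_source s \<or> M = step_target s"
  shows "M \<in> regions \<H> \<and> sep_set \<H> D M \<subseteq> sep_set \<H> D E"
  using assms(1,2)
proof (induction g arbitrary: D)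
  case (Cons t g)
  then obtain D' H where *: "D \<in> regions \<H>" "D' \<in> regions \<H>" "E \<in> regions \<H>" "sep_set \<H> D D' = {H}"
    and g: "t = Along (D, D')" "minimal_gallery \<H> D' g E" and H: "H \<in> sep_set \<H> D E"
    using minimal_gallery_regions by (auto simp: minimal_gallery_Cons)
  show ?case
  proof (cases "s \<in> set g")
    case True
    then have M: "M \<in> regions \<H>" "sep_set \<H> D' M \<subseteq> sep_set \<H> D' E" using Cons.IH[OF g(2)] by auto
    moreover have "sep_set \<H> D M \<subseteq> insert H (sep_set \<H> D' M)" using sep_step[OF *(1,2) M(1) *(4)] by blast
    ultimately show ?thesis using sep_step(1)[OF * H] H by blast
  next
    case False
    then have "M = D \<or> M = D'" using Cons.prems(2) assms(3) g(1) by auto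
    then show ?thesis using * H sep_refl by auto
  qed
qed simp

lemma dim_normals_two:
  assumes "card \<A> \<ge> 2" "\<A> \<subseteq> \<H>" "\<forall>H\<in>\<A>. nrm H \<in> span {u, v}"
  shows "dim (nrm ` \<A>) = 2"
proof -
  obtain H K where HK: "H \<in> \<A>" "K \<in> \<A>" "H \<noteq> K"
    using obtain_subset_with_card_n[OF assms(1)] by (metis card_2_iff insert_subset)
  have "nrm H \<notin> span {nrm K}"
  proof
    assume "nrm H \<in> span {nrm K}"
    then obtain c where "1 *\<^sub>R nrm H = c *\<^sub>R nrm K" by (auto simp: span_singleton)
    then show False using nrm_parallel[of H K 1 c] HK assms(2) by auto
  qed
  moreover have "nrm K \<noteq> 0" using nrm_nz HK assms(2) by blast
  ultimately have "independent {nrm H, nrm K}" by (simp add: independent_insert)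
  moreover have "nrm H \<noteq> nrm K" using \<open>nrm H \<notin> _\<close> span_base by force
  ultimately have "2 \<le> dim (nrm ` \<A>)"
    using independent_card_le_dim[of "{nrm H, nrm K}" "nrm ` \<A>"] HK by auto
  moreover have "dim (nrm ` \<A>) \<le> dim {u, v}"
    using assms(3) by (intro dim_mono) auto
  moreover have "dim {u, v} \<le> card {u, v}" by (rule dim_le_card') simp
  moreover have "card {u, v} \<le> 2" by (simp add: card_insert_if)
  ultimately show ?thesis by linarith
qed

text \<open>The common zero space of the hyperplanes through \<open>p\<close> has codimension two,
  since their normals are pairwise nonparallel, at least two in number and contained in a plane. Its
  part in \<open>closure C\<close> is the required face. Minimal galleries stay around it because
  they cross only hyperplanes through \<open>p\<close>.\<close>

lemma sal_cell_at:
  assumes C: "C \<in> regions \<H>" "p \<in> closure C" and C': "C' \<in> regions \<H>" "p \<in> closure C'"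
    and sep: "sep_set \<H> C C' = through \<H> p"
    and two: "card (through \<H> p) \<ge> 2" "\<forall>H\<in>through \<H> p. nrm H \<in> span {u, v}"
    and g: "minimal_gallery \<H> C g C'" "minimal_gallery \<H> C g' C'"
  shows "sal_cell \<H> g g'"
proof -
  define U where "U = {x. \<forall>w\<in>nrm ` through \<H> p. w \<bullet> x = 0}"
  define F where "F = closure C \<inter> U"
  \<comment> \<open>An open set on which every constraint from a hyperplane not through
    \<open>p\<close> is strict. There the face coincides with \<open>U\<close>, so it inherits the
    dimension of \<open>U\<close>.\<close>
  define W where "W = (\<Inter>H\<in>\<H> - through \<H> p. {x. orient C H \<bullet> x > 0})"
  have U: "nrm H \<bullet> x = 0" if "x \<in> U" "H \<in> through \<H> p" for x H
    using that by (auto simp: U_def)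
  have pU: "p \<in> U" by (auto simp: U_def through_iff)
  have pF: "p \<in> F" using C pU by (simp add: F_def)
  have pW: "p \<in> W"
    using C(2) unfolding closure_region[OF C(1)]
    by (force simp: W_def through_iff orient_zero less_le)
  have around: "F \<subseteq> closure M" if M: "M \<in> regions \<H>" "sep_set \<H> C M \<subseteq> through \<H> p" for M
  proof
    fix x assume x: "x \<in> F"
    have "0 \<le> orient M H \<bullet> x" if H: "H \<in> \<H>" for H
    proof (cases "H \<in> through \<H> p")
      case True
      then show ?thesis using U x by (auto simp: F_def orient_def)
    next
      case False
      then have "pos M H = pos C H" using M H by (auto simp: sep_set_eq[OF C(1) M(1)])
      then show ?thesis using x H unfolding F_def closure_region[OF C(1)] by (auto simp: orient_def)
    qed
    then show "x \<in> closure M" by (simp add: closure_region[OF M(1)])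
  qed
  have "subspace U" unfolding U_def by (rule subspace_common_zeros)
  have "open W" unfolding W_def using fin by (intro open_INT) (auto simp: open_halfspace_gt)
  have "dim U = DIM('a) - 2" "2 \<le> DIM('a)"
    using dim_common_zeros[of "nrm ` through \<H> p"] dim_normals_two[OF two(1) through_subset two(2)]
    by (simp_all add: U_def)
  then have aU: "aff_dim U = int DIM('a) - 2"
    using aff_dim_subspace[OF \<open>subspace U\<close>] by simp
  have "U \<inter> W \<subseteq> F"
  proof
    fix x assume x: "x \<in> U \<inter> W"
    have "0 \<le> orient C H \<bullet> x" if H: "H \<in> \<H>" for H
      using x U H by (cases "H \<in> through \<H> p") (auto simp: orient_def W_def less_imp_le)
    then show "x \<in> F" using x by (simp add: F_def closure_region[OF C(1)])
  qed
  moreover have "aff_dim (U \<inter> W) = aff_dim U"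
    using aff_dim_convex_Int_open[OF subspace_imp_convex[OF \<open>subspace U\<close>] \<open>open W\<close>] pU pW by blast
  ultimately have aF: "aff_dim F = int DIM('a) - 2"
    using aU aff_dim_subset[of "U \<inter> W" F] aff_dim_subset[of F U] by (auto simp: F_def)
  have face: "F face_of closure C"
    unfolding face_of_def
  proof (intro conjI ballI impI)
    show "F \<subseteq> closure C" by (simp add: F_def)
    show "convex F" unfolding F_def
      by (intro convex_Int convex_closure region_convex C subspace_imp_convex \<open>subspace U\<close>)
    fix a b x assume *: "a \<in> closure C" "b \<in> closure C" "x \<in> F" "x \<in> open_segment a b"
    then obtain t where t: "0 < t" "t < 1" "x = (1 - t) *\<^sub>R a + t *\<^sub>R b"
      by (auto simp: in_segment)
    have "nrm H \<bullet> a = 0 \<and> nrm H \<bullet> b = 0" if H: "H \<in> through \<H> p" for H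
    proof -
      have "0 \<le> orient C H \<bullet> a" "0 \<le> orient C H \<bullet> b"
        using *(1,2) H through_subset unfolding closure_region[OF C(1)] by blast+
      moreover have "(1 - t) * (orient C H \<bullet> a) + t * (orient C H \<bullet> b) = 0"
        using U[of x H] *(3) H t(3) orient_zero[of C H x] by (simp add: F_def inner_add_right)
      ultimately have "orient C H \<bullet> a = 0 \<and> orient C H \<bullet> b = 0"
        using t(1,2) by (smt (verit) mult_nonneg_nonneg mult_eq_0_iff)
      then show ?thesis by (simp add: orient_zero)
    qed
    then have "a \<in> U" "b \<in> U" by (auto simp: U_def)
    then show "a \<in> F" "b \<in> F" using * by (simp_all add: F_def)
  qed
  have FH: "F \<subseteq> H \<longleftrightarrow> H \<in> through \<H> p" if "H \<in> \<H>" for H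
  proof
    assume "F \<subseteq> H"
    then show "H \<in> through \<H> p" using pF that by (auto simp: through_def)
  next
    assume "H \<in> through \<H> p"
    then show "F \<subseteq> H" using U mem_iff[OF that] by (auto simp: F_def)
  qed
  have ar: "gallery_around F h" if h: "minimal_gallery \<H> C h C'" for h
    unfolding gallery_around_def
  proof
    fix s assume s: "s \<in> set h"
    show "F \<subseteq> closure (step_source s) \<and> F \<subseteq> closure (step_target s)"
      using minimal_gallery_step[OF h s, of "step_source s"] minimal_gallery_step[OF h s, of "step_target s"]
        around sep by simp
  qed
  have "{H \<in> \<H>. F \<subseteq> H} = through \<H> p" using FH through_subset by blast
  moreover have "F \<subseteq> closure C'" "F \<subseteq> closure C"
    using around[OF C'(1)] around[OF C(1)] sep sep_refl[OF C(1)] by simp_all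
  ultimately have "opposite_at \<H> F C C'" "F \<subseteq> closure C"
    using C' sep by (simp_all add: opposite_at_def)
  moreover have "codim2_face \<H> F"
    unfolding codim2_face_def using pF aF face C(1) by blast
  ultimately show ?thesis
    unfolding sal_cell_def using C(1) g ar[OF g(1)] ar[OF g(2)] by blast
qed

end

section \<open>Minimal galleries are homotopic\<close>

definition starts :: "'a::euclidean_space set set \<Rightarrow> 'a set \<Rightarrow> 'a step list \<Rightarrow> 'a set \<Rightarrow> bool" where
  "starts \<H> D g H \<longleftrightarrow> (\<exists>D' g'. g = Along (D, D') # g' \<and> sep_set \<H> D D' = {H})"

context central begin

lemma minimal_gallery_starts:
  assumes "minimal_gallery \<H> D g E" "D \<noteq> E"
  obtains H where "starts \<H> D g H" "H \<in> sep_set \<H> D E"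
  using assms by (cases g) (auto simp: minimal_gallery_Nil minimal_gallery_Cons starts_def)

text \<open>\<open>M\<close> lies across all hyperplanes through \<open>p\<close>. By induction
  after its first edge, each gallery can be rerouted through \<open>M\<close> with a common tail
  \<open>k\<close>; the two initial parts then bound the 2-cell at \<open>p\<close>.\<close>

lemma homotopic_via_point:
  assumes D: "D \<in> regions \<H>" and E: "E \<in> regions \<H>"
    and IH: "\<And>D' g h. \<lbrakk>card (sep_set \<H> D' E) < card (sep_set \<H> D E); minimal_gallery \<H> D' g E;
      minimal_gallery \<H> D' h E\<rbrakk> \<Longrightarrow> sal_homotopic \<H> D' E g h"
    and p: "p \<in> closure D" "through \<H> p \<subseteq> sep_set \<H> D E"
    and two: "\<forall>H\<in>through \<H> p. nrm H \<in> span {u, v}"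
    and g: "minimal_gallery \<H> D g E" "starts \<H> D g G" "G \<in> through \<H> p"
    and h: "minimal_gallery \<H> D h E" "starts \<H> D h H" "H \<in> through \<H> p"
  shows "sal_homotopic \<H> D E g h"
proof -
  obtain M where M: "M \<in> regions \<H>" "p \<in> closure M" "sep_set \<H> D M = through \<H> p"
    using opposite D p(1) by blast
  obtain k where k: "minimal_gallery \<H> M k E" using minimal_gallery_exists M E by blast
  have ME: "sep_set \<H> M E = sep_set \<H> D E - through \<H> p"
    using sep_set_via[OF M(1) D E] sep_set_commute[OF D M(1)] M(3) p(2) by auto
  have *: "\<exists>a. minimal_gallery \<H> D a M \<and> starts \<H> D a G \<and> sal_homotopic \<H> D E g (a @ k)"
    if g: "minimal_gallery \<H> D g E" "starts \<H> D g G" "G \<in> through \<H> p" for g G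
  proof -
    obtain D' g' where D': "D' \<in> regions \<H>" "g = Along (D, D') # g'" "sep_set \<H> D D' = {G}"
        "minimal_gallery \<H> D' g' E"
      using g(1,2) by (auto simp: starts_def minimal_gallery_Cons)
    have GE: "G \<in> sep_set \<H> D E" using g(3) p(2) by blast
    have DE: "sep_set \<H> D' E = sep_set \<H> D E - {G}" by (rule sep_step(1)[OF D D'(1) E D'(3) GE])
    have DM: "sep_set \<H> D' M = through \<H> p - {G}"
      using sep_step(1)[OF D D'(1) M(1) D'(3)] M(3) g(3) by simp
    obtain b where b: "minimal_gallery \<H> D' b M" using minimal_gallery_exists D' M by blast
    have "minimal_gallery \<H> D' (b @ k) E"
      by (rule minimal_gallery_append[OF b k]) (auto simp: DM ME)
    moreover have "card (sep_set \<H> D' E) < card (sep_set \<H> D E)"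
      unfolding DE using GE finite_sep by (intro psubset_card_mono) auto
    ultimately have "sal_homotopic \<H> D' E g' (b @ k)" using IH D'(4) by blast
    moreover have "sal_path \<H> D [Along (D, D')] D'" using D D' by (auto simp: sal_edge_iff)
    moreover have "sal_path \<H> E [] E" using E by simp
    ultimately have "sal_homotopic \<H> D E ([Along (D, D')] @ g' @ []) ([Along (D, D')] @ (b @ k) @ [])"
      by (rule sal_homotopic_extend)
    then have "sal_homotopic \<H> D E g ((Along (D, D') # b) @ k)" using D'(2) by simp
    moreover have "minimal_gallery \<H> D (Along (D, D') # b) M"
      using D D' b g(3) M(3) by (auto simp: minimal_gallery_Cons)
    moreover have "starts \<H> D (Along (D, D') # b) G" using D'(3) by (auto simp: starts_def)
    ultimately show ?thesis by blast
  qed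
  obtain a where a: "minimal_gallery \<H> D a M" "starts \<H> D a G" "sal_homotopic \<H> D E g (a @ k)"
    using *[OF g] by blast
  obtain b where b: "minimal_gallery \<H> D b M" "starts \<H> D b H" "sal_homotopic \<H> D E h (b @ k)"
    using *[OF h] by blast
  have ab: "sal_path \<H> D (a @ k) E" "sal_path \<H> D (b @ k) E"
    using sal_homotopic_path a(3) b(3) by blast+
  have "sal_homotopic \<H> D E (a @ k) (b @ k)"
  proof (cases "card (through \<H> p) \<ge> 2")
    case True
    have "sal_cell \<H> a b"
      using sal_cell_at[OF D p(1) M(1,2) M(3) True two a(1) b(1)] .
    then show ?thesis using sal_homotopic.cell[of \<H> D "[]" a k E b] ab by simp
  next
    \<comment> \<open>With a single hyperplane through \<open>p\<close> there is no face of
      codimension two to use: both initial parts are the same edge.\<close>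
    case False
    have "card (through \<H> p) > 0" using g(3) finite_through card_gt_0_iff by blast
    then have "card (through \<H> p) = 1" using False by linarith
    then obtain H where H: "through \<H> p = {H}" using card_1_singletonE by blast
    have "c = [Along (D, M)]" if c: "minimal_gallery \<H> D c M" for c
    proof -
      have "length c = 1" using c M(3) H by (simp add: minimal_gallery_def)
      then obtain s where "c = [s]" by (cases c) auto
      then show ?thesis using c by (auto simp: minimal_gallery_Cons minimal_gallery_Nil)
    qed
    then have "a = [Along (D, M)]" "b = [Along (D, M)]" using a(1) b(1) by blast+
    then have "a = b" by simp
    then show ?thesis using ab sal_homotopic.refl by blast
  qed
  then show ?thesis
    using a(3) b(3) sal_homotopic.trans sal_homotopic.sym by metis
qed

lemma nrm_in_span:
  assumes "D \<in> regions \<H>" "E \<in> regions \<H>" "y \<in> E" "H \<in> sep_set \<H> D E" "weight D y H \<in> span A"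
  shows "nrm H \<in> span A"
proof -
  have "orient D H = (- (orient D H \<bullet> y)) *\<^sub>R weight D y H"
    using orient_neg[OF assms(1-4)] by (simp add: weight_def)
  then have "orient D H \<in> span A" using assms(5) by (metis span_scale)
  then show ?thesis using span_neg by (fastforce simp: orient_def split: if_splits)
qed

text \<open>For a generic starting point in \<open>D\<close>, the ray towards \<open>y\<close> leaves \<open>D\<close> through one wall only, and
  along a generic segment of starting points it never meets a face of codimension above two.\<close>

definition triple_normal :: "'a set \<Rightarrow> 'a \<Rightarrow> 'a \<Rightarrow> 'a set \<Rightarrow> 'a set \<Rightarrow> 'a set \<Rightarrow> 'a" where
  "triple_normal D y x H K L =
    ((weight D y H - weight D y K) \<bullet> x) *\<^sub>R (weight D y H - weight D y L) -
    ((weight D y H - weight D y L) \<bullet> x) *\<^sub>R (weight D y H - weight D y K)"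

text \<open>Three hyperplanes hit together make two differences of weights vanish at the same point
  of the segment. Eliminating \<open>t\<close> leaves a linear equation for \<open>x'\<close> with
  coefficient vector \<open>triple_normal\<close>. Since \<open>x'\<close> is generic, that vector
  is zero, so the differences are parallel and the normals lie in a plane.\<close>

lemma hits_rank_two:
  assumes DE: "D \<in> regions \<H>" "E \<in> regions \<H>" "y \<in> E" "D \<noteq> E"
    and x: "\<forall>v\<in>weight_diffs D E y. v \<bullet> x \<noteq> 0"
    and x': "\<forall>H\<in>sep_set \<H> D E. \<forall>K\<in>sep_set \<H> D E. \<forall>L\<in>sep_set \<H> D E.
      triple_normal D y x H K L \<noteq> 0 \<longrightarrow> triple_normal D y x H K L \<bullet> x' \<noteq> 0"
  obtains u v where "\<forall>H\<in>hits D E y ((1 - t) *\<^sub>R x + t *\<^sub>R x'). nrm H \<in> span {u, v}"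
proof -
  let ?W = "hits D E y ((1 - t) *\<^sub>R x + t *\<^sub>R x')"
  let ?w = "weight D y"
  obtain H where H: "H \<in> ?W" using hits_nonempty DE by metis
  have WS: "?W \<subseteq> sep_set \<H> D E" by (auto simp: hits_def)
  show ?thesis
  proof (cases "?W = {H}")
    case True
    then have "\<forall>K\<in>?W. nrm K \<in> span {nrm H, nrm H}" by (simp add: span_base)
    then show ?thesis using that by blast
  next
    case False
    then obtain K where K: "K \<in> ?W" "K \<noteq> H" using H by blast
    have eq: "(1 - t) * ((?w H - ?w L) \<bullet> x) + t * ((?w H - ?w L) \<bullet> x') = 0" if "L \<in> ?W" for L
    proof -
      have "?w H \<bullet> ((1 - t) *\<^sub>R x + t *\<^sub>R x') = ?w L \<bullet> ((1 - t) *\<^sub>R x + t *\<^sub>R x')"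
        using that H by (auto simp: hits_def intro!: antisym)
      then show ?thesis by (simp add: inner_add_right inner_diff_left algebra_simps)
    qed
    have "?w H - ?w K \<in> weight_diffs D E y" using H K WS unfolding weight_diffs_def by blast
    then have nz: "(?w H - ?w K) \<bullet> x \<noteq> 0" using x by blast
    have "nrm L \<in> span {?w H, ?w K}" if L: "L \<in> ?W" for L
    proof -
      have "triple_normal D y x H K L \<bullet> x' = 0"
        using determinant_zero[OF eq[OF K(1)] eq[OF L]]
        by (simp add: triple_normal_def inner_diff_left)
      then have "triple_normal D y x H K L = 0" using x' H K L WS by blast
      then have "((?w H - ?w K) \<bullet> x) *\<^sub>R (?w H - ?w L) = ((?w H - ?w L) \<bullet> x) *\<^sub>R (?w H - ?w K)"
        by (simp add: triple_normal_def)
      then have "?w H - ?w L = (((?w H - ?w L) \<bullet> x) / ((?w H - ?w K) \<bullet> x)) *\<^sub>R (?w H - ?w K)"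
        using scaleR_eq_divide[OF _ nz] by blast
      then have "?w L = ?w H - (((?w H - ?w L) \<bullet> x) / ((?w H - ?w K) \<bullet> x)) *\<^sub>R (?w H - ?w K)"
        by (simp add: algebra_simps)
      also have "\<dots> \<in> span {?w H, ?w K}"
        by (intro span_diff span_scale span_base) auto
      finally show ?thesis using nrm_in_span[OF DE(1-3)] L WS by blast
    qed
    then show ?thesis using that by blast
  qed
qed

text \<open>The points of \<open>D\<close> from which the ray leaves first through the initial wall
  of \<open>g\<close> form an open set, nonempty because it contains points just behind the facet.
  Both ends of the generic segment are taken from such sets.\<close>

lemma starting_points:
  assumes DE: "D \<in> regions \<H>" "E \<in> regions \<H>" "y \<in> E" "D \<noteq> E"
    and g: "minimal_gallery \<H> D g E" "starts \<H> D g H"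
    and V: "finite V" "0 \<notin> V"
  obtains x where "x \<in> D" "hits D E y x = {H}" "\<forall>v\<in>V. v \<bullet> x \<noteq> 0"
proof -
  let ?S = "sep_set \<H> D E"
  let ?w = "weight D y"
  obtain D' g' where D': "D' \<in> regions \<H>" "g = Along (D, D') # g'" "sep_set \<H> D D' = {H}" "H \<in> ?S"
    using g by (auto simp: starts_def minimal_gallery_Cons)
  define S where "S = D \<inter> (\<Inter>K\<in>?S - {H}. {x. ?w H \<bullet> x < ?w K \<bullet> x})"
  have "open S" unfolding S_def
    using finite_sep region_open[OF DE(1)]
    by (intro open_Int open_INT) (auto intro!: open_Collect_less continuous_intros)
  moreover have "S \<noteq> {}"
  proof -
    obtain p where p: "through \<H> p = {H}" "p \<in> closure D" "p \<in> closure D'"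
      using facet_point DE(1) D' by blast
    have nz: "orient D K \<bullet> p \<noteq> 0" if "K \<in> \<H>" "K \<noteq> H" for K
      using that p(1) by (auto simp: through_iff orient_zero)
    have ge: "0 \<le> orient D K \<bullet> p" if "K \<in> \<H>" for K
      using p(2) that unfolding closure_region[OF DE(1)] by blast
    have pos: "0 < orient D K \<bullet> p" if "K \<in> \<H>" "K \<noteq> H" for K
      using nz[OF that] ge[OF that(1)] by simp
    have z: "orient D H \<bullet> p = 0" using p(1) by (auto simp: through_iff orient_zero)
    have "\<forall>K\<in>\<H>. 0 < orient D K \<bullet> p \<or> orient D K \<bullet> p = 0 \<and> 0 < - (orient D K \<bullet> y)"
      using pos z orient_neg[OF DE(1-3) D'(4)] by (metis neg_0_less_iff_less)
    then obtain e where e: "0 < e" "\<forall>K\<in>\<H>. 0 < orient D K \<bullet> p + e * - (orient D K \<bullet> y)"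
      by (rule lex_positive[OF fin])
    \<comment> \<open>Stepping back from \<open>p\<close> against the ray adds the same
      \<open>e\<close> to every crossing time, so \<open>H\<close>, whose time at \<open>p\<close>
      is zero, stays first.\<close>
    define x where "x = p - e *\<^sub>R y"
    have "x \<in> D" using e(2) by (subst region_eq[OF DE(1)]) (simp add: x_def inner_diff_right)
    moreover have "?w H \<bullet> x < ?w K \<bullet> x" if K: "K \<in> ?S" "K \<noteq> H" for K
    proof -
      have "K \<in> \<H>" using K sep_set_subset by blast
      have "?w H \<bullet> p = 0" using z by (simp add: weight_def)
      moreover have "0 < ?w K \<bullet> p"
        using pos[OF \<open>K \<in> \<H>\<close> K(2)] orient_neg[OF DE(1-3) K(1)] by (simp add: weight_def divide_less_0_iff)
      ultimately show ?thesis
        using weight_inner_self[OF DE(1-3) D'(4)] weight_inner_self[OF DE(1-3) K(1)]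
        by (simp add: x_def inner_diff_right)
    qed
    ultimately show ?thesis by (auto simp: S_def)
  qed
  ultimately obtain x where x: "x \<in> S" "\<forall>v\<in>V. v \<bullet> x \<noteq> 0" using generic_point V by blast
  have lt: "?w H \<bullet> x < ?w K \<bullet> x" if "K \<in> ?S" "K \<noteq> H" for K using x(1) that by (auto simp: S_def)
  have le: "?w H \<bullet> x \<le> ?w K \<bullet> x" if "K \<in> ?S" for K using lt[OF that] by (cases "K = H") auto
  have "K \<in> hits D E y x \<longleftrightarrow> K = H" for K
  proof
    assume "K \<in> hits D E y x"
    then have "K \<in> ?S" "?w K \<bullet> x \<le> ?w H \<bullet> x" using D'(4) by (simp_all add: hits_def)
    then show "K = H" using lt[of K] by force
  qed (use le D'(4) in \<open>simp add: hits_def\<close>)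
  then have "hits D E y x = {H}" by blast
  then show ?thesis using that x by (auto simp: S_def)
qed

text \<open>A hyperplane that is not first at \<open>a\<close> is strictly later than another one
  there, and a strict inequality persists nearby; so close to \<open>a\<close> the set of first hits
  can only shrink.\<close>

lemma hits_local:
  assumes a: "a \<in> {0..1::real}"
  shows "\<exists>T. openin (top_of_set {0..1::real}) T \<and> a \<in> T \<and>
    (\<forall>t\<in>T. hits D E y ((1 - t) *\<^sub>R x + t *\<^sub>R x') \<subseteq> hits D E y ((1 - a) *\<^sub>R x + a *\<^sub>R x'))"
proof -
  define W where "W t = hits D E y ((1 - t) *\<^sub>R x + t *\<^sub>R x')" for t
  define f where "f H t = weight D y H \<bullet> ((1 - t) *\<^sub>R x + t *\<^sub>R x')" for H t
  let ?S = "sep_set \<H> D E"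
  have "\<forall>H\<in>?S - W a. \<exists>K\<in>?S. f K a < f H a" by (auto simp: W_def hits_def f_def not_le)
  then obtain k where k: "\<And>H. H \<in> ?S - W a \<Longrightarrow> k H \<in> ?S \<and> f (k H) a < f H a" by metis
  define T where "T = {0..1} \<inter> (\<Inter>H\<in>?S - W a. {t. f (k H) t < f H t})"
  have "open (\<Inter>H\<in>?S - W a. {t. f (k H) t < f H t})"
    unfolding f_def using finite_sep
    by (intro open_INT) (auto intro!: open_Collect_less continuous_intros)
  then have "openin (top_of_set {0..1}) T" unfolding T_def by (rule openin_open_Int)
  moreover have "a \<in> T" using a k by (auto simp: T_def)
  moreover have "W t \<subseteq> W a" if "t \<in> T" for t
  proof
    fix H assume H: "H \<in> W t"
    show "H \<in> W a"
    proof (rule ccontr)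
      assume "H \<notin> W a"
      then have "H \<in> ?S - W a" using H by (simp add: W_def hits_def)
      then have "f (k H) t < f H t" "k H \<in> ?S" using that k by (auto simp: T_def)
      then show False using H by (force simp: W_def hits_def f_def)
    qed
  qed
  ultimately show ?thesis unfolding W_def by blast
qed

theorem minimal_galleries_homotopic:
  assumes "minimal_gallery \<H> D g E" "minimal_gallery \<H> D h E"
  shows "sal_homotopic \<H> D E g h"
  using assms
proof (induction "card (sep_set \<H> D E)" arbitrary: D g h rule: less_induct)
  case (less D g h)
  have D: "D \<in> regions \<H>" and E: "E \<in> regions \<H>" using minimal_gallery_regions less.prems by blast+
  show ?case
  proof (cases "D = E")
    case True
    then have "g = []" "h = []" using less.prems sep_refl[OF D] by (simp_all add: minimal_gallery_def)
    then show ?thesis using minimal_gallery_path[OF less.prems(1)] sal_homotopic.refl by metis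
  next
    case False
    obtain G where G: "starts \<H> D g G" "G \<in> sep_set \<H> D E" using minimal_gallery_starts less.prems False by blast
    obtain H where H: "starts \<H> D h H" "H \<in> sep_set \<H> D E" using minimal_gallery_starts less.prems False by blast
    obtain y where y: "y \<in> E" using region_nonempty E by blast
    let ?S = "sep_set \<H> D E"
    obtain x where x: "x \<in> D" "hits D E y x = {G}" "\<forall>v\<in>weight_diffs D E y. v \<bullet> x \<noteq> 0"
      using starting_points[OF D E y False less.prems(1) G(1) weight_diffs[OF D E y]] by blast
    \<comment> \<open>These vectors depend on \<open>x\<close>, so the other end \<open>x'\<close>
      can be chosen only after \<open>x\<close>.\<close>
    define V where "V = {triple_normal D y x H K L | H K L. H \<in> ?S \<and> K \<in> ?S \<and> L \<in> ?S} - {0}"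
    have "V \<subseteq> (\<lambda>(H, K, L). triple_normal D y x H K L) ` (?S \<times> ?S \<times> ?S)"
    proof
      fix w assume "w \<in> V"
      then obtain H K L where "w = triple_normal D y x H K L" "(H, K, L) \<in> ?S \<times> ?S \<times> ?S"
        unfolding V_def by blast
      then show "w \<in> (\<lambda>(H, K, L). triple_normal D y x H K L) ` (?S \<times> ?S \<times> ?S)"
        by (intro image_eqI[of _ _ "(H, K, L)"]) auto
    qed
    then have "finite V" using finite_subset finite_imageI finite_cartesian_product finite_sep by metis
    moreover have "0 \<notin> V" by (simp add: V_def)
    ultimately obtain x' where x': "x' \<in> D" "hits D E y x' = {H}" "\<forall>v\<in>V. v \<bullet> x' \<noteq> 0"
      using starting_points[OF D E y False less.prems(2) H(1)] by blast
    have x'': "\<forall>H\<in>?S. \<forall>K\<in>?S. \<forall>L\<in>?S. triple_normal D y x H K L \<noteq> 0 \<longrightarrow> triple_normal D y x H K L \<bullet> x' \<noteq> 0"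
      using x'(3) unfolding V_def by blast
    define z where "z t = (1 - t) *\<^sub>R x + t *\<^sub>R x'" for t :: real
    \<comment> \<open>Quantifying over all galleries that begin with a wall of the first hit avoids
      any choice of a gallery along the segment.\<close>
    define R where "R a b \<longleftrightarrow> (\<forall>g h G H. minimal_gallery \<H> D g E \<and> minimal_gallery \<H> D h E \<and>
      starts \<H> D g G \<and> starts \<H> D h H \<and> G \<in> hits D E y (z a) \<and> H \<in> hits D E y (z b) \<longrightarrow>
      sal_homotopic \<H> D E g h)" for a b
    have zD: "z t \<in> D" if "t \<in> {0..1}" for t
      using convexD_alt[OF region_convex[OF D] x(1) x'(1)] that by (simp add: z_def)
    have hub: "R a a" if a: "a \<in> {0..1}" for a
    proof -
      obtain p where p: "p \<in> closure D" "through \<H> p = hits D E y (z a)"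
        using first_hit[OF D E False zD[OF a] y] by blast
      obtain u v where two: "\<forall>H\<in>through \<H> p. nrm H \<in> span {u, v}"
        using hits_rank_two[OF D E y False x(3) x''] p(2) unfolding z_def by metis
      have "through \<H> p \<subseteq> ?S" using p(2) by (auto simp: hits_def)
      then show ?thesis unfolding R_def p(2)[symmetric]
        using homotopic_via_point[OF D E less.hyps p(1) _ two] by blast
    qed
    have "R 0 1"
    proof (rule connected_equivalence_relation[of "{0..1}"])
      show "R b a" if "R a b" for a b
        using that sal_homotopic.sym unfolding R_def by blast
      \<comment> \<open>A parameter without galleries would be related to everything, so a gallery
        starting with a wall hit at \<open>b\<close> has to be exhibited.\<close>
      show "R a c" if ab: "R a b" and bc: "R b c" and "b \<in> {0..1}" for a b c
      proof -
        obtain p where p: "p \<in> closure D" "through \<H> p = hits D E y (z b)"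
          using first_hit[OF D E False zD y] \<open>b \<in> _\<close> by blast
        obtain M where M: "M \<in> regions \<H>" "sep_set \<H> D M = hits D E y (z b)"
          using opposite[OF D p(1)] p(2) by metis
        obtain K where "K \<in> hits D E y (z b)" using hits_nonempty[OF D E False] by blast
        then have "D \<noteq> M" using M sep_refl by auto
        then obtain D' K where K: "D' \<in> regions \<H>" "sep_set \<H> D D' = {K}" "K \<in> hits D E y (z b)"
          using wall[OF D M(1)] M(2) by metis
        obtain k where k: "minimal_gallery \<H> D' k E" using minimal_gallery_exists K E by blast
        have "K \<in> ?S" using K by (simp add: hits_def)
        then have "minimal_gallery \<H> D (Along (D, D') # k) E"
          unfolding minimal_gallery_Cons using D K(1,2) k by blast
        moreover have "starts \<H> D (Along (D, D') # k) K" using K by (simp add: starts_def)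
        ultimately show ?thesis
          using ab bc K(3) sal_homotopic.trans unfolding R_def by meson
      qed
      show "\<exists>T. openin (top_of_set {0..1}) T \<and> a \<in> T \<and> (\<forall>t\<in>T. R a t)" if a: "a \<in> {0..1}" for a
      proof -
        obtain T where T: "openin (top_of_set {0..1}) T" "a \<in> T"
          "\<forall>t\<in>T. hits D E y (z t) \<subseteq> hits D E y (z a)"
          using hits_local[OF a, of D E y x x'] unfolding z_def by blast
        \<comment> \<open>Walls hit first at \<open>t\<close> are also hit first at
          \<open>a\<close>, so the comparison at \<open>a\<close> alone covers both
          parameters.\<close>
        have "R a t" if "t \<in> T" for t
          using hub[OF a] T(3) that unfolding R_def by blast
        then show ?thesis using T by blast
      qed
    qed auto
    moreover have "z 0 = x" "z 1 = x'" by (simp_all add: z_def)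
    ultimately show ?thesis using less.prems G(1) H(1) x(2) x'(2) unfolding R_def by auto
  qed
qed

end

section \<open>Loops of edges around a face\<close>

context central begin

definition ascent :: "'a set \<Rightarrow> 'a set \<Rightarrow> 'a set \<Rightarrow> 'a set \<Rightarrow> bool" where
  "ascent B H C' C \<longleftrightarrow> C' \<in> regions \<H> \<and> C \<in> regions \<H> \<and> sep_set \<H> C' C = {H} \<and> H \<notin> sep_set \<H> B C'"

text \<open>The first wall from \<open>C'\<close> toward \<open>C\<close> leads to a region of the
  interval different from \<open>C'\<close>, which the covering condition forces to be
  \<open>C\<close>.\<close>

lemma weak_cover_ascent:
  assumes B: "B \<in> regions \<H>" and cov: "weak_cover \<H> B C' C"
  obtains H where "ascent B H C' C"
proof -
  have C: "C' \<in> regions \<H>" "C \<in> regions \<H>" "sep_set \<H> B C' \<subseteq> sep_set \<H> B C" "C' \<noteq> C"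
    and no: "\<And>E. \<not> (weak_less \<H> B C' E \<and> weak_less \<H> B E C)"
    using cov by (auto simp: weak_cover_def weak_less_def weak_le_def)
  have sep: "sep_set \<H> C' C = sep_set \<H> B C - sep_set \<H> B C'"
    using sep_set_via[OF C(1) B C(2)] C(3) sep_set_commute[OF B C(1)] by auto
  obtain D H where D: "D \<in> regions \<H>" "sep_set \<H> C' D = {H}" "H \<in> sep_set \<H> C' C"
    using wall[OF C(1,2,4)] by blast
  have "sep_set \<H> B D = sep_set \<H> B C' \<union> {H}"
    using sep_set_via[OF B C(1) D(1)] D(2,3) sep by auto
  then have "weak_le \<H> B C' D" "weak_le \<H> B D C" "C' \<noteq> D"
    using C D sep sep_refl[OF C(1)] by (auto simp: weak_le_def)
  then have "D = C" using no[of D] by (auto simp: weak_less_def)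
  then show ?thesis using that D C sep unfolding ascent_def by blast
qed

lemma ascent_edges: "ascent B H C' C \<Longrightarrow> (C', C) \<in> sal_edges \<H> \<and> (C, C') \<in> sal_edges \<H>"
  using sep_set_commute by (auto simp: ascent_def sal_edge_iff)

lemma edge_gallery: "\<lbrakk>C \<in> regions \<H>; D \<in> regions \<H>; sep_set \<H> C D = {H}\<rbrakk> \<Longrightarrow> minimal_gallery \<H> C [Along (C, D)] D"
  by (auto simp: minimal_gallery_Cons minimal_gallery_Nil)

text \<open>\<open>gal\<close> is an unspecified choice; homotopy of minimal galleries lets a
  convenient one replace it.\<close>

lemma ell_gallery:
  assumes B: "B \<in> regions \<H>" and C: "ascent B H C' C" and g: "minimal_gallery \<H> B g C'"
  shows "ell \<H> B (C', C) = loop_class \<H> B (g @ [Along (C', C), Along (C, C')] @ path_rev g)"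
    "sal_path \<H> B (g @ [Along (C', C), Along (C, C')] @ path_rev g) B"
proof -
  let ?e = "[Along (C', C), Along (C, C')]"
  have C': "C' \<in> regions \<H>" using C by (simp add: ascent_def)
  have e: "sal_path \<H> C' ?e C'" using ascent_edges[OF C] C' by simp
  have hom: "sal_homotopic \<H> B C' (gal \<H> B C') g"
    using minimal_galleries_homotopic gal[OF B C'] g by blast
  have *: "sal_homotopic \<H> B B (gal \<H> B C' @ ?e @ path_rev (gal \<H> B C')) (g @ ?e @ path_rev g)"
    by (intro sal_homotopic_append[OF hom] sal_homotopic_append[OF sal_homotopic.refl[OF e]] homotopic_rev[OF hom])
  show "ell \<H> B (C', C) = loop_class \<H> B (g @ ?e @ path_rev g)"
    unfolding ell_def prod.case loop_class_eq_iff[OF conjunct1[OF sal_homotopic_path[OF *]]] by (rule *)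
  show "sal_path \<H> B (g @ ?e @ path_rev g) B" using sal_homotopic_path[OF *] by simp
qed

text \<open>Both edges lie over the same wall of two opposite regions around a face whose hyperplanes
  form \<open>T\<close>; the two square relations at \<open>C'\<close> and at \<open>C\<close> conjugate one loop into the other.\<close>

lemma ell_opposite:
  assumes B: "B \<in> regions \<H>" and e: "ascent B H C' C" and f: "ascent B H D' D"
    and T: "H \<notin> T" "sep_set \<H> C' D' = T" "T \<inter> sep_set \<H> B C' = {}"
  shows "ell \<H> B (C', C) = ell \<H> B (D', D)"
proof -
  have C: "C' \<in> regions \<H>" "C \<in> regions \<H>" "sep_set \<H> C' C = {H}" and D: "D' \<in> regions \<H>" "D \<in> regions \<H>" "sep_set \<H> D' D = {H}"
    using e f by (simp_all add: ascent_def)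
  have C'D: "sep_set \<H> C' D = insert H T"
    using sep_set_via[OF C(1) D(1,2)] T D(3) by auto
  have CD: "sep_set \<H> C D = T"
    using sep_step(1)[OF C(1,2) D(2) C(3)] C'D T(1) by auto
  have CC': "sep_set \<H> C C' = {H}" and DD': "sep_set \<H> D D' = {H}"
    using C D sep_set_commute by auto
  obtain a where a: "minimal_gallery \<H> B a C'" using minimal_gallery_exists B C by blast
  obtain g where g: "minimal_gallery \<H> C' g D'" using minimal_gallery_exists C D by blast
  obtain k where k: "minimal_gallery \<H> C k D" using minimal_gallery_exists C D by blast
  let ?e = "Along (C', C)" and ?e' = "Along (C, C')" and ?f = "Along (D', D)" and ?f' = "Along (D, D')"
  have ag: "minimal_gallery \<H> B (a @ g) D'"
    by (rule minimal_gallery_append[OF a g]) (use T in auto)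
  note ed = edge_gallery[OF C] edge_gallery[OF C(2,1) CC'] edge_gallery[OF D] edge_gallery[OF D(2,1) DD']
  have 1: "sal_homotopic \<H> C' D (g @ [?f]) ([?e] @ k)"
    by (intro minimal_galleries_homotopic minimal_gallery_append[OF g ed(3)] minimal_gallery_append[OF ed(1) k])
      (use T C D CD in auto)
  have 2: "sal_homotopic \<H> C D' (k @ [?f']) ([?e'] @ g)"
    by (intro minimal_galleries_homotopic minimal_gallery_append[OF k ed(4)] minimal_gallery_append[OF ed(2) g])
      (use T CD CC' DD' in auto)
  note paths = minimal_gallery_path[OF a] minimal_gallery_path[OF g] minimal_gallery_path[OF k]
    ed[THEN minimal_gallery_path]
  note refls = paths[THEN sal_homotopic.refl] paths[THEN sal_path_rev, THEN sal_homotopic.refl]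
  have "sal_homotopic \<H> C' C' ((g @ [?f]) @ ([?f'] @ path_rev g)) (([?e] @ k) @ ([?f'] @ path_rev g))"
    by (rule sal_homotopic_append[OF 1 sal_homotopic_append[OF refls(7) refls(9)]])
  moreover have "sal_homotopic \<H> C' C' ([?e] @ ((k @ [?f']) @ path_rev g)) ([?e] @ (([?e'] @ g) @ path_rev g))"
    by (rule sal_homotopic_append[OF refls(4) sal_homotopic_append[OF 2 refls(9)]])
  moreover have "sal_homotopic \<H> C' C' ([?e] @ ([?e'] @ (g @ path_rev g))) ([?e] @ ([?e'] @ []))"
    by (rule sal_homotopic_append[OF refls(4) sal_homotopic_append[OF refls(5) homotopic_rev_right[OF paths(2)]]])
  ultimately have 3: "sal_homotopic \<H> C' C' (g @ [?f, ?f'] @ path_rev g) [?e, ?e']"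
    by (simp only: append_assoc append_Cons append_Nil append_Nil2) (blast intro: sal_homotopic.trans)
  have "sal_homotopic \<H> B B (a @ (g @ [?f, ?f'] @ path_rev g) @ path_rev a) (a @ [?e, ?e'] @ path_rev a)"
    by (rule sal_homotopic_append[OF refls(1) sal_homotopic_append[OF 3 refls(8)]])
  then have hom: "sal_homotopic \<H> B B ((a @ g) @ [?f, ?f'] @ path_rev (a @ g)) (a @ [?e, ?e'] @ path_rev a)"
    by (simp add: path_rev_append)
  show ?thesis
    using hom ell_gallery[OF B e a] ell_gallery[OF B f ag] loop_class_eq_iff by metis
qed

lemma normal_combination:
  assumes "H \<in> \<H>" "K \<in> \<H>" "H \<noteq> K" "nrm H \<in> span {u, v}" "nrm K \<in> span {u, v}" "w \<in> span {u, v}"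
  obtains a b where "w = a *\<^sub>R nrm H + b *\<^sub>R nrm K"
proof -
  have "dim (nrm ` {H, K}) = 2" using assms by (intro dim_normals_two[of _ u v]) auto
  then have d: "dim {nrm H, nrm K} = 2" by simp
  have "dim (span {u, v}) \<le> dim {nrm H, nrm K}"
    unfolding d dim_span by (rule order.trans[OF dim_le_card']) (auto simp: card_insert_if)
  then have "span {nrm H, nrm K} = span (span {u, v})"
    using assms by (intro dim_eq_span) auto
  then have "w \<in> span {nrm H, nrm K}" using assms(6) by (simp add: span_span)
  then obtain a where "w - a *\<^sub>R nrm H \<in> span {nrm K}" using span_insert[of "nrm H"] by blast
  then obtain b where "w - a *\<^sub>R nrm H = b *\<^sub>R nrm K" by (auto simp: span_singleton)
  then have "w = a *\<^sub>R nrm H + b *\<^sub>R nrm K" by (simp add: algebra_simps)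
  then show ?thesis using that by blast
qed

text \<open>The other members of a rank two family all meet \<open>H\<close> in the same subspace,
  so their oriented normals are proportional on \<open>H\<close>, and \<open>z\<close> shows the
  factors to be positive. A facet in \<open>H\<close> therefore lies on the base side of all of them
  or of none.\<close>

lemma ascent_side:
  assumes B: "B \<in> regions \<H>" and e: "ascent B H C' C" and H: "H \<in> \<A>" "\<A> \<subseteq> \<H>"
    and two: "\<forall>K\<in>\<A>. nrm K \<in> span {u, v}"
    and z: "nrm H \<bullet> z = 0" "\<forall>K\<in>\<A> - {H}. 0 < orient B K \<bullet> z"
  shows "\<A> \<inter> sep_set \<H> B C' = {} \<or> \<A> \<inter> sep_set \<H> B C' = \<A> - {H}"
proof -
  have C: "C' \<in> regions \<H>" "C \<in> regions \<H>" "sep_set \<H> C' C = {H}" "H \<notin> sep_set \<H> B C'"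
    using e by (simp_all add: ascent_def)
  obtain c where c: "through \<H> c = {H}" "c \<in> closure C'" "c \<in> closure C"
    by (rule facet_point[OF C(1-3)])
  have "K \<in> through \<H> c \<longleftrightarrow> K = H" for K by (simp add: c(1))
  then have cH: "nrm H \<bullet> c = 0" "\<And>K. K \<in> \<A> - {H} \<Longrightarrow> nrm K \<bullet> c \<noteq> 0"
    using H(2) unfolding through_iff by blast+
  have sep: "K \<in> sep_set \<H> B C' \<longleftrightarrow> orient B K \<bullet> c < 0" if "K \<in> \<A> - {H}" for K
    using closure_pos[OF C(1) c(2), of K] cH(2)[OF that] that H(2)
    by (auto simp: sep_set_eq[OF B C(1)] orient_def)
  have same: "orient B K \<bullet> c < 0 \<longleftrightarrow> orient B L \<bullet> c < 0" if K: "K \<in> \<A> - {H}" and L: "L \<in> \<A> - {H}" for K L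
  proof -
    obtain a b where "orient B L = a *\<^sub>R nrm H + b *\<^sub>R nrm K"
    proof (rule normal_combination[of H K u v "orient B L"])
      show "orient B L \<in> span {u, v}" using two L by (auto simp: orient_def span_neg)
    qed (use H K two in auto)
    then have "orient B L = a *\<^sub>R nrm H + (if pos B K then b else - b) *\<^sub>R orient B K"
      by (simp add: orient_def)
    then obtain d where d: "orient B L \<bullet> c = d * (orient B K \<bullet> c)" "orient B L \<bullet> z = d * (orient B K \<bullet> z)"
      using cH(1) z(1) by (auto simp: inner_add_left)
    then have "0 < d" using z(2) K L by (metis zero_less_mult_pos2)
    then show ?thesis using d(1) by (simp add: mult_less_0_iff)
  qed
  show ?thesis
  proof (cases "\<A> \<inter> sep_set \<H> B C' = {}")
    case False
    then obtain K where K: "K \<in> \<A>" "K \<in> sep_set \<H> B C'" by blast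
    then have "K \<in> \<A> - {H}" using C(4) by blast
    then have "L \<in> sep_set \<H> B C'" if "L \<in> \<A> - {H}" for L using K sep same that by blast
    then show ?thesis using C(4) by blast
  qed simp
qed

text \<open>By \<open>ascent_side\<close> the two edges lie on the same side of the other
  hyperplanes through \<open>p\<close> or on opposite sides. In the first case they are the same
  edge, in the second \<open>ell_opposite\<close> applies.\<close>

lemma ell_local:
  assumes B: "B \<in> regions \<H>" and e: "ascent B H C' C" "p \<in> closure C'" and f: "ascent B H D' D" "p \<in> closure D'"
    and H: "H \<in> through \<H> p"
    and two: "\<forall>K\<in>through \<H> p. nrm K \<in> span {u, v}"
    and z: "nrm H \<bullet> z = 0" "\<forall>K\<in>through \<H> p - {H}. 0 < orient B K \<bullet> z"
  shows "ell \<H> B (C', C) = ell \<H> B (D', D)"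
proof -
  let ?T = "through \<H> p"
  have C: "C' \<in> regions \<H>" "C \<in> regions \<H>" "sep_set \<H> C' C = {H}" "H \<notin> sep_set \<H> B C'"
    using e by (simp_all add: ascent_def)
  have D: "D' \<in> regions \<H>" "D \<in> regions \<H>" "sep_set \<H> D' D = {H}" "H \<notin> sep_set \<H> B D'"
    using f by (simp_all add: ascent_def)
  have sub: "sep_set \<H> C' D' \<subseteq> ?T"
  proof
    fix K assume "K \<in> sep_set \<H> C' D'"
    then have "K \<in> \<H>" "pos C' K \<noteq> pos D' K" by (simp_all add: sep_set_eq[OF C(1) D(1)])
    then show "K \<in> ?T" using closure_pos[OF C(1) e(2)] closure_pos[OF D(1) f(2)] by (auto simp: through_iff)
  qed
  have CD: "sep_set \<H> C' D' = (sep_set \<H> B C' - sep_set \<H> B D') \<union> (sep_set \<H> B D' - sep_set \<H> B C')"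
    using sep_set_via[OF C(1) B D(1)] sep_set_commute[OF B C(1)] by simp
  have CDT: "sep_set \<H> C' D' = (?T \<inter> sep_set \<H> B C' - ?T \<inter> sep_set \<H> B D') \<union> (?T \<inter> sep_set \<H> B D' - ?T \<inter> sep_set \<H> B C')"
    using CD sub by auto
  note sides = ascent_side[OF B e(1) H through_subset two z] ascent_side[OF B f(1) H through_subset two z]
  have "?T \<inter> sep_set \<H> B C' = ?T \<inter> sep_set \<H> B D' \<or>
     ?T \<inter> sep_set \<H> B C' = {} \<and> ?T \<inter> sep_set \<H> B D' = ?T - {H} \<or>
     ?T \<inter> sep_set \<H> B D' = {} \<and> ?T \<inter> sep_set \<H> B C' = ?T - {H}"
    using sides by metis
  then consider "?T \<inter> sep_set \<H> B C' = ?T \<inter> sep_set \<H> B D'"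
    | "?T \<inter> sep_set \<H> B C' = {}" "sep_set \<H> C' D' = ?T - {H}"
    | "?T \<inter> sep_set \<H> B D' = {}" "sep_set \<H> C' D' = ?T - {H}"
    unfolding CDT by (metis Diff_empty Diff_cancel Un_empty_left Un_empty_right empty_Diff)
  then show ?thesis
  proof cases
    case 1
    then have "sep_set \<H> C' D' = {}" unfolding CDT by simp
    then have "C' = D'" using sep_empty C D by blast
    moreover have "sep_set \<H> C D = {}"
      using sep_set_via[OF C(2,1) D(2)] sep_set_commute[OF C(1,2)] C(3) D(3) \<open>C' = D'\<close> by simp
    then have "C = D" using sep_empty C D by blast
    ultimately show ?thesis by simp
  next
    case 2
    then show ?thesis by (intro ell_opposite[OF B e(1) f(1), of "?T - {H}"]) auto
  next
    case 3
    have "sep_set \<H> D' C' = ?T - {H}" using 3(2) sep_set_commute[OF C(1) D(1)] by simp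
    then show ?thesis using 3(1) by (intro ell_opposite[OF B f(1) e(1), of "?T - {H}", symmetric]) auto
  qed
qed

end

section \<open>Basic hyperplanes and shards\<close>

text \<open>The normals are orthogonal to the defining subspace of codimension two, hence lie in its
  two-dimensional orthogonal complement.\<close>

lemma full_rank2_span:
  fixes \<A> :: "'a::euclidean_space set set"
  assumes "central \<H>" "full_rank2 \<H> \<A>"
  obtains u v where "\<forall>H\<in>\<A>. nrm H \<in> span {u, v}"
proof -
  interpret central \<H> by (rule assms(1))
  obtain U where U: "subspace U" "dim U + 2 = DIM('a)" "\<A> = {H \<in> \<H>. U \<subseteq> H}"
    using assms(2) by (auto simp: full_rank2_def)
  let ?P = "{y \<in> UNIV. \<forall>x\<in>U. orthogonal x y}"
  have "dim ?P = 2"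
    using dim_subspace_orthogonal_to_vectors[OF U(1) subspace_UNIV subset_UNIV] U(2) by simp
  then obtain b where b: "?P \<subseteq> span b" "card b = 2" using basis_exists[of ?P] by metis
  then obtain u v where uv: "b = {u, v}" by (auto simp: card_2_iff)
  have "nrm H \<in> span {u, v}" if "H \<in> \<A>" for H
  proof -
    have H: "H \<in> \<H>" "U \<subseteq> H" using that U(3) by auto
    have "orthogonal x (nrm H)" if "x \<in> U" for x
    proof -
      have "nrm H \<bullet> x = 0" using mem_iff[OF H(1)] H(2) that by blast
      then show ?thesis by (simp add: orthogonal_def inner_commute)
    qed
    then show ?thesis using b(1) uv by blast
  qed
  then show ?thesis using that by blast
qed

context central begin

lemma base_region:
  assumes B: "B \<in> regions \<H>" and A: "\<A> \<subseteq> \<H>"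
  shows "base_region \<A> B \<in> regions \<A>" "base_region \<A> B = {x. \<forall>K\<in>\<A>. 0 < orient B K \<bullet> x}"
    "\<And>K. K \<in> \<A> \<Longrightarrow> orient (base_region \<A> B) K = orient B K"
proof -
  interpret A: central \<A> using sub[OF A] .
  obtain x where x: "x \<in> B" using region_nonempty B by blast
  have "\<forall>H\<in>\<A>. nrm H \<bullet> x \<noteq> 0" using nrm_region[OF B _ x] A by blast
  then obtain R where R: "R \<in> regions \<A>" "x \<in> R" using A.region_of_point by blast
  have or: "orient R K = orient B K" if "K \<in> \<A>" for K
  proof -
    have "pos R K = pos B K" using A.pos_iff[OF R(1) that R(2)] pos_iff[OF B _ x] that A by auto
    then show ?thesis by (simp add: orient_def)
  qed
  have Req: "R = {x. \<forall>K\<in>\<A>. 0 < orient B K \<bullet> x}"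
    by (rule HOL.trans[OF A.region_eq[OF R(1)]]) (simp add: or)
  have "B \<subseteq> R"
    unfolding Req using orient_pos[OF B] A by blast
  moreover have "R' = R" if R': "R' \<in> regions \<A>" "B \<subseteq> R'" for R'
  proof (rule A.region_cong[OF R'(1) R(1)], rule ballI)
    fix K assume K: "K \<in> \<A>"
    have "x \<in> R'" using x R'(2) by blast
    then show "pos R' K = pos R K" using A.pos_iff[OF R'(1) K] A.pos_iff[OF R(1) K R(2)] by simp
  qed
  ultimately have "base_region \<A> B = R"
    unfolding base_region_def using R(1) by (intro the_equality) blast+
  then show "base_region \<A> B \<in> regions \<A>" "base_region \<A> B = {x. \<forall>K\<in>\<A>. 0 < orient B K \<bullet> x}"
    "\<And>K. K \<in> \<A> \<Longrightarrow> orient (base_region \<A> B) K = orient B K"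
    using R(1) Req or by simp_all
qed

lemma hyperplane_zeros: "H \<in> \<H> \<Longrightarrow> H = {x. nrm H \<bullet> x = 0}"
  using mem_iff by blast

text \<open>Near \<open>z\<close> all other inequalities stay strict, so a relatively open piece of
  \<open>H\<close> belongs to the frontier of the base region.\<close>

lemma basicI:
  assumes B: "B \<in> regions \<H>" and A: "\<A> \<subseteq> \<H>" and H: "H \<in> \<A>"
    and z: "nrm H \<bullet> z = 0" "\<forall>K\<in>\<A> - {H}. 0 < orient B K \<bullet> z"
  shows "basic \<A> B H"
proof -
  interpret A: central \<A> using sub[OF A] .
  let ?R = "base_region \<A> B"
  note R = base_region[OF B A]
  define W where "W = (\<Inter>K\<in>\<A> - {H}. {x. orient B K \<bullet> x > 0})"
  have "open W" unfolding W_def using A.fin by (intro open_INT) (auto simp: open_halfspace_gt)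
  have HH: "H \<in> \<H>" using H A by blast
  have sH: "subspace H" by (subst hyperplane_zeros[OF HH]) (rule subspace_hyperplane)
  have "aff_dim {x. nrm H \<bullet> x = 0} = int DIM('a) - 1"
    using aff_dim_hyperplane[OF nrm_nz[OF HH]] by simp
  then have dH: "aff_dim H = int DIM('a) - 1" by (subst hyperplane_zeros[OF HH])
  have "H \<inter> W \<subseteq> H \<inter> frontier ?R"
  proof
    fix x assume x: "x \<in> H \<inter> W"
    then have xH: "nrm H \<bullet> x = 0" using mem_iff[OF HH] by blast
    have "0 \<le> orient ?R K \<bullet> x" if K: "K \<in> \<A>" for K
    proof (cases "K = H")
      case True
      then have "orient ?R K \<bullet> x = 0" using xH by (simp only: orient_zero)
      then show ?thesis by simp
    next
      case False
      then have "0 < orient B K \<bullet> x" using x K unfolding W_def by blast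
      then show ?thesis using R(3)[OF K] by simp
    qed
    then have "x \<in> closure ?R" using A.closure_region[OF R(1)] by blast
    moreover have "x \<notin> ?R"
    proof
      assume "x \<in> ?R"
      then show False using A.nrm_region[OF R(1) H] xH by blast
    qed
    ultimately show "x \<in> H \<inter> frontier ?R"
      using x A.region_open[OF R(1)] by (simp add: frontier_def interior_open)
  qed
  moreover have "z \<in> H \<inter> W" using z mem_iff[OF HH] by (auto simp: W_def)
  then have "aff_dim (H \<inter> W) = aff_dim H"
    using aff_dim_convex_Int_open[OF subspace_imp_convex[OF sH] \<open>open W\<close>] by blast
  ultimately have "aff_dim (H \<inter> frontier ?R) = int DIM('a) - 1"
    using aff_dim_subset[of "H \<inter> W" "H \<inter> frontier ?R"] aff_dim_subset[of "H \<inter> frontier ?R" H] dH by auto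
  then show ?thesis using H by (simp add: basic_def)
qed

text \<open>In rank two, a hyperplane that is not a wall of the base region lies strictly between
  two others. One of them, \<open>K\<close>, may be prescribed; the other is found by applying
  \<open>no\<close> to a point of \<open>H\<close> on the base side of \<open>K\<close>.\<close>

lemma nonbasic_combination:
  assumes B: "B \<in> regions \<H>" and A: "\<A> \<subseteq> \<H>" and two: "\<forall>K\<in>\<A>. nrm K \<in> span {u, v}"
    and H: "H \<in> \<A>" and K: "K \<in> \<A>" "K \<noteq> H"
    and no: "\<And>z. nrm H \<bullet> z = 0 \<Longrightarrow> \<not> (\<forall>K\<in>\<A> - {H}. 0 < orient B K \<bullet> z)"
  obtains L a b where "L \<in> \<A>" "L \<noteq> H" "L \<noteq> K" "0 < a" "0 < b"
    "orient B H = a *\<^sub>R orient B K + b *\<^sub>R orient B L"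
proof -
  let ?h = "orient B H" and ?k = "orient B K"
  have sp: "orient B L \<in> span {u, v}" if "L \<in> \<A>" for L
    using two that by (auto simp: orient_def span_neg)
  have HH: "H \<in> \<H>" and KK: "K \<in> \<H>" using H K A by blast+
  have hh: "?h \<bullet> ?h \<noteq> 0" using orient_nz[OF HH] by simp
  \<comment> \<open>The part of \<open>?k\<close> orthogonal to \<open>?h\<close>: a point of
    \<open>H\<close> on the base side of \<open>K\<close>.\<close>
  define w where "w = ?k - ((?k \<bullet> ?h) / (?h \<bullet> ?h)) *\<^sub>R ?h"
  have hw: "?h \<bullet> w = 0" using hh by (simp add: w_def inner_diff_right inner_commute)
  have kw: "?k \<bullet> w = w \<bullet> w"
  proof -
    have "w \<bullet> w = ?k \<bullet> w - ((?k \<bullet> ?h) / (?h \<bullet> ?h)) * (?h \<bullet> w)"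
      by (subst w_def) (simp only: inner_diff_left inner_scaleR_left)
    then show ?thesis using hw by simp
  qed
  have "w \<noteq> 0"
  proof
    assume "w = 0"
    then have "1 *\<^sub>R ?k = ((?k \<bullet> ?h) / (?h \<bullet> ?h)) *\<^sub>R ?h" by (simp add: w_def)
    then show False using orient_parallel[OF KK HH] K(2) by (metis zero_neq_one)
  qed
  then have ww: "w \<bullet> w > 0" by simp
  have mult: "\<exists>c. x = c *\<^sub>R ?h" if x: "x \<in> span {u, v}" "x \<bullet> w = 0" for x
  proof -
    obtain a b where ab: "x = a *\<^sub>R nrm H + b *\<^sub>R nrm K"
      using normal_combination[OF HH KK K(2)[symmetric]] two H K(1) x(1) by metis
    then have "x = (if pos B H then a else - a) *\<^sub>R ?h + (if pos B K then b else - b) *\<^sub>R ?k"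
      by (simp add: orient_def)
    then obtain a' b' where x': "x = a' *\<^sub>R ?h + b' *\<^sub>R ?k" by blast
    then have "x \<bullet> w = b' * (w \<bullet> w)" using hw kw by (simp add: inner_add_left)
    then have "b' = 0" using x(2) ww by simp
    then show ?thesis using x' by auto
  qed
  have "nrm H \<bullet> w = 0" using hw by (simp add: orient_zero)
  then obtain L where L: "L \<in> \<A>" "L \<noteq> H" "orient B L \<bullet> w \<le> 0" using no[of w] by (auto simp: not_less)
  have LL: "L \<in> \<H>" using L A by blast
  have "orient B L \<bullet> w \<noteq> 0"
  proof
    assume "orient B L \<bullet> w = 0"
    then obtain c where "orient B L = c *\<^sub>R ?h" using mult[OF sp[OF L(1)]] by blast
    then have "1 *\<^sub>R orient B L = c *\<^sub>R ?h" by simp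
    then show False using orient_parallel[OF LL HH] L(2) by (metis zero_neq_one)
  qed
  then have q: "orient B L \<bullet> w < 0" using L(3) by simp
  define q r where "q = - (orient B L \<bullet> w)" and "r = ?k \<bullet> w"
  have qr: "q > 0" "r > 0" using q kw ww by (simp_all add: q_def r_def)
  \<comment> \<open>This positive combination kills \<open>w\<close>, hence is a multiple of
    \<open>?h\<close>; a point of \<open>B\<close> shows that the factor is positive.\<close>
  define x where "x = q *\<^sub>R ?k + r *\<^sub>R orient B L"
  have "x \<bullet> w = 0" by (simp add: x_def inner_add_left inner_diff_left q_def r_def)
  moreover have "x \<in> span {u, v}" unfolding x_def using sp K(1) L(1) by (intro span_add span_scale) auto
  ultimately obtain c where c: "x = c *\<^sub>R ?h" using mult by blast
  obtain b where b: "b \<in> B" using region_nonempty B by blast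
  have "0 < x \<bullet> b" using orient_pos[OF B KK b] orient_pos[OF B LL b] qr
    by (simp add: x_def inner_add_left add_pos_pos)
  then have "c > 0" using orient_pos[OF B HH b] c by (simp add: zero_less_mult_iff)
  have "?h = (1 / c) *\<^sub>R x" using c \<open>c > 0\<close> by simp
  also have "\<dots> = (q / c) *\<^sub>R ?k + (r / c) *\<^sub>R orient B L" by (simp add: x_def scaleR_add_right)
  finally have "?h = (q / c) *\<^sub>R ?k + (r / c) *\<^sub>R orient B L" .
  moreover have "L \<noteq> K"
  proof
    assume "L = K"
    then have "orient B K \<bullet> w < 0" using q by simp
    then show False using kw ww by linarith
  qed
  ultimately show ?thesis using that[of L "q / c" "r / c"] L qr \<open>c > 0\<close> by simp
qed

text \<open>Without a witness, the oriented normal of \<open>H\<close> is a positive combination of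
  two others. Both are nonnegative on the closed base region, so \<open>H\<close> can meet it only
  where \<open>K\<close> vanishes too, in codimension two.\<close>

lemma basicD:
  assumes B: "B \<in> regions \<H>" and A: "\<A> \<subseteq> \<H>" and two: "\<forall>K\<in>\<A>. nrm K \<in> span {u, v}"
    and bas: "basic \<A> B H"
  obtains z where "nrm H \<bullet> z = 0" "\<forall>K\<in>\<A> - {H}. 0 < orient B K \<bullet> z"
proof (rule ccontr)
  assume *: "\<not> thesis"
  have no: "nrm H \<bullet> z = 0 \<Longrightarrow> \<not> (\<forall>K\<in>\<A> - {H}. 0 < orient B K \<bullet> z)" for z
    using that[of z] * by blast
  have H: "H \<in> \<A>" and dim: "aff_dim (H \<inter> frontier (base_region \<A> B)) = int DIM('a) - 1"
    using bas by (simp_all add: basic_def)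
  interpret A: central \<A> using sub[OF A] .
  note R = base_region[OF B A]
  obtain K where K: "K \<in> \<A>" "K \<noteq> H" using no[of 0] by force
  obtain L a b where L: "L \<in> \<A>" "L \<noteq> H" "L \<noteq> K" "0 < a" "0 < b"
    "orient B H = a *\<^sub>R orient B K + b *\<^sub>R orient B L"
    by (rule nonbasic_combination[OF B A two H K no])
  define U where "U = {x. \<forall>w\<in>nrm ` {H, K}. w \<bullet> x = 0}"
  have "H \<inter> frontier (base_region \<A> B) \<subseteq> U"
  proof
    fix x assume x: "x \<in> H \<inter> frontier (base_region \<A> B)"
    then have xH: "nrm H \<bullet> x = 0" using A.mem_iff[OF H] by blast
    have "x \<in> closure (base_region \<A> B)" using x by (simp add: frontier_def)
    then have ge: "0 \<le> orient B M \<bullet> x" if "M \<in> \<A>" for M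
      using A.closure_region[OF R(1)] R(3)[OF that] that by auto
    have "a * (orient B K \<bullet> x) + b * (orient B L \<bullet> x) = orient B H \<bullet> x"
      by (simp add: L(6) inner_add_left)
    also have "\<dots> = 0" using xH by (simp add: orient_zero)
    finally have "a * (orient B K \<bullet> x) = 0"
      using ge[OF K(1)] ge[OF L(1)] L(4,5) by (smt (verit) mult_nonneg_nonneg)
    then have "nrm K \<bullet> x = 0" using L(4) by (simp add: orient_zero)
    then show "x \<in> U" using xH by (simp add: U_def)
  qed
  then have "aff_dim (H \<inter> frontier (base_region \<A> B)) \<le> aff_dim U" by (rule aff_dim_subset)
  also have "\<dots> = int (dim U)"
    unfolding U_def by (rule aff_dim_subspace[OF subspace_common_zeros])
  also have "dim U + 2 = DIM('a)"
  proof -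
    have "dim (nrm ` {H, K}) = 2"
      by (rule dim_normals_two[of "{H, K}" "nrm H" "nrm K"])
        (use H K A in \<open>auto intro: span_base\<close>)
    then show ?thesis using dim_common_zeros[of "nrm ` {H, K}"] by (simp add: U_def)
  qed
  then have "int (dim U) < int DIM('a) - 1" by linarith
  finally show False using dim by simp
qed

text \<open>Any wall of the base region will do, and one is crossed on the way to its
  antipode.\<close>

lemma basic_exists:
  assumes B: "B \<in> regions \<H>" and A: "\<A> \<subseteq> \<H>" "\<A> \<noteq> {}"
  obtains K where "basic \<A> B K"
proof -
  interpret A: central \<A> using sub[OF A(1)] .
  note R = base_region[OF B A(1)]
  have "0 \<in> closure (base_region \<A> B)" unfolding A.closure_region[OF R(1)] by simp
  then obtain E where E: "E \<in> regions \<A>" "sep_set \<A> (base_region \<A> B) E = through \<A> 0"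
    using A.opposite[OF R(1)] by blast
  have "through \<A> 0 = \<A>" by (auto simp: A.through_iff)
  then have "E \<noteq> base_region \<A> B" using E A(2) A.sep_refl by auto
  then obtain D K where D: "D \<in> regions \<A>" "sep_set \<A> (base_region \<A> B) D = {K}"
    using A.wall[OF R(1) E(1)] by metis
  obtain z where z: "through \<A> z = {K}" "z \<in> closure (base_region \<A> B)" "z \<in> closure D"
    by (rule A.facet_point[OF R(1) D])
  have th: "L \<in> through \<A> z \<longleftrightarrow> L = K" for L by (simp add: z(1))
  have "K \<in> \<A>" "nrm K \<bullet> z = 0" using th[of K] by (simp_all add: A.through_iff)
  moreover have "0 < orient B L \<bullet> z" if "L \<in> \<A> - {K}" for L
  proof -
    have "L \<in> \<A>" "nrm L \<bullet> z \<noteq> 0" using th[of L] that by (simp_all add: A.through_iff)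
    moreover from this have "0 \<le> orient B L \<bullet> z"
      using z(2) R(3)[of L] unfolding A.closure_region[OF R(1)] by force
    ultimately show ?thesis unfolding less_le by (metis orient_zero)
  qed
  ultimately have "basic \<A> B K" by (intro basicI[OF B A(1), of K z]) auto
  then show ?thesis using that by blast
qed

lemma through_full_rank2:
  assumes "card (through \<H> p) \<ge> 2" "\<forall>K\<in>through \<H> p. nrm K \<in> span {u, v}"
  shows "full_rank2 \<H> (through \<H> p)"
proof -
  define U where "U = {x. \<forall>w\<in>nrm ` through \<H> p. w \<bullet> x = 0}"
  have "subspace U" unfolding U_def by (rule subspace_common_zeros)
  moreover have "dim U + 2 = DIM('a)"
    using dim_common_zeros[of "nrm ` through \<H> p"] dim_normals_two[OF assms(1) through_subset assms(2)]
    by (simp add: U_def)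
  moreover have "K \<in> through \<H> p \<longleftrightarrow> K \<in> \<H> \<and> U \<subseteq> K" for K
  proof
    assume K: "K \<in> through \<H> p"
    then have "K \<in> \<H>" by (simp add: through_iff)
    moreover have "U \<subseteq> K" using mem_iff[OF \<open>K \<in> \<H>\<close>] K by (auto simp: U_def)
    ultimately show "K \<in> \<H> \<and> U \<subseteq> K" by blast
  next
    assume "K \<in> \<H> \<and> U \<subseteq> K"
    moreover have "p \<in> U" by (auto simp: U_def through_iff)
    ultimately show "K \<in> through \<H> p" by (auto simp: through_def)
  qed
  ultimately show ?thesis using assms(1) unfolding full_rank2_def by blast
qed

text \<open>Two or more hyperplanes through \<open>p\<close> form a full rank two family with some
  basic member; were \<open>H\<close> not basic, that member would cut it. The point
  \<open>z\<close> is the form in which basicness is used.\<close>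

lemma uncut_witness:
  assumes B: "B \<in> regions \<H>" and two: "\<forall>K\<in>through \<H> p. nrm K \<in> span {u, v}" and H: "H \<in> through \<H> p"
    and uncut: "\<And>K. K \<in> through \<H> p \<Longrightarrow> \<not> cuts \<H> B K H"
  obtains z where "nrm H \<bullet> z = 0" "\<forall>K\<in>through \<H> p - {H}. 0 < orient B K \<bullet> z"
proof (cases "card (through \<H> p) \<ge> 2")
  case True
  have full: "full_rank2 \<H> (through \<H> p)" using through_full_rank2[OF True two] .
  obtain K where K: "basic (through \<H> p) B K" using basic_exists[OF B through_subset] H by blast
  then have "K \<in> through \<H> p" by (simp add: basic_def)
  then have "basic (through \<H> p) B H" using uncut full H K unfolding cuts_def by blast
  then show ?thesis using basicD[OF B through_subset two] that by blast
next
  case False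
  have "K = H" if "K \<in> through \<H> p" for K
  proof (rule ccontr)
    assume "K \<noteq> H"
    then have "card {K, H} \<le> card (through \<H> p)" using that H finite_through by (intro card_mono) auto
    then show False using False \<open>K \<noteq> H\<close> by simp
  qed
  \<comment> \<open>Only \<open>H\<close> passes through \<open>p\<close>, so the condition on the
    other hyperplanes is empty.\<close>
  then show ?thesis using that[of 0] by auto
qed

text \<open>Pushing \<open>p\<close> along \<open>z\<close> inside \<open>H\<close> leaves every
  other hyperplane, and the two sides of \<open>H\<close> at the new point form an edge. It keeps
  transitivity in \<open>ell_same_shard\<close> from being vacuous.\<close>

lemma facet_ascent:
  assumes B: "B \<in> regions \<H>" and H: "H \<in> through \<H> p"
    and z: "nrm H \<bullet> z = 0" "\<forall>K\<in>through \<H> p - {H}. 0 < orient B K \<bullet> z"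
  obtains C' C where "ascent B H C' C" "p \<in> closure C'"
proof -
  have HH: "H \<in> \<H>" "nrm H \<bullet> p = 0" using H by (simp_all add: through_iff)
  \<comment> \<open>Oriented by the sign at \<open>p\<close>, and toward \<open>B\<close> where
    \<open>p\<close> decides nothing; \<open>z\<close> then breaks the ties.\<close>
  define s where "s K = (if 0 < nrm K \<bullet> p \<or> nrm K \<bullet> p = 0 \<and> pos B K then nrm K else - nrm K)" for K
  have s: "0 < s K \<bullet> p \<or> s K \<bullet> p = 0 \<and> 0 < s K \<bullet> z" if "K \<in> \<H> - {H}" for K
    using that z(2) by (auto simp: s_def through_iff orient_def split: if_splits)
  obtain e where e: "0 < e" "\<forall>K\<in>\<H> - {H}. 0 < s K \<bullet> p + e * (s K \<bullet> z)"
    by (rule lex_positive[of "\<H> - {H}" "\<lambda>K. s K \<bullet> p" "\<lambda>K. s K \<bullet> z"]) (use fin s in auto)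
  define q where "q = p + e *\<^sub>R z"
  have qH: "nrm H \<bullet> q = 0" using HH z(1) by (simp add: q_def inner_add_right)
  have q: "0 < s K \<bullet> q" if "K \<in> \<H>" "K \<noteq> H" for K using e that by (simp add: q_def inner_add_right)
  then have qK: "nrm K \<bullet> q \<noteq> 0" if "K \<in> \<H>" "K \<noteq> H" for K
    using that by (metis inner_minus_left less_irrefl minus_zero s_def)
  obtain b where b: "b \<in> B" using region_nonempty B by blast
  have bK: "nrm K \<bullet> b \<noteq> 0" if "K \<in> \<H>" for K using nrm_region[OF B that b] .
  obtain C' where C': "C' \<in> regions \<H>"
    "\<And>K. K \<in> \<H> \<Longrightarrow> pos C' K \<longleftrightarrow> 0 < nrm K \<bullet> q \<or> nrm K \<bullet> q = 0 \<and> 0 < nrm K \<bullet> b"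
    using germ[of q b] bK by metis
  have "\<forall>K\<in>\<H>. nrm K \<bullet> q = 0 \<longrightarrow> nrm K \<bullet> (- b) \<noteq> 0" using bK by simp
  then obtain C where C: "C \<in> regions \<H>"
    "\<And>K. K \<in> \<H> \<Longrightarrow> pos C K \<longleftrightarrow> 0 < nrm K \<bullet> q \<or> nrm K \<bullet> q = 0 \<and> 0 < nrm K \<bullet> (- b)"
    using germ[of q "- b"] by metis
  have "pos C' K \<noteq> pos C K \<longleftrightarrow> K = H" if "K \<in> \<H>" for K
    unfolding C(2)[OF that] C'(2)[OF that]
    using qH qK[OF that] bK[OF that] by (cases "K = H") (simp_all, linarith)
  then have "sep_set \<H> C' C = {H}" unfolding sep_set_eq[OF C'(1) C(1)] using HH(1) by blast
  moreover have "H \<notin> sep_set \<H> B C'"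
    using C'(2)[OF HH(1)] qH pos_iff[OF B HH(1) b] by (simp add: sep_set_eq[OF B C'(1)])
  ultimately have "ascent B H C' C" using C C' by (simp add: ascent_def)
  moreover have "p \<in> closure C'"
    unfolding closure_iff_pos[OF C'(1)]
  proof (intro ballI impI)
    fix K assume K: "K \<in> \<H>" "nrm K \<bullet> p \<noteq> 0"
    then have "K \<noteq> H" using HH by blast
    have "0 < nrm K \<bullet> q \<longleftrightarrow> 0 < nrm K \<bullet> p"
      using q[OF K(1) \<open>K \<noteq> H\<close>] K(2) by (auto simp: s_def split: if_splits)
    then show "pos C' K \<longleftrightarrow> 0 < nrm K \<bullet> p" using C'(2)[OF K(1)] qK[OF K(1) \<open>K \<noteq> H\<close>] by simp
  qed
  ultimately show ?thesis using that by blast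
qed

section \<open>Shards as sign cells inside a hyperplane\<close>

definition cutters :: "'a set \<Rightarrow> 'a set \<Rightarrow> 'a set set" where
  "cutters B H = {K \<in> \<H>. cuts \<H> B K H}"

definition shard_cell :: "'a set \<Rightarrow> 'a set \<Rightarrow> 'a \<Rightarrow> 'a set" where
  "shard_cell B H c = {y \<in> H. \<forall>K\<in>cutters B H. 0 < (nrm K \<bullet> c) * (nrm K \<bullet> y)}"

lemma shards_of_eq:
  assumes H: "H \<in> \<H>"
  shows "shards_of \<H> B H = (\<lambda>c. closure (shard_cell B H c)) ` {c \<in> H. \<forall>K\<in>cutters B H. nrm K \<bullet> c \<noteq> 0}"
proof -
  have "convex H" by (subst hyperplane_zeros[OF H]) (rule convex_hyperplane)
  moreover have "cutters B H \<subseteq> \<H>" by (auto simp: cutters_def)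
  ultimately show ?thesis
    unfolding shards_of_def cutters_def[symmetric] shard_cell_def
    by (simp only: components_cells image_image)
qed

text \<open>The far end of the segment is moved inside its facet, so that the segment
  only meets faces of codimension at most two.\<close>

lemma generic_facet_point:
  assumes D: "D \<in> regions \<H>" and H: "H \<in> \<H>" and d: "through \<H> d = {H}" "d \<in> closure D"
    and V: "finite V" "\<And>v \<mu>. v \<in> V \<Longrightarrow> v \<noteq> \<mu> *\<^sub>R nrm H"
  obtains q where "through \<H> q = {H}" "q \<in> closure D" "\<forall>v\<in>V. v \<bullet> q \<noteq> 0"
proof -
  let ?h = "nrm H"
  have hh: "?h \<bullet> ?h \<noteq> 0" using nrm_nz[OF H] by simp
  \<comment> \<open>Orthogonal projection onto \<open>H\<close>. It is self-adjoint, so avoiding the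
    zeros of \<open>v\<close> within \<open>H\<close> means avoiding the zeros of \<open>P v\<close>
    in the whole space. Multiples of \<open>nrm H\<close> are excluded because they vanish on
    \<open>H\<close>.\<close>
  define P where "P x = x - ((?h \<bullet> x) / (?h \<bullet> ?h)) *\<^sub>R ?h" for x
  have hP: "?h \<bullet> P x = 0" for x using hh by (simp add: P_def inner_diff_right)
  have adj: "v \<bullet> P x = P v \<bullet> x" for v x by (simp add: P_def inner_diff_right inner_diff_left inner_commute)
  define S where "S = (\<Inter>K\<in>\<H> - {H}. {x. 0 < orient D K \<bullet> P x})"
  have th: "K \<in> through \<H> d \<longleftrightarrow> K = H" for K by (simp add: d(1))
  have dH: "?h \<bullet> d = 0" using th[of H] by (simp add: through_iff)
  have "open S" unfolding S_def P_def using fin hh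
    by (intro open_INT) (auto intro!: open_Collect_less continuous_intros)
  moreover have "d \<in> S"
  proof -
    have "0 < orient D K \<bullet> d" if "K \<in> \<H>" "K \<noteq> H" for K
    proof -
      have "nrm K \<bullet> d \<noteq> 0" using th[of K] that by (simp add: through_iff)
      moreover have "0 \<le> orient D K \<bullet> d" using d(2) that unfolding closure_region[OF D] by blast
      ultimately show ?thesis by (metis less_eq_real_def orient_zero)
    qed
    moreover have "P d = d" using dH by (simp add: P_def)
    ultimately show ?thesis by (simp add: S_def)
  qed
  moreover have "finite (P ` V)" using V(1) by simp
  moreover have "0 \<notin> P ` V" using V(2) by (auto simp: P_def)
  ultimately obtain x where x: "x \<in> S" "\<forall>v\<in>P ` V. v \<bullet> x \<noteq> 0" using generic_point by (metis empty_iff)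
  have K: "0 < orient D K \<bullet> P x" if "K \<in> \<H>" "K \<noteq> H" for K using x(1) that by (auto simp: S_def)
  have "K \<in> through \<H> (P x) \<longleftrightarrow> K = H" for K
    using K[of K] hP[of x] H unfolding through_iff by (metis less_irrefl orient_zero)
  then have "through \<H> (P x) = {H}" by blast
  moreover have "0 \<le> orient D K \<bullet> P x" if "K \<in> \<H>" for K
  proof (cases "K = H")
    case True
    then have "orient D K \<bullet> P x = 0" using hP by (simp add: orient_zero)
    then show ?thesis by simp
  qed (use K that in \<open>simp add: less_imp_le\<close>)
  then have "P x \<in> closure D" unfolding closure_region[OF D] by blast
  ultimately show ?thesis using that[of "P x"] x(2) by (simp add: adj)
qed

text \<open>By \<open>same\<close>, \<open>c\<close> and \<open>d\<close> lie in one component of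
  \<open>H\<close> minus its cutters. That component is convex, so no cutter meets the segment, and
  \<open>uncut_witness\<close> supplies what \<open>ell_local\<close> needs at each of its
  points.\<close>

lemma ell_same_shard:
  assumes B: "B \<in> regions \<H>" and e: "ascent B H C' C" and f: "ascent B H D' D"
    and c: "through \<H> c = {H}" "c \<in> closure C'" and d: "through \<H> d = {H}" "d \<in> closure D'"
    and same: "\<And>K. K \<in> \<H> \<Longrightarrow> cuts \<H> B K H \<Longrightarrow> 0 < (nrm K \<bullet> c) * (nrm K \<bullet> d)"
  shows "ell \<H> B (C', C) = ell \<H> B (D', D)"
proof -
  have D': "D' \<in> regions \<H>" using f by (simp add: ascent_def)
  have thc: "K \<in> through \<H> c \<longleftrightarrow> K = H" for K by (simp add: c(1))
  have thd: "K \<in> through \<H> d \<longleftrightarrow> K = H" for K by (simp add: d(1))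
  have H: "H \<in> \<H>" "nrm H \<bullet> c = 0" using thc[of H] by (simp_all add: through_iff)
  have cK: "nrm K \<bullet> c \<noteq> 0" if "K \<in> \<H>" "K \<noteq> H" for K using thc[of K] that by (simp add: through_iff)
  \<comment> \<open>If \<open>K\<close> and \<open>L\<close> both contain a point of the segment,
    then \<open>W K L\<close> vanishes at its far end \<open>q\<close>. A generic \<open>q\<close>
    in the facet prevents this unless \<open>W K L\<close> is a multiple of \<open>nrm H\<close>; in
    that case, for \<open>K\<close> other than \<open>H\<close>, \<open>nrm L\<close> lies in the
    span of \<open>nrm H\<close> and \<open>nrm K\<close>.\<close>
  define W where "W K L = (nrm K \<bullet> c) *\<^sub>R nrm L - (nrm L \<bullet> c) *\<^sub>R nrm K" for K L
  define V where "V = {w \<in> (\<lambda>(K, L). W K L) ` (\<H> \<times> \<H>). \<forall>\<mu>. w \<noteq> \<mu> *\<^sub>R nrm H}"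
  have "finite V" unfolding V_def using fin by simp
  moreover have "\<And>v \<mu>. v \<in> V \<Longrightarrow> v \<noteq> \<mu> *\<^sub>R nrm H" by (simp add: V_def)
  ultimately obtain q where q: "through \<H> q = {H}" "q \<in> closure D'" "\<forall>v\<in>V. v \<bullet> q \<noteq> 0"
    using generic_facet_point[OF D' H(1) d] by blast
  have thq: "K \<in> through \<H> q \<longleftrightarrow> K = H" for K by (simp add: q(1))
  have qH: "nrm H \<bullet> q = 0" using thq[of H] by (simp add: through_iff)
  have qd: "0 < nrm K \<bullet> q \<longleftrightarrow> 0 < nrm K \<bullet> d" "nrm K \<bullet> q \<noteq> 0" if "K \<in> \<H>" "K \<noteq> H" for K
  proof -
    have *: "nrm K \<bullet> q \<noteq> 0" "nrm K \<bullet> d \<noteq> 0" using thq[of K] thd[of K] that by (simp_all add: through_iff)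
    then show "nrm K \<bullet> q \<noteq> 0" "0 < nrm K \<bullet> q \<longleftrightarrow> 0 < nrm K \<bullet> d"
      using closure_pos[OF D' q(2) that(1)] closure_pos[OF D' d(2) that(1)] by simp_all
  qed
  define p where "p t = (1 - t) *\<^sub>R c + t *\<^sub>R q" for t :: real
  have pH: "H \<in> through \<H> (p t)" for t using H qH by (simp add: through_iff p_def inner_add_right)
  have two: "\<exists>u v. \<forall>K\<in>through \<H> (p t). nrm K \<in> span {u, v}" for t
  proof (cases "through \<H> (p t) = {H}")
    case True
    then have "\<forall>K\<in>through \<H> (p t). nrm K \<in> span {nrm H, nrm H}" by (simp add: span_base)
    then show ?thesis by blast
  next
    case False
    then obtain K where "K \<in> through \<H> (p t)" "K \<noteq> H" using pH[of t] by blast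
    then have K: "K \<in> \<H>" "nrm K \<bullet> p t = 0" "K \<noteq> H" by (simp_all add: through_iff)
    have "nrm L \<in> span {nrm H, nrm K}" if "L \<in> through \<H> (p t)" for L
    proof -
      have L: "L \<in> \<H>" "nrm L \<bullet> p t = 0" using that by (simp_all add: through_iff)
      have "(nrm K \<bullet> c) * (nrm L \<bullet> q) - (nrm L \<bullet> c) * (nrm K \<bullet> q) = 0"
        by (rule determinant_zero[of t]) (use K L in \<open>simp_all add: p_def inner_add_right\<close>)
      then have "W K L \<bullet> q = 0" by (simp add: W_def inner_diff_left)
      moreover have "W K L \<in> (\<lambda>(K, L). W K L) ` (\<H> \<times> \<H>)"
        using K L by (intro image_eqI[of _ _ "(K, L)"]) auto
      ultimately obtain \<mu> where "W K L = \<mu> *\<^sub>R nrm H" using q(3) unfolding V_def by blast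
      then have "(nrm K \<bullet> c) *\<^sub>R nrm L = 1 *\<^sub>R (\<mu> *\<^sub>R nrm H + (nrm L \<bullet> c) *\<^sub>R nrm K)"
        by (simp add: W_def algebra_simps)
      then have "nrm L = (1 / (nrm K \<bullet> c)) *\<^sub>R (\<mu> *\<^sub>R nrm H + (nrm L \<bullet> c) *\<^sub>R nrm K)"
        using cK[OF K(1,3)] by (rule scaleR_eq_divide)
      also have "\<dots> \<in> span {nrm H, nrm K}" by (intro span_scale span_add span_base) auto
      finally show ?thesis .
    qed
    then show ?thesis by blast
  qed
  have uncut: "\<not> cuts \<H> B K H" if t: "t \<in> {0..1}" and K: "K \<in> through \<H> (p t)" for K t
  proof
    assume cut: "cuts \<H> B K H"
    have KH: "K \<in> \<H>" "nrm K \<bullet> p t = 0" using K by (simp_all add: through_iff)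
    have "0 < (nrm K \<bullet> c) * (nrm K \<bullet> d)" using same[OF KH(1) cut] .
    then have sgn: "0 < (nrm K \<bullet> c) * (nrm K \<bullet> q)"
      using qd[OF KH(1) cuts_neq[OF cut]] by (auto simp: zero_less_mult_iff)
    have "(1 - t) * ((nrm K \<bullet> c) * (nrm K \<bullet> c)) + t * ((nrm K \<bullet> c) * (nrm K \<bullet> q)) = (nrm K \<bullet> c) * (nrm K \<bullet> p t)"
      by (simp add: p_def inner_add_right algebra_simps)
    then have "(1 - t) * ((nrm K \<bullet> c) * (nrm K \<bullet> c)) + t * ((nrm K \<bullet> c) * (nrm K \<bullet> q)) = 0"
      using KH(2) by simp
    moreover have "0 < (nrm K \<bullet> c) * (nrm K \<bullet> c)" using sgn by (auto simp: zero_less_mult_iff)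
    moreover have "0 < 1 - t \<or> 0 < t" "0 \<le> 1 - t" "0 \<le> t" using t by auto
    ultimately show False using sgn by (smt (verit) mult_nonneg_nonneg mult_pos_pos)
  qed
  have wit: "\<exists>z. nrm H \<bullet> z = 0 \<and> (\<forall>K\<in>through \<H> (p t) - {H}. 0 < orient B K \<bullet> z)" if "t \<in> {0..1}" for t
    using two[of t] uncut_witness[OF B _ pH[of t]] uncut[OF that] by metis
  define R where "R a b \<longleftrightarrow> (\<forall>C' C D' D. ascent B H C' C \<and> ascent B H D' D \<and> p a \<in> closure C' \<and> p b \<in> closure D'
    \<longrightarrow> ell \<H> B (C', C) = ell \<H> B (D', D))" for a b
  have hub: "R a a" if "a \<in> {0..1}" for a
    using ell_local[OF B _ _ _ _ pH[of a]] two[of a] wit[OF that] unfolding R_def by metis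
  have "R 0 1"
  proof (rule connected_equivalence_relation[of "{0..1}"])
    show "R b a" if "R a b" for a b using that unfolding R_def by metis
    show "R a c" if ab: "R a b" and bc: "R b c" and b: "b \<in> {0..1}" for a b c
    proof -
      obtain E' E where "ascent B H E' E" "p b \<in> closure E'"
        using wit[OF b] facet_ascent[OF B pH[of b]] by metis
      then show ?thesis using ab bc unfolding R_def by metis
    qed
    show "\<exists>T. openin (top_of_set {0..1}) T \<and> a \<in> T \<and> (\<forall>t\<in>T. R a t)" if a: "a \<in> {0..1}" for a
    proof -
      define T where "T = {0..1} \<inter> (\<Inter>K\<in>\<H> - through \<H> (p a). {t. 0 < (nrm K \<bullet> p a) * (nrm K \<bullet> p t)})"
      have "open (\<Inter>K\<in>\<H> - through \<H> (p a). {t. 0 < (nrm K \<bullet> p a) * (nrm K \<bullet> p t)})"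
        unfolding p_def using fin
        by (intro open_INT) (auto intro!: open_Collect_less continuous_intros)
      then have "openin (top_of_set {0..1}) T" unfolding T_def by (rule openin_open_Int)
      moreover have "a \<in> T" using a by (auto simp: T_def through_iff zero_less_mult_iff neq_iff)
      moreover have "R a t" if t: "t \<in> T" for t
      proof -
        \<comment> \<open>Hyperplanes not through \<open>p a\<close> keep their sign nearby, so a
          region touching the segment at \<open>t\<close> also touches it at \<open>a\<close>; edges
          at \<open>t\<close> thus fall under the local comparison at \<open>a\<close>.\<close>
        have "p a \<in> closure E" if E: "E \<in> regions \<H>" "p t \<in> closure E" for E
          unfolding closure_iff_pos[OF E(1)]
        proof (intro ballI impI)
          fix K assume K: "K \<in> \<H>" "nrm K \<bullet> p a \<noteq> 0"
          then have *: "0 < (nrm K \<bullet> p a) * (nrm K \<bullet> p t)" using t by (auto simp: T_def through_iff)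
          then have "nrm K \<bullet> p t \<noteq> 0" by auto
          then show "pos E K \<longleftrightarrow> 0 < nrm K \<bullet> p a"
            using closure_pos[OF E K(1)] * by (auto simp: zero_less_mult_iff)
        qed
        then show ?thesis using hub[OF a] unfolding R_def ascent_def by metis
      qed
      ultimately show ?thesis by blast
    qed
  qed auto
  moreover have "p 0 = c" "p 1 = q" by (simp_all add: p_def)
  ultimately show ?thesis using e f c(2) q(2) unfolding R_def by metis
qed

text \<open>\<open>c\<close> avoids every hyperplane but \<open>H\<close>, so the facet is a
  neighbourhood of \<open>c\<close> within \<open>H\<close>. Hence the facet spans
  \<open>H\<close>.\<close>

lemma ascent_facet:
  assumes e: "ascent B H C' C" and c: "through \<H> c = {H}" "c \<in> closure C'" and y: "nrm H \<bullet> y = 0"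
  obtains t where "0 < t" "c + t *\<^sub>R y \<in> closure C' \<inter> closure C"
proof -
  have C: "C' \<in> regions \<H>" "C \<in> regions \<H>" "sep_set \<H> C' C = {H}" using e by (simp_all add: ascent_def)
  have th: "K \<in> through \<H> c \<longleftrightarrow> K = H" for K by (simp add: c(1))
  have H: "H \<in> \<H>" "nrm H \<bullet> c = 0" using th[of H] by (simp_all add: through_iff)
  have pos: "0 < orient C' K \<bullet> c" if "K \<in> \<H> - {H}" for K
  proof -
    have "nrm K \<bullet> c \<noteq> 0" using th[of K] that by (simp add: through_iff)
    moreover have "0 \<le> orient C' K \<bullet> c" using c(2) that unfolding closure_region[OF C(1)] by blast
    ultimately show ?thesis by (metis less_eq_real_def orient_zero)
  qed
  obtain t where t: "0 < t" "\<forall>K\<in>\<H> - {H}. 0 < orient C' K \<bullet> c + t * (orient C' K \<bullet> y)"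
    by (rule lex_positive[of "\<H> - {H}" "\<lambda>K. orient C' K \<bullet> c" "\<lambda>K. orient C' K \<bullet> y"])
      (use fin pos in auto)
  have zero: "nrm H \<bullet> (c + t *\<^sub>R y) = 0" using H y by (simp add: inner_add_right)
  have same: "orient C K = orient C' K" if "K \<in> \<H>" "K \<noteq> H" for K
  proof -
    have "K \<notin> sep_set \<H> C' C" using C(3) that by simp
    then show ?thesis using that by (simp add: sep_set_eq[OF C(1,2)] orient_def)
  qed
  have "0 \<le> orient C' K \<bullet> (c + t *\<^sub>R y) \<and> 0 \<le> orient C K \<bullet> (c + t *\<^sub>R y)" if K: "K \<in> \<H>" for K
  proof (cases "K = H")
    case True
    then have "orient C' K \<bullet> (c + t *\<^sub>R y) = 0" "orient C K \<bullet> (c + t *\<^sub>R y) = 0"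
      using zero by (simp_all only: orient_zero)
    then show ?thesis by simp
  next
    case False
    then have "0 < orient C' K \<bullet> c + t * (orient C' K \<bullet> y)" using t(2) K by blast
    then show ?thesis using same[OF K False] by (simp add: inner_add_right)
  qed
  then have "c + t *\<^sub>R y \<in> closure C' \<inter> closure C"
    unfolding closure_region[OF C(1)] closure_region[OF C(2)] by blast
  then show ?thesis using that t(1) by blast
qed

text \<open>Adding a small positive multiple of \<open>c\<close> to a point of the facet makes every
  inequality of the cell strict, so the point is a limit of points of the cell.\<close>

lemma facet_subset_shard:
  assumes e: "ascent B H C' C" and c: "through \<H> c = {H}" "c \<in> closure C'"
  shows "closure C' \<inter> closure C \<subseteq> closure (shard_cell B H c)"
proof
  fix x assume x: "x \<in> closure C' \<inter> closure C"
  have C: "C' \<in> regions \<H>" "C \<in> regions \<H>" "sep_set \<H> C' C = {H}" using e by (simp_all add: ascent_def)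
  have th: "K \<in> through \<H> c \<longleftrightarrow> K = H" for K by (simp add: c(1))
  have H: "H \<in> \<H>" "nrm H \<bullet> c = 0" using th[of H] by (simp_all add: through_iff)
  have ge: "0 \<le> orient C' K \<bullet> x" "0 \<le> orient C K \<bullet> x" "0 \<le> orient C' K \<bullet> c" if "K \<in> \<H>" for K
    using x c(2) that unfolding closure_region[OF C(1)] closure_region[OF C(2)] by blast+
  have "H \<in> sep_set \<H> C' C" by (simp add: C(3))
  then have "orient C H = - orient C' H" by (auto simp: sep_set_eq[OF C(1,2)] orient_def)
  then have "orient C' H \<bullet> x = 0" using ge[OF H(1)] by simp
  then have xH: "nrm H \<bullet> x = 0" by (simp add: orient_zero)
  have "x + t *\<^sub>R c \<in> shard_cell B H c" if t: "0 < t" for t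
  proof -
    have "0 < (nrm K \<bullet> c) * (nrm K \<bullet> (x + t *\<^sub>R c))" if K: "K \<in> cutters B H" for K
    proof -
      have KH: "K \<in> \<H>" "K \<noteq> H" using K cuts_neq by (auto simp: cutters_def)
      have "nrm K \<bullet> c \<noteq> 0" using th[of K] KH by (simp add: through_iff)
      then have "0 < t * ((nrm K \<bullet> c) * (nrm K \<bullet> c))" using t by (auto simp: zero_less_mult_iff)
      moreover have "0 \<le> (orient C' K \<bullet> c) * (orient C' K \<bullet> x)" using ge[OF KH(1)] by simp
      then have "0 \<le> (nrm K \<bullet> c) * (nrm K \<bullet> x)" by (simp add: orient_def split: if_splits)
      ultimately show ?thesis by (simp add: inner_add_right algebra_simps)
    qed
    moreover have "x + t *\<^sub>R c \<in> H" using mem_iff[OF H(1)] xH H(2) by (simp add: inner_add_right)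
    ultimately show ?thesis by (simp add: shard_cell_def)
  qed
  then have "\<forall>\<^sub>F t in at_right 0. x + t *\<^sub>R c \<in> closure (shard_cell B H c)"
    using closure_subset by (intro eventually_mono[OF eventually_at_right_less[of 0]]) blast
  moreover have "((\<lambda>t. x + t *\<^sub>R c) \<longlongrightarrow> x + 0 *\<^sub>R c) (at_right (0::real))"
    by (intro tendsto_intros)
  ultimately show "x \<in> closure (shard_cell B H c)"
    using Lim_in_closed_set[OF closed_closure _ trivial_limit_at_right_real] by fastforce
qed

text \<open>The facet spans \<open>H\<close>, which identifies the hyperplane of the shard;
  \<open>c\<close> satisfies the closed inequalities of the cell and lies on no cutter, which
  identifies the cell. This gives the uniqueness behind \<open>edge_shard\<close> and recovers the
  sides when two shards agree.\<close>

lemma facet_in_shard: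
  assumes e: "ascent B H C' C" and c: "through \<H> c = {H}" "c \<in> closure C'"
    and H': "H' \<in> \<H>" "\<forall>K\<in>cutters B H'. nrm K \<bullet> q \<noteq> 0"
    and sub: "closure C' \<inter> closure C \<subseteq> closure (shard_cell B H' q)"
  shows "H' = H" "\<forall>K\<in>cutters B H. 0 < (nrm K \<bullet> q) * (nrm K \<bullet> c)"
proof -
  have th: "K \<in> through \<H> c \<longleftrightarrow> K = H" for K by (simp add: c(1))
  have H: "H \<in> \<H>" "nrm H \<bullet> c = 0" using th[of H] by (simp_all add: through_iff)
  have in_closure: "closure (shard_cell B H' q) \<subseteq> {x. nrm H' \<bullet> x = 0}"
    by (intro closure_minimal closed_hyperplane) (auto simp: shard_cell_def mem_iff[OF H'(1)])
  obtain t where "0 < t" "c + t *\<^sub>R 0 \<in> closure C' \<inter> closure C"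
    by (rule ascent_facet[OF e c, of 0]) auto
  then have c': "c \<in> closure (shard_cell B H' q)" using sub by auto
  have sub0: "nrm H' \<bullet> y = 0" if y: "nrm H \<bullet> y = 0" for y
  proof -
    obtain t where t: "0 < t" "c + t *\<^sub>R y \<in> closure C' \<inter> closure C"
      by (rule ascent_facet[OF e c y])
    then have "nrm H' \<bullet> (c + t *\<^sub>R y) = 0" "nrm H' \<bullet> c = 0" using c' sub in_closure by blast+
    then show ?thesis using t(1) by (simp add: inner_add_right)
  qed
  have hh: "nrm H \<bullet> nrm H \<noteq> 0" using nrm_nz[OF H(1)] by simp
  define w where "w = nrm H' - ((nrm H \<bullet> nrm H') / (nrm H \<bullet> nrm H)) *\<^sub>R nrm H"
  have hw: "nrm H \<bullet> w = 0" using hh by (simp add: w_def inner_diff_right)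
  then have "nrm H' \<bullet> w = 0" by (rule sub0)
  then have "w \<bullet> w = 0" using hw by (subst w_def) (simp only: inner_diff_left inner_scaleR_left)
  then have "1 *\<^sub>R nrm H' = ((nrm H \<bullet> nrm H') / (nrm H \<bullet> nrm H)) *\<^sub>R nrm H" by (simp add: w_def)
  then show "H' = H" using nrm_parallel[OF H'(1) H(1)] by (metis zero_neq_one)
  show "\<forall>K\<in>cutters B H. 0 < (nrm K \<bullet> q) * (nrm K \<bullet> c)"
  proof
    fix K assume K: "K \<in> cutters B H"
    have KH: "K \<in> \<H>" "K \<noteq> H" using K cuts_neq by (auto simp: cutters_def)
    have "closed {x. 0 \<le> ((nrm K \<bullet> q) *\<^sub>R nrm K) \<bullet> x}" by (rule closed_halfspace_ge)
    then have "closure (shard_cell B H' q) \<subseteq> {x. 0 \<le> ((nrm K \<bullet> q) *\<^sub>R nrm K) \<bullet> x}"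
      using K \<open>H' = H\<close> by (intro closure_minimal) (auto simp: shard_cell_def less_imp_le)
    then have "0 \<le> (nrm K \<bullet> q) * (nrm K \<bullet> c)" using c' by auto
    moreover have "nrm K \<bullet> c \<noteq> 0" using th[of K] KH by (simp add: through_iff)
    moreover have "nrm K \<bullet> q \<noteq> 0" using H'(2) K \<open>H' = H\<close> by blast
    ultimately show "0 < (nrm K \<bullet> q) * (nrm K \<bullet> c)" by (simp add: less_le)
  qed
qed

lemma cutters_off_facet:
  assumes "through \<H> c = {H}" "K \<in> cutters B H"
  shows "nrm K \<bullet> c \<noteq> 0"
proof -
  have "K \<in> \<H>" "K \<noteq> H" using assms(2) cuts_neq by (auto simp: cutters_def)
  moreover have "K \<in> through \<H> c \<longleftrightarrow> K = H" by (simp add: assms(1))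
  ultimately show ?thesis by (simp add: through_iff)
qed

lemma edge_shard_eq:
  assumes e: "ascent B H C' C" and c: "through \<H> c = {H}" "c \<in> closure C'"
  shows "edge_shard \<H> B (C', C) = closure (shard_cell B H c)"
proof -
  have "H \<in> through \<H> c" by (simp add: c(1))
  then have H: "H \<in> \<H>" "c \<in> H" by (simp_all add: through_def)
  have off: "\<forall>K\<in>cutters B H. nrm K \<bullet> c \<noteq> 0" using cutters_off_facet[OF c(1)] by blast
  show ?thesis
    unfolding edge_shard_def prod.case
  proof (rule the_equality)
    have "closure (shard_cell B H c) \<in> shards_of \<H> B H"
      unfolding shards_of_eq[OF H(1)] using H(2) off by blast
    then show "closure (shard_cell B H c) \<in> (\<Union>H\<in>\<H>. shards_of \<H> B H) \<and>
        closure C' \<inter> closure C \<subseteq> closure (shard_cell B H c)"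
      using H(1) facet_subset_shard[OF e c] by blast
  next
    fix S assume S: "S \<in> (\<Union>H\<in>\<H>. shards_of \<H> B H) \<and> closure C' \<inter> closure C \<subseteq> S"
    then obtain H' where H': "H' \<in> \<H>" "S \<in> shards_of \<H> B H'" by blast
    then obtain q where q: "q \<in> H'" "\<forall>K\<in>cutters B H'. nrm K \<bullet> q \<noteq> 0" "S = closure (shard_cell B H' q)"
      unfolding shards_of_eq[OF H'(1)] by blast
    have sub: "closure C' \<inter> closure C \<subseteq> closure (shard_cell B H' q)" using S q(3) by simp
    note F = facet_in_shard[OF e c H'(1) q(2) sub]
    have "(0 < (nrm K \<bullet> q) * (nrm K \<bullet> y)) = (0 < (nrm K \<bullet> c) * (nrm K \<bullet> y))" if "K \<in> cutters B H" for K y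
      using F(2) that by (auto simp: zero_less_mult_iff)
    then have "shard_cell B H' q = shard_cell B H c" unfolding shard_cell_def F(1) by auto
    then show "S = closure (shard_cell B H c)" using q(3) by simp
  qed
qed

end

section \<open>Monodromy\<close>

fun monodromy :: "('a set \<times> 'a set \<Rightarrow> 'b \<Rightarrow> 'b) \<Rightarrow> 'a step list \<Rightarrow> 'b \<Rightarrow> 'b" where
  "monodromy L [] = id"
| "monodromy L (Along e # p) = monodromy L p \<circ> L e"
| "monodromy L (Against e # p) = monodromy L p \<circ> inv_into UNIV (L e)"

lemma monodromy_append: "monodromy L (p @ q) = monodromy L q \<circ> monodromy L p"
proof (induction p)
  case (Cons s p)
  then show ?case by (cases s) (simp_all add: comp_assoc)
qed simp

context central begin

text \<open>Bijectivity makes \<open>Against\<close> steps inverse to \<open>Along\<close> steps.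
  Invariance is demanded for all minimal galleries, which includes the two sides of each 2-cell and
  is what a potential delivers directly.\<close>

definition flat :: "('a set \<times> 'a set \<Rightarrow> 'b \<Rightarrow> 'b) \<Rightarrow> bool" where
  "flat L \<longleftrightarrow> (\<forall>e. bij (L e)) \<and>
    (\<forall>D E g h. minimal_gallery \<H> D g E \<longrightarrow> minimal_gallery \<H> D h E \<longrightarrow> monodromy L g = monodromy L h)"

lemma monodromy_homotopic:
  assumes L: "flat L" and hom: "sal_homotopic \<H> D E p q"
  shows "monodromy L p = monodromy L q"
  using hom
proof (induction rule: sal_homotopic.induct)
  case (backtrack p s q)
  have "bij (L (step_edge s))" using L unfolding flat_def by blast
  then have "monodromy L [s, step_rev s] = id"
    by (cases s) (simp_all add: bij_is_inj bij_is_surj fun_eq_iff surj_f_inv_f)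
  then show ?case by (simp only: monodromy_append id_comp comp_id)
next
  case (cell p g q g')
  then have "monodromy L g = monodromy L g'" using L unfolding flat_def sal_cell_def by blast
  then show ?case by (simp only: monodromy_append)
qed simp_all

lemma monodromy_potential:
  assumes "minimal_gallery \<H> C g E" "\<psi> E = id"
    and "\<And>R R' H. \<lbrakk>R \<in> regions \<H>; R' \<in> regions \<H>; sep_set \<H> R R' = {H}; H \<in> sep_set \<H> R E\<rbrakk>
      \<Longrightarrow> \<psi> R = \<psi> R' \<circ> L (R, R')"
  shows "monodromy L g = \<psi> C"
  using assms(1)
proof (induction g arbitrary: C)
  case Nil
  then show ?case using assms(2) by (simp add: minimal_gallery_Nil)
next
  case (Cons s g)
  then obtain C'' H where C: "s = Along (C, C'')" "C \<in> regions \<H>" "C'' \<in> regions \<H>" "sep_set \<H> C C'' = {H}"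
      "H \<in> sep_set \<H> C E" "minimal_gallery \<H> C'' g E"
    unfolding minimal_gallery_Cons by blast
  then show ?case using Cons.IH[OF C(6)] assms(3)[OF C(2-5)] by simp
qed

text \<open>\<open>\<psi> E R\<close> stands for transport from \<open>R\<close> to
  \<open>E\<close>. If every step toward \<open>E\<close> respects it, induction along a minimal
  gallery shows that transport depends on the ends only, so no 2-cell has to be inspected.\<close>

lemma flatI:
  assumes "\<And>e. bij (L e)"
    and "\<And>E. E \<in> regions \<H> \<Longrightarrow> \<psi> E E = id"
    and "\<And>E R R' H. \<lbrakk>E \<in> regions \<H>; R \<in> regions \<H>; R' \<in> regions \<H>; sep_set \<H> R R' = {H}; H \<in> sep_set \<H> R E\<rbrakk>
      \<Longrightarrow> \<psi> E R = \<psi> E R' \<circ> L (R, R')"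
  shows "flat L" "minimal_gallery \<H> C g E \<Longrightarrow> monodromy L g = \<psi> E C"
proof -
  have *: "monodromy L g = \<psi> E C" if g: "minimal_gallery \<H> C g E" for C g E
  proof (rule monodromy_potential[OF g])
    have E: "E \<in> regions \<H>" using minimal_gallery_regions[OF g] by blast
    show "\<psi> E E = id" by (rule assms(2)[OF E])
    show "\<psi> E R = \<psi> E R' \<circ> L (R, R')" if "R \<in> regions \<H>" "R' \<in> regions \<H>" "sep_set \<H> R R' = {H}"
      "H \<in> sep_set \<H> R E" for R R' H by (rule assms(3)[OF E that])
  qed
  then show "minimal_gallery \<H> C g E \<Longrightarrow> monodromy L g = \<psi> E C" by blast
  show "flat L" using * assms(1) by (simp add: flat_def)
qed

text \<open>Homotopic loops have equal monodromy, and a trivial \<open>g\<close> leaves only the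
  edge pair of the first loop. The conjugation by \<open>h\<close> is kept, because \<open>h\<close>
  may act nontrivially when it crosses the hyperplane being counted.\<close>

lemma monodromy_ell:
  assumes L: "flat L" and B: "B \<in> regions \<H>" and e: "ascent B H C' C" and f: "ascent B K D' D"
    and eq: "ell \<H> B (C', C) = ell \<H> B (D', D)"
    and g: "minimal_gallery \<H> B g C'" "monodromy L g = id" and h: "minimal_gallery \<H> B h D'"
  shows "L (C, C') \<circ> L (C', C) =
    monodromy L (path_rev h) \<circ> (L (D, D') \<circ> L (D', D)) \<circ> monodromy L h"
    "monodromy L (path_rev h) \<circ> monodromy L h = id"
proof -
  have rev: "monodromy L (path_rev a) \<circ> monodromy L a = id" if "minimal_gallery \<H> B a E" for a E
    using monodromy_homotopic[OF L homotopic_rev_right[OF minimal_gallery_path[OF that]]]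
    by (simp add: monodromy_append)
  have "monodromy L (g @ [Along (C', C), Along (C, C')] @ path_rev g) =
      monodromy L (h @ [Along (D', D), Along (D, D')] @ path_rev h)"
    using eq ell_gallery[OF B e g(1)] ell_gallery[OF B f h] loop_class_eq_iff
      monodromy_homotopic[OF L] by metis
  moreover have "monodromy L (path_rev g) = id" using rev[OF g(1)] g(2) by simp
  ultimately show "L (C, C') \<circ> L (C', C) =
    monodromy L (path_rev h) \<circ> (L (D, D') \<circ> L (D', D)) \<circ> monodromy L h"
    using g(2) by (simp add: monodromy_append comp_assoc)
  show "monodromy L (path_rev h) \<circ> monodromy L h = id" by (rule rev[OF h])
qed

lemma sep_flip:
  assumes "B \<in> regions \<H>" "R \<in> regions \<H>" "R' \<in> regions \<H>" "sep_set \<H> R R' = {M}"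
  shows "X \<in> sep_set \<H> B R' \<longleftrightarrow> (X \<in> sep_set \<H> B R) \<noteq> (X = M)"
  using sep_set_via[OF assms(1-3)] assms(4) by auto

text \<open>The labels count positive crossings of \<open>H\<close>. The first loop crosses
  \<open>H\<close> twice in positive direction; the edge pair of the second crosses only
  \<open>K\<close>, and whatever its outward and returning galleries count cancels.\<close>

lemma ell_determines_hyperplane:
  assumes B: "B \<in> regions \<H>" and e: "ascent B H C' C" and f: "ascent B K D' D"
    and eq: "ell \<H> B (C', C) = ell \<H> B (D', D)"
  shows "H = K"
proof (rule ccontr)
  assume "H \<noteq> K"
  have C: "C' \<in> regions \<H>" "C \<in> regions \<H>" "sep_set \<H> C' C = {H}" "H \<notin> sep_set \<H> B C'"
    using e by (simp_all add: ascent_def)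
  have D: "D' \<in> regions \<H>" "D \<in> regions \<H>" "sep_set \<H> D' D = {K}"
    using f by (simp_all add: ascent_def)
  define L where "L = (\<lambda>(R, R'). if H \<in> sep_set \<H> R R' then (\<lambda>n::int. n + 1) else id)"
  define \<psi> where "\<psi> E R = (if H \<in> sep_set \<H> R E then (\<lambda>n::int. n + 1) else id)" for E R
  have "bij (\<lambda>n::int. n + 1)" by (rule bij_betw_byWitness[of _ "\<lambda>n. n - 1"]) auto
  then have 1: "bij (L r)" for r by (cases r) (simp add: L_def)
  have 2: "\<psi> E E = id" if "E \<in> regions \<H>" for E using sep_refl[OF that] by (simp add: \<psi>_def)
  have 3: "\<psi> E R = \<psi> E R' \<circ> L (R, R')"
    if "E \<in> regions \<H>" "R \<in> regions \<H>" "R' \<in> regions \<H>" "sep_set \<H> R R' = {M}" "M \<in> sep_set \<H> R E" for E R R' M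
  proof -
    have "sep_set \<H> R' E = sep_set \<H> R E - {M}" using sep_step(1)[OF that(2,3,1,4,5)] .
    then show ?thesis using that(4,5) by (auto simp: \<psi>_def L_def)
  qed
  have flat: "flat L" by (rule flatI(1)[of L \<psi>, OF 1 2 3])
  have mon: "monodromy L g = \<psi> E C" if "minimal_gallery \<H> C g E" for C g E
    by (rule flatI(2)[of L \<psi>, OF 1 2 3 that])
  obtain g h where g: "minimal_gallery \<H> B g C'" and h: "minimal_gallery \<H> B h D'"
    using minimal_gallery_exists B C D by metis
  have "monodromy L g = id" using mon[OF g] C(4) by (simp add: \<psi>_def)
  note m = monodromy_ell[OF flat B e f eq g this h]
  have "sep_set \<H> C C' = {H}" "sep_set \<H> D D' = {K}" using C D sep_set_commute by auto
  then have "L (C, C') \<circ> L (C', C) = (\<lambda>n. n + 2)" "L (D, D') \<circ> L (D', D) = id"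
    using C(3) D(3) \<open>H \<noteq> K\<close> by (auto simp: L_def)
  then have "(\<lambda>n::int. n + 2) = id" using m by simp
  then show False by (simp add: fun_eq_iff)
qed

end

text \<open>The pure braid group of three lines \<open>K\<close>, \<open>H\<close>, \<open>L\<close> with \<open>H\<close> between \<open>K\<close> and \<open>L\<close>, mapped onto
  the permutations of three points. A state records which of \<open>K\<close>, \<open>H\<close>, \<open>L\<close> separate a region from
  the base region. Moving away from the base region acts trivially; crossing \<open>H\<close> back acts by
  different transpositions on the two sides of \<open>K\<close>.\<close>

datatype three = P0 | P1 | P2

type_synonym state = "bool \<times> bool \<times> bool"

fun swap01 :: "three \<Rightarrow> three" where "swap01 P0 = P1" | "swap01 P1 = P0" | "swap01 P2 = P2"
fun swap12 :: "three \<Rightarrow> three" where "swap12 P0 = P0" | "swap12 P1 = P2" | "swap12 P2 = P1"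
fun swap02 :: "three \<Rightarrow> three" where "swap02 P0 = P2" | "swap02 P1 = P1" | "swap02 P2 = P0"

text \<open>The normal of \<open>H\<close> is a positive combination of those of \<open>K\<close>
  and \<open>L\<close>, so \<open>H\<close> separates when both do and does not when neither does.
  Six states remain: the regions of three lines, arranged in a hexagon.\<close>

fun valid :: "state \<Rightarrow> bool" where
  "valid (k, h, l) \<longleftrightarrow> (k = l \<longrightarrow> h = k)"

text \<open>Comparing the two half circuits between opposite regions of the hexagon forces one label
  for \<open>K\<close> and one for \<open>L\<close>, and makes the label of \<open>H\<close> before
  \<open>K\<close> the conjugate of the one beyond \<open>K\<close> by the label of
  \<open>K\<close>. The labels \<open>swap12\<close> for \<open>K\<close> and \<open>swap01\<close>
  for \<open>H\<close> beyond \<open>K\<close> are chosen not to commute, so that the conjugate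
  \<open>swap02\<close> is different. For \<open>L\<close> the inverse of
  \<open>swap12 \<circ> swap01\<close> is taken, which makes the return from the farthest region
  trivial on both sides.\<close>

fun back_label :: "state \<Rightarrow> state \<Rightarrow> three \<Rightarrow> three" where
  "back_label (k, h, l) (k', h', l') =
    (if k \<and> \<not> k' then swap12
     else if l \<and> \<not> l' then swap01 \<circ> swap12
     else if h \<and> \<not> h' then (if k then swap01 else swap02)
     else id)"

text \<open>The first argument is the target. The test \<open>valid\<close> discards flips that
  leave the hexagon; between distinct valid states, if neither \<open>K\<close> nor \<open>L\<close>
  can be flipped toward the target, then \<open>H\<close> is the wall to cross.\<close>

fun toward :: "state \<Rightarrow> state \<Rightarrow> state" where
  "toward (k', h', l') (k, h, l) =
    (if k \<noteq> k' \<and> valid (k', h, l) then (k', h, l)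
     else if l \<noteq> l' \<and> valid (k, h, l') then (k, h, l')
     else (k, h', l))"

fun descend :: "nat \<Rightarrow> state \<Rightarrow> state \<Rightarrow> three \<Rightarrow> three" where
  "descend 0 t s = id"
| "descend (Suc n) t s = (if s = t then id else descend n t (toward t s) \<circ> back_label s (toward t s))"

text \<open>Transport along one chosen shortest route; three steps suffice because states have three
  coordinates and each step corrects one.\<close>

definition potential :: "state \<Rightarrow> state \<Rightarrow> three \<Rightarrow> three" where
  "potential = descend (Suc (Suc (Suc 0)))"

lemma three_fun_eq: "f = g \<longleftrightarrow> f P0 = g P0 \<and> f P1 = g P1 \<and> f P2 = g P2"
proof (intro iffI ext)
  show "f x = g x" if "f P0 = g P0 \<and> f P1 = g P1 \<and> f P2 = g P2" for x
    using that by (cases x) auto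
qed auto

text \<open>A finite check on the hexagon containing all that flatness requires. The first
  alternative of the last assumption covers steps across any other hyperplane of the
  arrangement.\<close>

lemma potential_step:
  assumes "valid (k, h, l)" "valid (k', h', l')" "valid (a, b, c)"
    and "(k', h', l') = (k, h, l) \<or> (k', h', l') = (a, h, l) \<or> (k', h', l') = (k, b, l) \<or> (k', h', l') = (k, h, c)"
  shows "potential (a, b, c) (k, h, l) = potential (a, b, c) (k', h', l') \<circ> back_label (k, h, l) (k', h', l')"
  using assms(4)
proof (elim disjE)
  assume "(k', h', l') = (k, h, l)"
  then show ?thesis by simp
next
  assume eq: "(k', h', l') = (a, h, l)"
  have "valid (a, h, l)" using assms(2) eq by (simp only:)
  with assms(1,3) show ?thesis unfolding potential_def eq
    by (cases k; cases h; cases l; cases a; cases b; cases c) (simp_all add: three_fun_eq)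
next
  assume eq: "(k', h', l') = (k, b, l)"
  have "valid (k, b, l)" using assms(2) eq by (simp only:)
  with assms(1,3) show ?thesis unfolding potential_def eq
    by (cases k; cases h; cases l; cases a; cases b; cases c) (simp_all add: three_fun_eq)
next
  assume eq: "(k', h', l') = (k, h, c)"
  have "valid (k, h, c)" using assms(2) eq by (simp only:)
  with assms(1,3) show ?thesis unfolding potential_def eq
    by (cases k; cases h; cases l; cases a; cases b; cases c) (simp_all add: three_fun_eq)
qed

lemma bij_back_label: "bij (back_label s t)"
proof -
  have "bij swap01" "bij swap12" "bij swap02"
    by (rule o_bij[of swap01], simp_all add: three_fun_eq)
      (rule o_bij[of swap12] o_bij[of swap02]; simp add: three_fun_eq)+
  then show ?thesis by (cases "(s, t)" rule: back_label.cases) (auto intro: bij_comp)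
qed

section \<open>Telling apart loops on the two sides of a cutting hyperplane\<close>

context central begin

lemma sep_iff_neg:
  assumes "B \<in> regions \<H>" "R \<in> regions \<H>" "K \<in> \<H>" "x \<in> R"
  shows "K \<in> sep_set \<H> B R \<longleftrightarrow> orient B K \<bullet> x < 0" "orient B K \<bullet> x \<noteq> 0"
  using pos_iff[OF assms(2-4)] nrm_region[OF assms(2-4)] assms(3)
  by (auto simp: sep_set_eq[OF assms(1,2)] orient_def)

text \<open>Galleries from \<open>B\<close> act trivially, so equal loops would force the labels for
  recrossing \<open>H\<close> on the two sides of \<open>K\<close> to be equal, that is
  \<open>swap02 = swap01\<close>.\<close>

lemma ell_neq_across:
  assumes B: "B \<in> regions \<H>" and KHL: "K \<in> \<H>" "H \<in> \<H>" "L \<in> \<H>" "K \<noteq> H" "L \<noteq> H" "L \<noteq> K"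
    and comb: "orient B H = a *\<^sub>R orient B K + b *\<^sub>R orient B L" "0 < a" "0 < b"
    and e: "ascent B H C' C" and f: "ascent B H D' D"
    and KC: "K \<notin> sep_set \<H> B C'" and KD: "K \<in> sep_set \<H> B D'"
  shows "ell \<H> B (C', C) \<noteq> ell \<H> B (D', D)"
proof
  assume eq: "ell \<H> B (C', C) = ell \<H> B (D', D)"
  have C: "C' \<in> regions \<H>" "C \<in> regions \<H>" "sep_set \<H> C' C = {H}" "H \<notin> sep_set \<H> B C'"
    using e by (simp_all add: ascent_def)
  have D: "D' \<in> regions \<H>" "D \<in> regions \<H>" "sep_set \<H> D' D = {H}" "H \<notin> sep_set \<H> B D'"
    using f by (simp_all add: ascent_def)
  define \<tau> where "\<tau> R = (K \<in> sep_set \<H> B R, H \<in> sep_set \<H> B R, L \<in> sep_set \<H> B R)" for R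
  define lab where "lab = (\<lambda>(R, R'). back_label (\<tau> R) (\<tau> R'))"
  define \<psi> where "\<psi> E R = potential (\<tau> E) (\<tau> R)" for E R
  have valid: "valid (\<tau> R)" if R: "R \<in> regions \<H>" for R
  proof -
    obtain x where x: "x \<in> R" using region_nonempty R by blast
    have "orient B H \<bullet> x = a * (orient B K \<bullet> x) + b * (orient B L \<bullet> x)"
      by (simp add: comb(1) inner_add_left)
    moreover note sep_iff_neg[OF B R _ x]
    moreover have "0 < a * u + b * v" if "0 < u" "0 < v" for u v
      using that comb(2,3) by (simp add: add_pos_pos)
    moreover have "a * u + b * v < 0" if "u < 0" "v < 0" for u v
      using that comb(2,3) by (simp add: add_neg_neg mult_pos_neg)
    ultimately show ?thesis using KHL by (auto simp: \<tau>_def) (smt (verit))+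
  qed
  have 1: "bij (lab r)" for r by (cases r) (simp add: lab_def bij_back_label)
  have 2: "\<psi> E E = id" for E by (simp add: \<psi>_def potential_def)
  have 3: "\<psi> E R = \<psi> E R' \<circ> lab (R, R')"
    if R: "E \<in> regions \<H>" "R \<in> regions \<H>" "R' \<in> regions \<H>" "sep_set \<H> R R' = {M}" "M \<in> sep_set \<H> R E" for E R R' M
  proof -
    note flip = sep_flip[OF B R(2,3,4)]
    have "M \<in> sep_set \<H> B E \<longleftrightarrow> M \<notin> sep_set \<H> B R" using sep_set_via[OF B R(2,1)] R(5) by blast
    \<comment> \<open>A step toward \<open>E\<close> changes at most one coordinate of the state,
      and sets it to its value at \<open>E\<close>.\<close>
    then have "\<tau> R' = \<tau> R \<or> \<tau> R' = (fst (\<tau> E), snd (\<tau> R)) \<or>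
        \<tau> R' = (fst (\<tau> R), fst (snd (\<tau> E)), snd (snd (\<tau> R))) \<or>
        \<tau> R' = (fst (\<tau> R), fst (snd (\<tau> R)), snd (snd (\<tau> E)))"
      using KHL(4-6) unfolding \<tau>_def flip by auto
    then show ?thesis
      using potential_step[of "fst (\<tau> R)" "fst (snd (\<tau> R))" "snd (snd (\<tau> R))"
          "fst (\<tau> R')" "fst (snd (\<tau> R'))" "snd (snd (\<tau> R'))"
          "fst (\<tau> E)" "fst (snd (\<tau> E))" "snd (snd (\<tau> E))"]
        valid[OF R(1)] valid[OF R(2)] valid[OF R(3)]
      by (simp add: \<psi>_def lab_def)
  qed
  have flat: "flat lab" by (rule flatI(1)[of lab \<psi>, OF 1 2 3])
  have mon: "monodromy lab g = \<psi> E C" if "minimal_gallery \<H> C g E" for C g E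
    by (rule flatI(2)[of lab \<psi>, OF 1 2 3 that])
  obtain g h where g: "minimal_gallery \<H> B g C'" and h: "minimal_gallery \<H> B h D'"
    using minimal_gallery_exists B C D by metis
  have tB: "\<tau> B = (False, False, False)" by (simp add: \<tau>_def sep_refl[OF B])
  \<comment> \<open>Crossing \<open>H\<close> alone keeps both states valid only if exactly one of
    \<open>K\<close> and \<open>L\<close> separates from \<open>B\<close>, which determines the
    third coordinate.\<close>
  have tC': "\<tau> C' = (False, False, True)" and tC: "\<tau> C = (False, True, True)"
    using valid[OF C(1)] valid[OF C(2)] KC C(4) KHL(4-6) unfolding \<tau>_def sep_flip[OF B C(1-3)] by auto
  have tD': "\<tau> D' = (True, False, False)" and tD: "\<tau> D = (True, True, False)"
    using valid[OF D(1)] valid[OF D(2)] KD D(4) KHL(4-6) unfolding \<tau>_def sep_flip[OF B D(1-3)] by auto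
  have mg: "monodromy lab g = id"
    by (simp add: mon[OF g] \<psi>_def tB tC' potential_def)
  have mh: "monodromy lab h = id"
    by (simp add: mon[OF h] \<psi>_def tB tD' potential_def)
  have "swap02 = swap01"
    using monodromy_ell[OF flat B e f eq g mg h] mh by (simp add: lab_def tC tC' tD tD')
  then show False by (simp add: three_fun_eq)
qed

text \<open>In the rank two family where \<open>K\<close> cuts \<open>H\<close>, the latter is not
  basic and so lies between \<open>K\<close> and some \<open>L\<close>. If \<open>K\<close>
  separated the facets, \<open>ell_neq_across\<close> would apply in one order or the other.\<close>

lemma ell_determines_sides:
  assumes B: "B \<in> regions \<H>" and e: "ascent B H C' C" and f: "ascent B H D' D"
    and c: "through \<H> c = {H}" "c \<in> closure C'" and d: "through \<H> d = {H}" "d \<in> closure D'"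
    and eq: "ell \<H> B (C', C) = ell \<H> B (D', D)" and K: "K \<in> cutters B H"
  shows "0 < (nrm K \<bullet> c) * (nrm K \<bullet> d)"
proof -
  have KH: "K \<in> \<H>" "K \<noteq> H" using K cuts_neq by (auto simp: cutters_def)
  obtain \<A> where A: "full_rank2 \<H> \<A>" "K \<in> \<A>" "H \<in> \<A>" "\<not> basic \<A> B H"
    using K by (auto simp: cutters_def cuts_def)
  have sub: "\<A> \<subseteq> \<H>" using A(1) by (auto simp: full_rank2_def)
  obtain u v where two: "\<forall>K\<in>\<A>. nrm K \<in> span {u, v}"
    using full_rank2_span[OF central_axioms A(1)] by blast
  have no: "nrm H \<bullet> z = 0 \<Longrightarrow> \<not> (\<forall>K\<in>\<A> - {H}. 0 < orient B K \<bullet> z)" for z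
    using basicI[OF B sub A(3)] A(4) by blast
  obtain L a b where L: "L \<in> \<A>" "L \<noteq> H" "L \<noteq> K" "0 < a" "0 < b"
    "orient B H = a *\<^sub>R orient B K + b *\<^sub>R orient B L"
    by (rule nonbasic_combination[OF B sub two A(3,2) KH(2) no])
  have HL: "H \<in> \<H>" "L \<in> \<H>" using A(3) L(1) sub by blast+
  note neq = ell_neq_across[OF B KH(1) HL KH(2) L(2,3,6,4,5)]
  have "(K \<in> sep_set \<H> B C') = (K \<in> sep_set \<H> B D')"
    using neq[OF e f] neq[OF f e] eq by metis
  moreover have C: "C' \<in> regions \<H>" and D: "D' \<in> regions \<H>" using e f by (simp_all add: ascent_def)
  ultimately have "pos C' K = pos D' K" using KH(1) by (auto simp: sep_set_eq[OF B C] sep_set_eq[OF B D])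
  moreover have nz: "nrm K \<bullet> c \<noteq> 0" "nrm K \<bullet> d \<noteq> 0"
    using cutters_off_facet[OF c(1) K] cutters_off_facet[OF d(1) K] .
  ultimately have "(0 < nrm K \<bullet> c) = (0 < nrm K \<bullet> d)"
    using closure_pos[OF C c(2) KH(1) nz(1)] closure_pos[OF D d(2) KH(1) nz(2)] by simp
  then show ?thesis using nz by (auto simp: zero_less_mult_iff neq_iff)
qed

theorem ell_eq_iff_edge_shard_eq:
  assumes B: "B \<in> regions \<H>" and e: "ascent B H C' C" and f: "ascent B K D' D"
  shows "ell \<H> B (C', C) = ell \<H> B (D', D) \<longleftrightarrow> edge_shard \<H> B (C', C) = edge_shard \<H> B (D', D)"
proof -
  have C: "C' \<in> regions \<H>" "C \<in> regions \<H>" "sep_set \<H> C' C = {H}" using e by (simp_all add: ascent_def)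
  have D: "D' \<in> regions \<H>" "D \<in> regions \<H>" "sep_set \<H> D' D = {K}" using f by (simp_all add: ascent_def)
  obtain c where c: "through \<H> c = {H}" "c \<in> closure C'" "c \<in> closure C" by (rule facet_point[OF C])
  obtain d where d: "through \<H> d = {K}" "d \<in> closure D'" "d \<in> closure D" by (rule facet_point[OF D])
  note shards = edge_shard_eq[OF e c(1,2)] edge_shard_eq[OF f d(1,2)]
  show ?thesis
  proof
    assume eq: "ell \<H> B (C', C) = ell \<H> B (D', D)"
    have HK: "H = K" by (rule ell_determines_hyperplane[OF B e f eq])
    have "(0 < (nrm M \<bullet> c) * (nrm M \<bullet> y)) = (0 < (nrm M \<bullet> d) * (nrm M \<bullet> y))" if "M \<in> cutters B H" for M y
      using ell_determines_sides[OF B e f[folded HK] c(1,2) d(1)[folded HK] d(2) eq that]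
      by (auto simp: zero_less_mult_iff)
    then have "shard_cell B H c = shard_cell B K d" unfolding shard_cell_def HK[symmetric] by auto
    then show "edge_shard \<H> B (C', C) = edge_shard \<H> B (D', D)" using shards by simp
  next
    assume "edge_shard \<H> B (C', C) = edge_shard \<H> B (D', D)"
    then have sub: "closure C' \<inter> closure C \<subseteq> closure (shard_cell B K d)"
      using shards facet_subset_shard[OF e c(1,2)] by simp
    have "K \<in> through \<H> d" by (simp add: d(1))
    then have K: "K \<in> \<H>" by (simp add: through_iff)
    have off: "\<forall>M\<in>cutters B K. nrm M \<bullet> d \<noteq> 0" using cutters_off_facet[OF d(1)] by blast
    note F = facet_in_shard[OF e c(1,2) K off sub]
    show "ell \<H> B (C', C) = ell \<H> B (D', D)"
    proof (rule ell_same_shard[OF B e _ c(1,2)])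
      show "ascent B H D' D" "through \<H> d = {H}" "d \<in> closure D'" using f d F(1) by simp_all
      show "0 < (nrm M \<bullet> c) * (nrm M \<bullet> d)" if "M \<in> \<H>" "cuts \<H> B M H" for M
        using F(2) that by (auto simp: cutters_def mult.commute)
    qed
  qed
qed

end

theorem theorem1p1:
  fixes \<H> :: "(real ^ 'n) set set" and B C C' D D' :: "(real ^ 'n) set"
  assumes "central_arrangement \<H>"
    and "irreducible_arrangement \<H>"
    and "B \<in> regions \<H>"
    and "weak_cover \<H> B C' C"
    and "weak_cover \<H> B D' D"
  shows "ell \<H> B (C', C) = ell \<H> B (D', D) \<longleftrightarrow>
         edge_shard \<H> B (C', C) = edge_shard \<H> B (D', D)"
proof -
  interpret central \<H> by (rule central.intro[OF assms(1)])
  obtain H K where "ascent B H C' C" "ascent B K D' D"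
    using weak_cover_ascent[OF assms(3)] assms(4,5) by metis
  then show ?thesis by (rule ell_eq_iff_edge_shard_eq[OF assms(3)])
qed

end
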